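(* Let $\mathcal{F}=\{\mathcal{F}_\lambda\}_{\lambda\in\mathbb{N}}$, equipped with a distribution $\mathcal{D}_{\mathcal F}$, be a preimage-samplable evasive function class with input length $n=n(\lambda)$, and let $(\mathcal{D},\mathfrak{C}^{\mathcal F})$, $\mathfrak{C}^{\mathcal F}=\{C^{\mathcal F}_k\}$, be the corresponding keyed circuit implementation of $(\mathcal{D}_{\mathcal F},\mathcal{F})$ for the preimage-samplability condition. Assume that $\mathsf{UPO}=(\mathsf{Obf},\mathsf{Eval})$ is a generalized unclonable puncturable obfuscation scheme, with respect to the challenge distribution $\mathsf{Id}_{\mathcal U}$, for any generalized puncturable keyed circuit class in $\mathsf{P/poly}$. Then there is a copy-protection scheme for $\mathcal{F}$, with $\mathsf{CopyProtect}(\cdot)$ equal to $\mathsf{UPO.Obf}(\cdot)$, satisfying $(\mathcal{D}_{\mathcal F},\mathcal{D}_{\mathsf{identical}})$-anti-piracy with respect to $\mathfrak{C}^{\mathcal F}$ as keyed circuit implementation of $\mathcal{F}$ and $(\mathcal{D},\mathfrak{C}^{\mathcal F})$ as keyed circuit implementation of $(\mathcal{D}_{\mathcal F},\mathcal{F})$. Here $\mathcal{D}_{\mathsf{identical}}$ is the following distribution on pairs of inputs, depending on the copy-protected circuit $C^{\mathcal F}_k$: with probability $\frac12$ output $(x,x)$ with $x$ uniform in $\{0,1\}^n$; with probability $\frac12$ output $(x,x)$ with $x$ uniform in $(C^{\mathcal F}_k)^{-1}(1)$.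
   Context: QPT means quantum polynomial time; $\approx_c$ is computational indistinguishability against QPT adversaries. **Keyed circuit class.** $\mathfrak{C}=\{\mathfrak{C}_\lambda\}$, $\mathfrak{C}_\lambda=\{C_k:k\in\mathcal{K}_\lambda\}$, polynomial-size classical circuits of the same size, input length $n(\lambda)$, output length $m(\lambda)$. It is *generalized puncturable* if equipped with an efficient $\mathsf{GenPuncture}$ which on $k$, points $x^{\mathcal B},x^{\mathcal C}$ and poly-size circuits $\mu_{\mathcal B},\mu_{\mathcal C}:\{0,1\}^n\to\{0,1\}^m$ outputs a circuit $G_{k^*}$ (of the same size as $C_k$) such that $G_{k^*}(x)=C_k(x)$ for $x\notin\{x^{\mathcal B},x^{\mathcal C}\}$, $G_{k^*}(x^{\mathcal B})=\mu_{\mathcal B}(x^{\mathcal B})$ and, if $x^{\mathcal C}\ne x^{\mathcal B}$, $G_{k^*}(x^{\mathcal C})=\mu_{\mathcal C}(x^{\mathcal C})$. **Generalized UPO.** QPT algorithms $\mathsf{Obf}(1^\lambda,C)\to\rho_C$ and $\mathsf{Eval}(\rho_C,x)\to(\rho'_C,y)$ with $y=C(x)$ except with negligible probability, such that for every QPT $(\mathcal{A},\mathcal{B},\mathcal{C})$ the following experiment with uniform $b\in\{0,1\}$ outputs 1 with probability at most $\frac12+\mathsf{negl}(\lambda)$: $\mathcal{A}$ sends $(k,\mu_{\mathcal B},\mu_{\mathcal C})$; the challenger samples $(x^{\mathcal B},x^{\mathcal C})\leftarrow\mathcal{D}_{\mathcal X}(1^\lambda)$, computes $G_{k^*}\leftarrow\mathsf{GenPuncture}(k,x^{\mathcal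 B},x^{\mathcal C},\mu_{\mathcal B},\mu_{\mathcal C})$ and sends $\mathcal{A}$ the state $\mathsf{Obf}(1^\lambda,C_k)$ if $b=0$, $\mathsf{Obf}(1^\lambda,G_{k^*})$ if $b=1$; $\mathcal{A}$ outputs a bipartite state $\sigma$; $(\mathcal{B}(x^{\mathcal B},\cdot)\otimes\mathcal{C}(x^{\mathcal C},\cdot))(\sigma)$ gives $(b_{\mathcal B},b_{\mathcal C})$; output 1 iff $b_{\mathcal B}=b_{\mathcal C}=b$. The challenge distribution $\mathcal{D}_{\mathcal X}=\mathsf{Id}_{\mathcal U}$ samples $x$ uniformly in $\{0,1\}^n$ and outputs $(x,x)$. **Keyed circuit implementation.** $\mathfrak{C}$ implements $\mathcal{F}$ if the map $S_\lambda$ sending a circuit to its functionality maps $\mathfrak{C}_\lambda$ onto $\mathcal{F}_\lambda$. With an efficiently samplable distribution $\mathcal{D}$ on keys, $(\mathcal{D},\mathfrak{C})$ implements $(\mathcal{D}_{\mathcal F},\mathcal{F})$ if moreover $\{S_\lambda(C_k)\}_{k\leftarrow\mathcal{D}(1^\lambda)}\approx\{f\}_{f\leftarrow\mathcal{D}_{\mathcal F}(1^\lambda)}$. **Evasive.** A class of boolean functions on $n(\lambda)$ bits is evasive with respect to an efficiently samplable $\mathcal{D}_{\mathcal F}$ if for every fixed $x$, $\Pr_{f\leftarrow\mathcal{D}_{\mathcal F}(1^\lambda)}[f(x)=1]$ is negligible. **Preimage-samplable evasive.** An evasive $(\mathcal{D}_{\mathcal F},\mathcal{F})$ such that (1) there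 is a keyed circuit implementation $(\mathcal{D},\mathfrak{C}^{\mathcal F}=\{C^{\mathcal F}_k\}_{k\in\mathcal{K}})$ of $(\mathcal{D}_{\mathcal F},\mathcal{F})$; (2) there is an auxiliary generalized puncturable keyed circuit class $\mathfrak{C}=\{C_{k'}\}_{k'\in\mathcal{K}'}$ with generalized puncturing algorithm $\mathsf{P}$ and an efficiently samplable distribution $\mathcal{D}'$ on $\mathcal{K}'$ such that $$\{(C^{\mathcal F}_k,x)\}_{k\leftarrow\mathcal{D}(1^\lambda),\,x\leftarrow (C^{\mathcal F}_k)^{-1}(1)\text{ uniform}}\approx_c\{(C_{k',y,\vec 1},y)\}_{k'\leftarrow\mathcal{D}'(1^\lambda),\,y\leftarrow\{0,1\}^n\text{ uniform},\,C_{k',y,\vec 1}\leftarrow\mathsf{P}(k',y,y,\vec1,\vec1)},$$ with $\vec 1$ the constant-1 function. **Copy-protection.** For $\mathcal{F}$ with keyed circuit implementation $\mathfrak{C}$: QPT algorithms $\mathsf{CopyProtect}(1^\lambda,C)\to\rho_C$ and $\mathsf{Eval}(\rho_C,x)\to(\rho'_C,y)$ with, for every $C\in\mathfrak{C}_\lambda$ and $x$, $y=C(x)$ except with negligible probability. $(\mathcal{D}_{\mathcal F},\mathcal{D}_{\mathcal X})$-anti-piracy with respect to an implementation $(\mathcal{D},\mathfrak{C})$ of $(\mathcal{D}_{\mathcal F},\mathcal{F})$: for every QPT $(\mathcal{A},\mathcal{B},\mathcal{C})$ the following experiment outputs 1 with probability at most $p_{\mathsf{triv}}+\mathsf{negl}(\lambda)$: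 $k\leftarrow\mathcal{D}(1^\lambda)$, $\mathcal{A}$ gets $\mathsf{CopyProtect}(1^\lambda,C_k)$ and outputs a bipartite state $\sigma$; $(x^{\mathcal B},x^{\mathcal C})\leftarrow\mathcal{D}_{\mathcal X}$ (which may depend on $C_k$); $(\mathcal{B}(x^{\mathcal B},\cdot)\otimes\mathcal{C}(x^{\mathcal C},\cdot))(\sigma)$ gives $(y^{\mathcal B},y^{\mathcal C})$; output 1 iff $y^{\mathcal B}=C_k(x^{\mathcal B})$ and $y^{\mathcal C}=C_k(x^{\mathcal C})$. Here $p_{\mathsf{triv}}=\max\{p_{\mathsf B},p_{\mathsf C}\}$, where $p_{\mathsf B}$ is the maximal success probability when $\mathcal{A}$ gives the copy-protected state to $\mathcal{B}$ and $\mathcal{C}$ outputs its best guess without it, and $p_{\mathsf C}$ is defined symmetrically. *)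

theory Defs
  imports
    "HOL-Probability.SPMF"
    "HOL-Library.Landau_Symbols"
    "HOL-Library.FuncSet"
    "HOL-Library.Monad_Syntax"
    "HOL-Computational_Algebra.Polynomial"
begin

section \<open>Boolean circuits\<close>

type_synonym bits = "bool list"

definition cube :: "nat \<Rightarrow> bits set" where
  "cube n = {x. length x = n}"

datatype wire = Inp nat | Gate nat

datatype gate = Const bool | Nand wire wire

datatype circuit = Circuit (inputs: nat) (gates: "gate list") (outputs: "wire list")

fun wire_val :: "bits \<Rightarrow> bits \<Rightarrow> wire \<Rightarrow> bool" where
  "wire_val x vs (Inp i) = x ! i"
| "wire_val x vs (Gate j) = vs ! j"

fun gate_val :: "bits \<Rightarrow> bits \<Rightarrow> gate \<Rightarrow> bool" where
  "gate_val x vs (Const b) = b"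
| "gate_val x vs (Nand u v) = (\<not> (wire_val x vs u \<and> wire_val x vs v))"

definition ceval :: "circuit \<Rightarrow> bits \<Rightarrow> bits" where
  "ceval C x =
    map (wire_val x (foldl (\<lambda>vs g. vs @ [gate_val x vs g]) [] (gates C))) (outputs C)"

definition csize :: "circuit \<Rightarrow> nat" where
  "csize C = length (gates C)"

text \<open>In gate number \<open>j\<close>, only inputs and gates with a smaller number may be referred to.\<close>

fun wire_ok :: "nat \<Rightarrow> nat \<Rightarrow> wire \<Rightarrow> bool" where
  "wire_ok n j (Inp i) = (i < n)"
| "wire_ok n j (Gate i) = (i < j)"

fun gate_ok :: "nat \<Rightarrow> nat \<Rightarrow> gate \<Rightarrow> bool" where
  "gate_ok n j (Const b) = True"
| "gate_ok n j (Nand u v) = (wire_ok n j u \<and> wire_ok n j v)"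

definition circuits :: "nat \<Rightarrow> nat \<Rightarrow> circuit set" where
  "circuits n m = {C. inputs C = n \<and> length (outputs C) = m \<and>
     (\<forall>j < csize C. gate_ok n j (gates C ! j)) \<and>
     (\<forall>w \<in> set (outputs C). wire_ok n (csize C) w)}"

definition functionality :: "circuit \<Rightarrow> bits \<Rightarrow> bits" where
  "functionality C = restrict (ceval C) (cube (inputs C))"

definition preimage_one :: "circuit \<Rightarrow> bits set" where
  "preimage_one C = {x \<in> cube (inputs C). ceval C x = [True]}"

definition const_one :: "nat \<Rightarrow> circuit" where
  "const_one n = Circuit n [Const True] [Gate 0]"

subsection \<open>Descriptions of circuits as bit strings\<close>

definition unary :: "nat \<Rightarrow> bits" where
  "unary k = replicate k True @ [False]"

fun encode_wire :: "wire \<Rightarrow> bits" where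
  "encode_wire (Inp i) = True # unary i"
| "encode_wire (Gate j) = False # unary j"

fun encode_gate :: "gate \<Rightarrow> bits" where
  "encode_gate (Const b) = [False, b]"
| "encode_gate (Nand u v) = True # encode_wire u @ encode_wire v"

fun encode :: "circuit \<Rightarrow> bits" where
  "encode (Circuit n gs ws) = unary n
     @ unary (length gs) @ concat (map encode_gate gs)
     @ unary (length ws) @ concat (map encode_wire ws)"

lemma unary_prefix_free: "unary a @ s = unary b @ t \<longleftrightarrow> a = b \<and> s = t"
proof (induction a arbitrary: b)
  case 0 show ?case by (cases b) (auto simp: unary_def)
next
  case (Suc a) show ?case using Suc[of "b - 1"] by (cases b) (auto simp: unary_def)
qed

lemma encode_wire_prefix_free:
  "encode_wire v @ s = encode_wire w @ t \<longleftrightarrow> v = w \<and> s = t"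
  by (cases v; cases w) (auto simp: unary_prefix_free)

lemma encode_gate_prefix_free:
  "encode_gate g @ s = encode_gate h @ t \<longleftrightarrow> g = h \<and> s = t"
  by (cases g; cases h) (auto simp: encode_wire_prefix_free)

lemma concat_prefix_free:
  assumes "\<And>a b s t. f a @ s = f b @ t \<longleftrightarrow> a = b \<and> s = t"
  shows "length as = length bs \<Longrightarrow>
    concat (map f as) @ s = concat (map f bs) @ t \<longleftrightarrow> as = bs \<and> s = t"
  by (induction as bs rule: list_induct2) (auto simp: assms)

lemma inj_encode: "inj encode"
proof (rule injI)
  fix C D assume eq: "encode C = encode D"
  obtain n gs ws where C: "C = Circuit n gs ws" by (cases C)
  obtain n' gs' ws' where D: "D = Circuit n' gs' ws'" by (cases D)
  have n: "n = n'" and l: "length gs = length gs'"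
    and r: "concat (map encode_gate gs) @ unary (length ws) @ concat (map encode_wire ws)
      = concat (map encode_gate gs') @ unary (length ws') @ concat (map encode_wire ws')"
    using eq by (auto simp: C D unary_prefix_free)
  have gs: "gs = gs'" and m: "length ws = length ws'"
    and "concat (map encode_wire ws) = concat (map encode_wire ws')"
    using r by (auto simp: unary_prefix_free
        concat_prefix_free[where f = encode_gate, OF encode_gate_prefix_free l])
  then have "ws = ws'"
    using concat_prefix_free[where f = encode_wire, OF encode_wire_prefix_free m, of "[]" "[]"]
    by simp
  then show "C = D" using n gs by (simp add: C D)
qed

definition decode :: "bits \<Rightarrow> circuit" where
  "decode = inv encode"

section \<open>Quantum algorithms\<close>

text \<open>
  The model of computation is a uniform one: an algorithm is a single structured program for a
  machine with finitely many bit stacks and finitely many stacks of qubits.  On the classical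
  side this is a multi-tape Turing machine (a tape being two stacks) with random coins; on the
  quantum side the gate set is H, T, CNOT together with computational basis measurements.

  Qubits are named by natural numbers.  A joint pure state of all qubits is an amplitude
  function on finite sets of names: \<open>S\<close> stands for the basis vector in which exactly the qubits
  in \<open>S\<close> are 1.  All names \<open>\<ge> fresh\<close> are unused, and these qubits are 0.  Programs never see
  names: they can touch exactly the qubits lying on their own stacks.  This is
  what makes it sound to run the parties of an experiment one after the other on a common
  (entangled) pure state.  Mixed states arise as distributions on pure states, by measurements.
\<close>

record qmem =
  ket :: "nat set \<Rightarrow> complex"
  fresh :: nat

definition vacuum :: qmem where
  "vacuum = \<lparr>ket = (\<lambda>S. if S = {} then 1 else 0), fresh = 0\<rparr>"

definition valid_qmem :: "qmem \<Rightarrow> bool" where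
  "valid_qmem q \<longleftrightarrow>
     (\<forall>S. ket q S \<noteq> 0 \<longrightarrow> S \<subseteq> {..<fresh q}) \<and>
     (\<Sum>S \<in> Pow {..<fresh q}. (cmod (ket q S))\<^sup>2) = 1"

definition hadamard :: "nat \<Rightarrow> (nat set \<Rightarrow> complex) \<Rightarrow> nat set \<Rightarrow> complex" where
  "hadamard i \<psi> = (\<lambda>S.
     (\<psi> (S - {i}) + (if i \<in> S then - 1 else 1) * \<psi> (insert i S)) / complex_of_real (sqrt 2))"

definition tgate :: "nat \<Rightarrow> (nat set \<Rightarrow> complex) \<Rightarrow> nat set \<Rightarrow> complex" where
  "tgate i \<psi> = (\<lambda>S. (if i \<in> S then cis (pi / 4) else 1) * \<psi> S)"

definition cnot :: "nat \<Rightarrow> nat \<Rightarrow> (nat set \<Rightarrow> complex) \<Rightarrow> nat set \<Rightarrow> complex" where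
  "cnot c t \<psi> = (\<lambda>S. \<psi> (if c \<in> S \<and> c \<noteq> t then (if t \<in> S then S - {t} else insert t S) else S))"

definition prob_one :: "nat \<Rightarrow> qmem \<Rightarrow> real" where
  "prob_one i q = (\<Sum>S \<in> {S \<in> Pow {..<fresh q}. i \<in> S}. (cmod (ket q S))\<^sup>2)"

definition collapse :: "nat \<Rightarrow> bool \<Rightarrow> qmem \<Rightarrow> qmem" where
  "collapse i b q = q\<lparr>ket := (\<lambda>S. if (i \<in> S) = b
     then ket q S / complex_of_real (sqrt (if b then prob_one i q else 1 - prob_one i q)) else 0)\<rparr>"

definition measure_qubit :: "nat \<Rightarrow> qmem \<Rightarrow> (bool \<times> qmem) spmf" where
  "measure_qubit i q =
     map_spmf (\<lambda>b. (b, collapse i b q)) (spmf_of_pmf (bernoulli_pmf (prob_one i q)))"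

type_synonym reg = nat

datatype test =
    Top reg        \<comment> \<open>the bit stack is nonempty and its top is 1\<close>
  | NonEmpty reg
  | QNonEmpty reg

datatype prog =
    Skip
  | Push reg bool
  | Pop reg
  | Copy reg reg   \<comment> \<open>overwrite the second bit stack by the first\<close>
  | Coin reg       \<comment> \<open>push a uniformly random bit\<close>
  | New reg        \<comment> \<open>push a new qubit in state 0\<close>
  | Move reg reg   \<comment> \<open>move the top qubit of the first stack to the second one\<close>
  | Had reg
  | Tee reg
  | Cnot reg reg   \<comment> \<open>control: top of the first stack, target: top of the second one\<close>
  | Measure reg reg \<comment> \<open>pop a qubit from the first stack, push the outcome on the second (bit) stack\<close>
  | Seq prog prog
  | Branch test prog prog
  | While test prog

record config =
  creg :: "reg \<Rightarrow> bits"
  qreg :: "reg \<Rightarrow> nat list"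
  qmem_of :: qmem
  steps :: nat

fun holds :: "test \<Rightarrow> config \<Rightarrow> bool" where
  "holds (Top r) s = (creg s r \<noteq> [] \<and> hd (creg s r))"
| "holds (NonEmpty r) s = (creg s r \<noteq> [])"
| "holds (QNonEmpty r) s = (qreg s r \<noteq> [])"

definition tick :: "nat \<Rightarrow> config \<Rightarrow> config" where
  "tick t s = s\<lparr>steps := steps s + t\<rparr>"

definition set_creg :: "reg \<Rightarrow> bits \<Rightarrow> config \<Rightarrow> config" where
  "set_creg r w s = s\<lparr>creg := (creg s)(r := w)\<rparr>"

definition set_qreg :: "reg \<Rightarrow> nat list \<Rightarrow> config \<Rightarrow> config" where
  "set_qreg r is s = s\<lparr>qreg := (qreg s)(r := is)\<rparr>"

definition apply_ket :: "((nat set \<Rightarrow> complex) \<Rightarrow> nat set \<Rightarrow> complex) \<Rightarrow> config \<Rightarrow> config" where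
  "apply_ket U s = s\<lparr>qmem_of := (qmem_of s)\<lparr>ket := U (ket (qmem_of s))\<rparr>\<rparr>"

definition alloc :: "reg \<Rightarrow> config \<Rightarrow> config" where
  "alloc r s = s\<lparr>qreg := (qreg s)(r := fresh (qmem_of s) # qreg s r),
                 qmem_of := (qmem_of s)\<lparr>fresh := fresh (qmem_of s) + 1\<rparr>\<rparr>"

partial_function (spmf) while_spmf :: "('s \<Rightarrow> bool) \<Rightarrow> ('s \<Rightarrow> 's spmf) \<Rightarrow> 's \<Rightarrow> 's spmf" where
  "while_spmf b f s =
     (if b s then bind_spmf (f s) (\<lambda>s'. while_spmf b f s') else return_spmf s)"

text \<open>
  Nontermination is missing probability mass.  Every instruction and every evaluation of a test
  takes one step, except that copying costs the length of the string in addition.  Instructions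
  that need the top of an empty stack do nothing.
\<close>

primrec exec :: "prog \<Rightarrow> config \<Rightarrow> config spmf" where
  "exec Skip s = return_spmf (tick 1 s)"
| "exec (Push r b) s = return_spmf (tick 1 (set_creg r (b # creg s r) s))"
| "exec (Pop r) s = return_spmf (tick 1 (set_creg r (tl (creg s r)) s))"
| "exec (Copy r r') s =
     return_spmf (tick (1 + length (creg s r)) (set_creg r' (creg s r) s))"
| "exec (Coin r) s =
     map_spmf (\<lambda>b. tick 1 (set_creg r (b # creg s r) s)) coin_spmf"
| "exec (New r) s = return_spmf (tick 1 (alloc r s))"
| "exec (Move r r') s = return_spmf (tick 1 (case qreg s r of [] \<Rightarrow> s
     | i # is \<Rightarrow> (let s' = set_qreg r is s in set_qreg r' (i # qreg s' r') s')))"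
| "exec (Had r) s = return_spmf (tick 1 (case qreg s r of [] \<Rightarrow> s
     | i # _ \<Rightarrow> apply_ket (hadamard i) s))"
| "exec (Tee r) s = return_spmf (tick 1 (case qreg s r of [] \<Rightarrow> s
     | i # _ \<Rightarrow> apply_ket (tgate i) s))"
| "exec (Cnot r r') s = return_spmf (tick 1 (case (qreg s r, qreg s r') of
       (i # _, j # _) \<Rightarrow> apply_ket (cnot i j) s
     | _ \<Rightarrow> s))"
| "exec (Measure r r') s = (case qreg s r of [] \<Rightarrow> return_spmf (tick 1 s)
     | i # is \<Rightarrow> map_spmf
         (\<lambda>(b, q). tick 1 (set_creg r' (b # creg s r') (set_qreg r is (s\<lparr>qmem_of := q\<rparr>))))
         (measure_qubit i (qmem_of s)))"
| "exec (Seq c d) s = bind_spmf (exec c s) (exec d)"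
| "exec (Branch t c d) s = (if holds t s then exec c (tick 1 s) else exec d (tick 1 s))"
| "exec (While t c) s =
     map_spmf (tick 1) (while_spmf (holds t) (\<lambda>s'. exec c (tick 1 s')) s)"

subsection \<open>Inputs, outputs and polynomial time\<close>

text \<open>
  An algorithm is started with its classical inputs on the bit stacks \<open>0, 1, \<dots>\<close>, its quantum inputs
  on the qubit stacks \<open>0, 1, \<dots>\<close>, and all other stacks empty.  Outputs are read off the same way.
  A quantum state handed from one algorithm to another (\<open>\<rho>\<^sub>C\<close>, \<open>\<sigma>\<close>, an internal state) is the
  contents of one bit stack and one qubit stack.
\<close>

definition load :: "bits list \<Rightarrow> nat list list \<Rightarrow> qmem \<Rightarrow> config" where
  "load cs qs q = \<lparr>creg = (\<lambda>r. if r < length cs then cs ! r else []),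
                   qreg = (\<lambda>r. if r < length qs then qs ! r else []),
                   qmem_of = q, steps = 0\<rparr>"

definition call :: "prog \<Rightarrow> bits list \<Rightarrow> nat list list \<Rightarrow> qmem
    \<Rightarrow> ((reg \<Rightarrow> bits) \<times> (reg \<Rightarrow> nat list) \<times> qmem) spmf" where
  "call c cs qs q = map_spmf (\<lambda>s. (creg s, qreg s, qmem_of s)) (exec c (load cs qs q))"

definition outcome :: "prog \<Rightarrow> bits list \<Rightarrow> bits spmf" where
  "outcome c cs = map_spmf (\<lambda>(out, _). out 0) (call c cs [] vacuum)"

definition valid_input :: "nat list list \<Rightarrow> qmem \<Rightarrow> bool" where
  "valid_input qs q \<longleftrightarrow>
     valid_qmem q \<and> distinct (concat qs) \<and> set (concat qs) \<subseteq> {..<fresh q}"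

definition QPT :: "prog \<Rightarrow> bool" where
  "QPT c \<longleftrightarrow> (\<exists>p :: nat poly. \<forall>cs qs q. valid_input qs q \<longrightarrow>
     lossless_spmf (exec c (load cs qs q)) \<and>
     (\<forall>s \<in> set_spmf (exec c (load cs qs q)).
        steps s \<le> poly p (length (concat cs) + length (concat qs))))"

section \<open>Negligible functions, indistinguishability, samplable distributions\<close>

definition negligible :: "(nat \<Rightarrow> real) \<Rightarrow> bool" where
  "negligible \<epsilon> \<longleftrightarrow> (\<forall>c :: nat. \<epsilon> \<in> o(\<lambda>\<eta>. 1 / real \<eta> ^ c))"

definition poly_bounded :: "(nat \<Rightarrow> nat) \<Rightarrow> bool" where
  "poly_bounded f \<longleftrightarrow> (\<exists>p :: nat poly. \<forall>\<eta>. f \<eta> \<le> poly p \<eta>)"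

abbreviation secpar :: "nat \<Rightarrow> bits" where
  "secpar \<eta> \<equiv> replicate \<eta> True"

definition efficiently_samplable :: "(nat \<Rightarrow> bits pmf) \<Rightarrow> bool" where
  "efficiently_samplable D \<longleftrightarrow>
     (\<exists>c. QPT c \<and> (\<forall>\<eta>. outcome c [secpar \<eta>] = spmf_of_pmf (D \<eta>)))"

text \<open>A distribution on functions is sampled by sampling a circuit for the function.\<close>

definition efficiently_samplable_fun ::
  "(nat \<Rightarrow> nat) \<Rightarrow> (nat \<Rightarrow> nat) \<Rightarrow> (nat \<Rightarrow> (bits \<Rightarrow> bits) pmf) \<Rightarrow> bool" where
  "efficiently_samplable_fun n m DF \<longleftrightarrow>
     (\<exists>c. QPT c \<and> (\<forall>\<eta>. set_spmf (outcome c [secpar \<eta>]) \<subseteq> encode ` circuits (n \<eta>) (m \<eta>) \<and>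
        map_spmf (\<lambda>w. functionality (decode w)) (outcome c [secpar \<eta>]) = spmf_of_pmf (DF \<eta>)))"

definition stat_indist :: "(nat \<Rightarrow> 'a pmf) \<Rightarrow> (nat \<Rightarrow> 'a pmf) \<Rightarrow> bool" where
  "stat_indist X Y \<longleftrightarrow> (\<exists>\<epsilon>. negligible \<epsilon> \<and> (\<forall>\<eta> A.
     \<bar>measure_pmf.prob (X \<eta>) A - measure_pmf.prob (Y \<eta>) A\<bar> \<le> \<epsilon> \<eta>))"

definition comp_indist :: "(nat \<Rightarrow> bits list spmf) \<Rightarrow> (nat \<Rightarrow> bits list spmf) \<Rightarrow> bool" where
  "comp_indist X Y \<longleftrightarrow> (\<forall>c. QPT c \<longrightarrow>
     negligible (\<lambda>\<eta>. \<bar>spmf (bind_spmf (X \<eta>) (\<lambda>z. outcome c (secpar \<eta> # z))) [True]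
                     - spmf (bind_spmf (Y \<eta>) (\<lambda>z. outcome c (secpar \<eta> # z))) [True]\<bar>))"

section \<open>Keyed circuit classes\<close>

definition keyed_circuit_class :: "(nat \<Rightarrow> nat) \<Rightarrow> (nat \<Rightarrow> nat) \<Rightarrow> (nat \<Rightarrow> bits set)
    \<Rightarrow> (nat \<Rightarrow> bits \<Rightarrow> circuit) \<Rightarrow> bool" where
  "keyed_circuit_class n m K C \<longleftrightarrow>
     poly_bounded n \<and> poly_bounded m \<and>
     (\<forall>\<eta>. \<forall>k \<in> K \<eta>. C \<eta> k \<in> circuits (n \<eta>) (m \<eta>)) \<and>
     (\<exists>size. poly_bounded size \<and> (\<forall>\<eta>. \<forall>k \<in> K \<eta>. csize (C \<eta> k) = size \<eta>))"

definition generalized_puncturable :: "(nat \<Rightarrow> nat) \<Rightarrow> (nat \<Rightarrow> nat) \<Rightarrow> (nat \<Rightarrow> bits set)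
    \<Rightarrow> (nat \<Rightarrow> bits \<Rightarrow> circuit) \<Rightarrow> prog \<Rightarrow> bool" where
  "generalized_puncturable n m K C GenPuncture \<longleftrightarrow>
     keyed_circuit_class n m K C \<and> QPT GenPuncture \<and>
     (\<forall>\<eta>. \<forall>k \<in> K \<eta>. \<forall>xB \<in> cube (n \<eta>). \<forall>xC \<in> cube (n \<eta>).
        \<forall>\<mu>B \<in> circuits (n \<eta>) (m \<eta>). \<forall>\<mu>C \<in> circuits (n \<eta>) (m \<eta>).
        \<forall>w \<in> set_spmf (outcome GenPuncture [secpar \<eta>, k, xB, xC, encode \<mu>B, encode \<mu>C]).
        \<exists>G \<in> circuits (n \<eta>) (m \<eta>). w = encode G \<and> csize G = csize (C \<eta> k) \<and>
          (\<forall>x \<in> cube (n \<eta>) - {xB, xC}. ceval G x = ceval (C \<eta> k) x) \<and>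
          ceval G xB = ceval \<mu>B xB \<and>
          (xC \<noteq> xB \<longrightarrow> ceval G xC = ceval \<mu>C xC))"

definition implements :: "(nat \<Rightarrow> nat) \<Rightarrow> (nat \<Rightarrow> nat) \<Rightarrow> (nat \<Rightarrow> (bits \<Rightarrow> bits) set)
    \<Rightarrow> (nat \<Rightarrow> bits set) \<Rightarrow> (nat \<Rightarrow> bits \<Rightarrow> circuit) \<Rightarrow> bool" where
  "implements n m F K C \<longleftrightarrow> keyed_circuit_class n m K C \<and>
     (\<forall>\<eta>. functionality ` (C \<eta> ` K \<eta>) = F \<eta>)"

definition implements_dist :: "(nat \<Rightarrow> nat) \<Rightarrow> (nat \<Rightarrow> nat) \<Rightarrow> (nat \<Rightarrow> (bits \<Rightarrow> bits) set)
    \<Rightarrow> (nat \<Rightarrow> (bits \<Rightarrow> bits) pmf) \<Rightarrow> (nat \<Rightarrow> bits set) \<Rightarrow> (nat \<Rightarrow> bits \<Rightarrow> circuit)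
    \<Rightarrow> (nat \<Rightarrow> bits pmf) \<Rightarrow> bool" where
  "implements_dist n m F DF K C D \<longleftrightarrow> implements n m F K C \<and>
     (\<forall>\<eta>. set_pmf (D \<eta>) \<subseteq> K \<eta>) \<and> efficiently_samplable D \<and>
     stat_indist (\<lambda>\<eta>. map_pmf (\<lambda>k. functionality (C \<eta> k)) (D \<eta>)) DF"

section \<open>Evasive function classes\<close>

definition evasive :: "(nat \<Rightarrow> nat) \<Rightarrow> (nat \<Rightarrow> (bits \<Rightarrow> bits) set)
    \<Rightarrow> (nat \<Rightarrow> (bits \<Rightarrow> bits) pmf) \<Rightarrow> bool" where
  "evasive n F DF \<longleftrightarrow>
     (\<forall>\<eta>. F \<eta> \<subseteq> cube (n \<eta>) \<rightarrow>\<^sub>E cube 1) \<and>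
     (\<forall>\<eta>. set_pmf (DF \<eta>) \<subseteq> F \<eta>) \<and> efficiently_samplable_fun n (\<lambda>_. 1) DF \<and>
     (\<exists>\<epsilon>. negligible \<epsilon> \<and> (\<forall>\<eta>. \<forall>x \<in> cube (n \<eta>).
        measure_pmf.prob (DF \<eta>) {f. f x = [True]} \<le> \<epsilon> \<eta>))"

text \<open>
  The clause \<open>preimage_one (C \<eta> k) \<noteq> {}\<close> is what it takes for the uniform distribution on
  the preimage of 1 to exist.
\<close>

definition preimage_samplable_evasive :: "(nat \<Rightarrow> nat) \<Rightarrow> (nat \<Rightarrow> (bits \<Rightarrow> bits) set)
    \<Rightarrow> (nat \<Rightarrow> (bits \<Rightarrow> bits) pmf) \<Rightarrow> (nat \<Rightarrow> bits set) \<Rightarrow> (nat \<Rightarrow> bits \<Rightarrow> circuit)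
    \<Rightarrow> (nat \<Rightarrow> bits pmf) \<Rightarrow> bool" where
  "preimage_samplable_evasive n F DF K C D \<longleftrightarrow>
     evasive n F DF \<and> implements_dist n (\<lambda>_. 1) F DF K C D \<and>
     (\<forall>\<eta>. \<forall>k \<in> set_pmf (D \<eta>). preimage_one (C \<eta> k) \<noteq> {}) \<and>
     (\<exists>K' C' P D'. generalized_puncturable n (\<lambda>_. 1) K' C' P \<and>
        (\<forall>\<eta>. set_pmf (D' \<eta>) \<subseteq> K' \<eta>) \<and> efficiently_samplable D' \<and>
        comp_indist
          (\<lambda>\<eta>. do { k \<leftarrow> spmf_of_pmf (D \<eta>);
                    x \<leftarrow> spmf_of_set (preimage_one (C \<eta> k));
                    return_spmf [encode (C \<eta> k), x] })
          (\<lambda>\<eta>. do { k' \<leftarrow> spmf_of_pmf (D' \<eta>);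
                    y \<leftarrow> spmf_of_set (cube (n \<eta>));
                    w \<leftarrow> outcome P [secpar \<eta>, k', y, y,
                            encode (const_one (n \<eta>)), encode (const_one (n \<eta>))];
                    return_spmf [w, y] }))"

section \<open>Generalized unclonable puncturable obfuscation\<close>

text \<open>
  This serves obfuscation and copy-protection alike.  The evaluation algorithm leaves \<open>y\<close> on bit
  stack 0 and the updated state on bit stack 1 and qubit stack 0; correctness is about \<open>y\<close> only.
\<close>

definition correct :: "prog \<Rightarrow> prog \<Rightarrow> (nat \<Rightarrow> nat) \<Rightarrow> (nat \<Rightarrow> bits set)
    \<Rightarrow> (nat \<Rightarrow> bits \<Rightarrow> circuit) \<Rightarrow> bool" where
  "correct Enc Eval n K C \<longleftrightarrow> (\<exists>\<epsilon>. negligible \<epsilon> \<and>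
     (\<forall>\<eta>. \<forall>k \<in> K \<eta>. \<forall>x \<in> cube (n \<eta>).
        spmf (do { (out, qout, q) \<leftarrow> call Enc [secpar \<eta>, encode (C \<eta> k)] [] vacuum;
                   (y, _) \<leftarrow> call Eval [secpar \<eta>, x, out 0] [qout 0] q;
                   return_spmf (y 0 = ceval (C \<eta> k) x) }) True \<ge> 1 - \<epsilon> \<eta>))"

text \<open>
  The first adversary \<open>\<A>\<close> consists of two stages \<open>A1\<close>, \<open>A2\<close>, before and after the challenge,
  with an internal state (bit stack 3, qubit stack 0) passed between them.  \<open>A1\<close>
  leaves \<open>k, \<mu>B, \<mu>C\<close> on bit stacks 0, 1, 2; if these are not of the required form, the
  adversary loses.  The two halves of the bipartite state are stacks 0 (for the first party) and
  stacks 1 (for the second one).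
\<close>

definition upo_experiment :: "prog \<Rightarrow> (nat \<Rightarrow> (bits \<times> bits) pmf) \<Rightarrow> (nat \<Rightarrow> nat) \<Rightarrow> (nat \<Rightarrow> nat)
    \<Rightarrow> (nat \<Rightarrow> bits set) \<Rightarrow> (nat \<Rightarrow> bits \<Rightarrow> circuit) \<Rightarrow> prog
    \<Rightarrow> prog \<Rightarrow> prog \<Rightarrow> prog \<Rightarrow> prog \<Rightarrow> nat \<Rightarrow> bool spmf" where
  "upo_experiment Obf DX n m K C GenPuncture A1 A2 AB AC \<eta> = do {
     b \<leftarrow> coin_spmf;
     (a1, qa1, q) \<leftarrow> call A1 [secpar \<eta>] [] vacuum;
     let k = a1 0; let \<mu>B = a1 1; let \<mu>C = a1 2;
     if k \<in> K \<eta> \<and> \<mu>B \<in> encode ` circuits (n \<eta>) (m \<eta>) \<and> \<mu>C \<in> encode ` circuits (n \<eta>) (m \<eta>)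
     then do {
       (xB, xC) \<leftarrow> spmf_of_pmf (DX (n \<eta>));
       G \<leftarrow> outcome GenPuncture [secpar \<eta>, k, xB, xC, \<mu>B, \<mu>C];
       (\<rho>, q\<rho>, q) \<leftarrow> call Obf [secpar \<eta>, if b then G else encode (C \<eta> k)] [] q;
       (\<sigma>, q\<sigma>, q) \<leftarrow> call A2 [secpar \<eta>, a1 3, \<rho> 0] [qa1 0, q\<rho> 0] q;
       (bB, _, q) \<leftarrow> call AB [secpar \<eta>, xB, \<sigma> 0] [q\<sigma> 0] q;
       (bC, _, q) \<leftarrow> call AC [secpar \<eta>, xC, \<sigma> 1] [q\<sigma> 1] q;
       return_spmf (bB 0 = [b] \<and> bC 0 = [b])
     } else return_spmf False }"

definition upo_secure :: "prog \<Rightarrow> (nat \<Rightarrow> (bits \<times> bits) pmf) \<Rightarrow> (nat \<Rightarrow> nat) \<Rightarrow> (nat \<Rightarrow> nat)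
    \<Rightarrow> (nat \<Rightarrow> bits set) \<Rightarrow> (nat \<Rightarrow> bits \<Rightarrow> circuit) \<Rightarrow> prog \<Rightarrow> bool" where
  "upo_secure Obf DX n m K C GenPuncture \<longleftrightarrow>
     (\<forall>A1 A2 AB AC. QPT A1 \<longrightarrow> QPT A2 \<longrightarrow> QPT AB \<longrightarrow> QPT AC \<longrightarrow>
        (\<exists>\<epsilon>. negligible \<epsilon> \<and> (\<forall>\<eta>.
           spmf (upo_experiment Obf DX n m K C GenPuncture A1 A2 AB AC \<eta>) True
             \<le> 1 / 2 + \<epsilon> \<eta>)))"

text \<open>
  Correctness is required on every class of polynomial-size circuits, security on every
  generalized puncturable one whose inputs cannot be guessed, that is, with \<open>2\<^sup>-\<^sup>n\<close> negligible.
  Without this proviso no scheme would exist: for \<open>n\<close> logarithmic in the security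
  parameter (say \<open>n = 0\<close>) the adversary guesses the punctured point, evaluates the obfuscated
  program there, and learns the challenge bit.
\<close>

definition generalized_UPO :: "(nat \<Rightarrow> (bits \<times> bits) pmf) \<Rightarrow> prog \<Rightarrow> prog \<Rightarrow> bool" where
  "generalized_UPO DX Obf Eval \<longleftrightarrow> QPT Obf \<and> QPT Eval \<and>
     (\<forall>n m K C. keyed_circuit_class n m K C \<longrightarrow> correct Obf Eval n K C) \<and>
     (\<forall>n m K C GenPuncture. generalized_puncturable n m K C GenPuncture \<longrightarrow>
        negligible (\<lambda>\<eta>. 1 / 2 ^ n \<eta>) \<longrightarrow> upo_secure Obf DX n m K C GenPuncture)"

definition Id_U :: "nat \<Rightarrow> (bits \<times> bits) pmf" where
  "Id_U n = map_pmf (\<lambda>x. (x, x)) (pmf_of_set (cube n))"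

section \<open>Copy-protection\<close>

definition copy_protection :: "(nat \<Rightarrow> nat) \<Rightarrow> (nat \<Rightarrow> nat) \<Rightarrow> (nat \<Rightarrow> (bits \<Rightarrow> bits) set)
    \<Rightarrow> (nat \<Rightarrow> bits set) \<Rightarrow> (nat \<Rightarrow> bits \<Rightarrow> circuit) \<Rightarrow> prog \<Rightarrow> prog \<Rightarrow> bool" where
  "copy_protection n m F K C CopyProtect Eval \<longleftrightarrow> implements n m F K C \<and>
     QPT CopyProtect \<and> QPT Eval \<and> correct CopyProtect Eval n K C"

definition piracy_experiment :: "prog \<Rightarrow> (nat \<Rightarrow> circuit \<Rightarrow> (bits \<times> bits) pmf)
    \<Rightarrow> (nat \<Rightarrow> bits \<Rightarrow> circuit) \<Rightarrow> (nat \<Rightarrow> bits pmf)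
    \<Rightarrow> prog \<Rightarrow> prog \<Rightarrow> prog \<Rightarrow> nat \<Rightarrow> bool spmf" where
  "piracy_experiment CopyProtect DX C D A AB AC \<eta> = do {
     k \<leftarrow> spmf_of_pmf (D \<eta>);
     (\<rho>, q\<rho>, q) \<leftarrow> call CopyProtect [secpar \<eta>, encode (C \<eta> k)] [] vacuum;
     (\<sigma>, q\<sigma>, q) \<leftarrow> call A [secpar \<eta>, \<rho> 0] [q\<rho> 0] q;
     (xB, xC) \<leftarrow> spmf_of_pmf (DX \<eta> (C \<eta> k));
     (yB, _, q) \<leftarrow> call AB [secpar \<eta>, xB, \<sigma> 0] [q\<sigma> 0] q;
     (yC, _, q) \<leftarrow> call AC [secpar \<eta>, xC, \<sigma> 1] [q\<sigma> 1] q;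
     return_spmf (yB 0 = ceval (C \<eta> k) xB \<and> yC 0 = ceval (C \<eta> k) xC) }"

text \<open>
  The trivial attack: one party gets the whole copy-protected state and runs \<open>R\<close> on it, the other
  party applies a guessing strategy \<open>g\<close> to its own challenge alone.  \<open>toB\<close> tells whether it is
  the first party that gets the state.  The maximum is over all strategies, with no bound on
  their running time.
\<close>

definition trivial_experiment :: "bool \<Rightarrow> prog \<Rightarrow> (nat \<Rightarrow> circuit \<Rightarrow> (bits \<times> bits) pmf)
    \<Rightarrow> (nat \<Rightarrow> bits \<Rightarrow> circuit) \<Rightarrow> (nat \<Rightarrow> bits pmf)
    \<Rightarrow> prog \<Rightarrow> (bits \<Rightarrow> bits pmf) \<Rightarrow> nat \<Rightarrow> bool spmf" where
  "trivial_experiment toB CopyProtect DX C D R g \<eta> = do {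
     k \<leftarrow> spmf_of_pmf (D \<eta>);
     (\<rho>, q\<rho>, q) \<leftarrow> call CopyProtect [secpar \<eta>, encode (C \<eta> k)] [] vacuum;
     (xB, xC) \<leftarrow> spmf_of_pmf (DX \<eta> (C \<eta> k));
     let (x, x') = (if toB then (xB, xC) else (xC, xB));
     (y, _) \<leftarrow> call R [secpar \<eta>, x, \<rho> 0] [q\<rho> 0] q;
     y' \<leftarrow> spmf_of_pmf (g x');
     return_spmf (y 0 = ceval (C \<eta> k) x \<and> y' = ceval (C \<eta> k) x') }"

definition p_trivial_to :: "bool \<Rightarrow> prog \<Rightarrow> (nat \<Rightarrow> circuit \<Rightarrow> (bits \<times> bits) pmf)
    \<Rightarrow> (nat \<Rightarrow> bits \<Rightarrow> circuit) \<Rightarrow> (nat \<Rightarrow> bits pmf) \<Rightarrow> nat \<Rightarrow> real" where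
  "p_trivial_to toB CopyProtect DX C D \<eta> =
     (SUP (R, g) \<in> UNIV. spmf (trivial_experiment toB CopyProtect DX C D R g \<eta>) True)"

definition p_triv :: "prog \<Rightarrow> (nat \<Rightarrow> circuit \<Rightarrow> (bits \<times> bits) pmf)
    \<Rightarrow> (nat \<Rightarrow> bits \<Rightarrow> circuit) \<Rightarrow> (nat \<Rightarrow> bits pmf) \<Rightarrow> nat \<Rightarrow> real" where
  "p_triv CopyProtect DX C D \<eta> =
     max (p_trivial_to True CopyProtect DX C D \<eta>) (p_trivial_to False CopyProtect DX C D \<eta>)"

definition anti_piracy :: "(nat \<Rightarrow> nat) \<Rightarrow> (nat \<Rightarrow> nat) \<Rightarrow> (nat \<Rightarrow> (bits \<Rightarrow> bits) set)
    \<Rightarrow> (nat \<Rightarrow> (bits \<Rightarrow> bits) pmf) \<Rightarrow> (nat \<Rightarrow> circuit \<Rightarrow> (bits \<times> bits) pmf)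
    \<Rightarrow> (nat \<Rightarrow> bits set) \<Rightarrow> (nat \<Rightarrow> bits \<Rightarrow> circuit) \<Rightarrow> (nat \<Rightarrow> bits pmf) \<Rightarrow> prog \<Rightarrow> bool" where
  "anti_piracy n m F DF DX K C D CopyProtect \<longleftrightarrow> implements_dist n m F DF K C D \<and>
     (\<forall>A AB AC. QPT A \<longrightarrow> QPT AB \<longrightarrow> QPT AC \<longrightarrow>
        (\<exists>\<epsilon>. negligible \<epsilon> \<and> (\<forall>\<eta>.
           spmf (piracy_experiment CopyProtect DX C D A AB AC \<eta>) True
             \<le> p_triv CopyProtect DX C D \<eta> + \<epsilon> \<eta>)))"

definition D_identical :: "nat \<Rightarrow> circuit \<Rightarrow> (bits \<times> bits) pmf" where
  "D_identical \<eta> C = do {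
     b \<leftarrow> bernoulli_pmf (1 / 2);
     x \<leftarrow> pmf_of_set (if b then cube (inputs C) else preimage_one C);
     return_pmf (x, x) }"

end

theory Submission
  imports Defs
begin

text \<open>
  The party without the program can always answer 0, so by evasiveness the trivial success
  probability is at least 1/2 up to a negligible error.  A pirate wins, again by evasiveness, if both
  parties answer 0 on a uniform challenge, or 1 on a uniform preimage of 1.  Preimage samplability
  turns the second case into: both answer 1 on the point at which the obfuscated circuit is
  punctured.  It also turns the circuit in the first case into a punctured one, with a challenge
  independent of the punctured point.  In that situation an adversary can run the whole game by
  itself, so that by security of the obfuscation the puncturing may be undone.  Then the two cases
  together are exactly the experiment for the obfuscation scheme, with the answers as guesses for
  the challenge bit, whence the bound 1/2.
\<close>

section \<open>Simulation of renamed programs\<close>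

text \<open>The obfuscation is only known to resist adversaries that are themselves programs with a
  polynomial time bound, so every reduction has to exist as a \<open>prog\<close>. Most of the
  development is a calculus for assembling programs from given ones that share an entangled state.
  Security of the obfuscation is used twice, with the same opening stage, and both times the
  unpunctured side contributes the same quantity \<open>Q1'\<close>: the probability that both
  parties answer 0 about \<open>C' \<eta> k\<close> at an independent uniform point. An adversary
  that plays the game internally bounds \<open>Q1 - Q1'\<close>, the pirate itself bounds
  \<open>Q2 + Q1' - 1\<close>, and \<open>Q1'\<close>, about which nothing is known, cancels. Two
  facts have to be extracted. The input length \<open>n\<close> comes without an algorithm, so the
  opening stage reads it off a circuit sampled for \<open>DF\<close>. That
  \<open>1 / 2 ^ n \<eta>\<close> is negligible, the proviso of security, follows from evasiveness
  together with the existence of preimages of 1.\<close>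

lemma while_spmf_map:
  assumes b: "\<And>s. b' (E s) = b s" and f: "\<And>s. f' (E s) = map_spmf E (f s)"
  shows "while_spmf b' f' (E s) = map_spmf E (while_spmf b f s)"
\<comment> \<open>Both sides are least fixed points and nothing is assumed about termination.
  Fixed-point induction on either side bounds its approximations by the other side.\<close>
proof (rule spmf.leq_antisym)
  have "\<forall>s. ord_spmf (=) (while_spmf b' f' (E s)) (map_spmf E (while_spmf b f s))"
  proof (rule while_spmf.fixp_induct[where P =
        "\<lambda>w. \<forall>s. ord_spmf (=) (w b' f' (E s)) (map_spmf E (while_spmf b f s))"], goal_cases)
    case 1 then show ?case by simp
  next
    case 2 then show ?case by simp
  next
    case (3 w)
    show ?case
      by (subst while_spmf.simps)
        (auto simp: b f bind_map_spmf map_spmf_bind_spmf o_def 3 intro!: ord_spmf_bind_reflI)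
  qed
  then show "ord_spmf (=) (while_spmf b' f' (E s)) (map_spmf E (while_spmf b f s))" ..
next
  have "\<forall>s. ord_spmf (=) (map_spmf E (while_spmf b f s)) (while_spmf b' f' (E s))"
  proof (rule while_spmf.fixp_induct[where P =
        "\<lambda>w. \<forall>s. ord_spmf (=) (map_spmf E (w b f s)) (while_spmf b' f' (E s))"], goal_cases)
    case 1 then show ?case by simp
  next
    case 2 then show ?case by simp
  next
    case (3 w)
    show ?case
      by (subst while_spmf.simps)
        (auto simp: b f bind_map_spmf map_spmf_bind_spmf o_def 3 intro!: ord_spmf_bind_reflI)
  qed
  then show "ord_spmf (=) (map_spmf E (while_spmf b f s)) (while_spmf b' f' (E s))" ..
qed

text \<open>Partial correctness by fixed-point induction: the claim speaks of results only, so it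
  survives the limit even if the loop may diverge.\<close>

lemma while_spmf_invariant:
  assumes "I s" and step: "\<And>s s'. I s \<Longrightarrow> b s \<Longrightarrow> s' \<in> set_spmf (f s) \<Longrightarrow> I s'"
    and "s' \<in> set_spmf (while_spmf b f s)"
  shows "I s'"
proof -
  have "\<forall>s. I s \<longrightarrow> (\<forall>s' \<in> set_spmf (while_spmf b f s). I s')"
  proof (rule while_spmf.fixp_induct[where P =
        "\<lambda>w. \<forall>s. I s \<longrightarrow> (\<forall>s' \<in> set_spmf (w b f s). I s')"], goal_cases)
    case 1 then show ?case by simp
  next
    case 2 then show ?case by simp
  next
    case (3 w)
    show ?case
    proof (intro allI impI ballI)
      fix s s' assume s: "I s" and s': "s' \<in> set_spmf (if b s then f s \<bind> w b f else return_spmf s)"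
      show "I s'"
      proof (cases "b s")
        case True
        then obtain t where "t \<in> set_spmf (f s)" "s' \<in> set_spmf (w b f t)"
          using s' by (auto simp: set_bind_spmf)
        then show ?thesis using 3 step[OF s True] by blast
      qed (use s s' in simp)
    qed
  qed
  with assms(1,3) show ?thesis by simp
qed

primrec ren_test :: "(reg \<Rightarrow> reg) \<Rightarrow> (reg \<Rightarrow> reg) \<Rightarrow> test \<Rightarrow> test" where
  "ren_test f g (Top r) = Top (f r)"
| "ren_test f g (NonEmpty r) = NonEmpty (f r)"
| "ren_test f g (QNonEmpty r) = QNonEmpty (g r)"

primrec ren :: "(reg \<Rightarrow> reg) \<Rightarrow> (reg \<Rightarrow> reg) \<Rightarrow> prog \<Rightarrow> prog" where
  "ren f g Skip = Skip"
| "ren f g (Push r b) = Push (f r) b"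
| "ren f g (Pop r) = Pop (f r)"
| "ren f g (Copy r r') = Copy (f r) (f r')"
| "ren f g (Coin r) = Coin (f r)"
| "ren f g (New r) = New (g r)"
| "ren f g (Move r r') = Move (g r) (g r')"
| "ren f g (Had r) = Had (g r)"
| "ren f g (Tee r) = Tee (g r)"
| "ren f g (Cnot r r') = Cnot (g r) (g r')"
| "ren f g (Measure r r') = Measure (g r) (f r')"
| "ren f g (Seq c d) = Seq (ren f g c) (ren f g d)"
| "ren f g (Branch t c d) = Branch (ren_test f g t) (ren f g c) (ren f g d)"
| "ren f g (While t c) = While (ren_test f g t) (ren f g c)"

text \<open>
  \<open>join q0 q\<close> is the product of an inert state \<open>q0\<close> with \<open>q\<close>, the names of the latter being shifted
  by \<open>fresh q0\<close>.
\<close>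

definition join :: "qmem \<Rightarrow> qmem \<Rightarrow> qmem" where
  "join q0 q = \<lparr>ket = (\<lambda>S. ket q0 (S \<inter> {..<fresh q0}) * ket q {i. fresh q0 + i \<in> S}),
                fresh = fresh q0 + fresh q\<rparr>"

text \<open>
  A single simulation relation for two purposes: running a renamed program inside a larger
  configuration \<open>s0\<close> (with \<open>q0\<close> the vacuum), and running a program next to qubits left behind by
  earlier computations (with \<open>f\<close> and \<open>g\<close> the identity).
\<close>

definition embed :: "(reg \<Rightarrow> reg) \<Rightarrow> (reg \<Rightarrow> reg) \<Rightarrow> qmem \<Rightarrow> config \<Rightarrow> config \<Rightarrow> config" where
  "embed f g q0 s0 t =
     \<lparr>creg = (\<lambda>r. if r \<in> range f then creg t (inv f r) else creg s0 r),
      qreg = (\<lambda>r. if r \<in> range g then map ((+) (fresh q0)) (qreg t (inv g r)) else qreg s0 r),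
      qmem_of = join q0 (qmem_of t), steps = steps s0 + steps t\<rparr>"

section \<open>Gates and measurements on one factor of a product state\<close>

lemma join_vacuum [simp]: "join vacuum q = q"
  by (simp add: join_def vacuum_def)

lemma fresh_join [simp]: "fresh (join q0 q) = fresh q0 + fresh q"
  by (simp add: join_def)

text \<open>The gate acts on a shifted name, so adding or removing that name changes only the upper
  part of the index set and leaves the amplitude contributed by \<open>q0\<close> alone.\<close>

lemma join_hadamard:
  "hadamard (fresh q0 + i) (ket (join q0 q)) = ket (join q0 (q\<lparr>ket := hadamard i (ket q)\<rparr>))"
proof
  fix S
  have "(S - {fresh q0 + i}) \<inter> {..<fresh q0} = S \<inter> {..<fresh q0}"
    "insert (fresh q0 + i) S \<inter> {..<fresh q0} = S \<inter> {..<fresh q0}"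
    "{j. fresh q0 + j \<in> S - {fresh q0 + i}} = {j. fresh q0 + j \<in> S} - {i}"
    "{j. fresh q0 + j \<in> insert (fresh q0 + i) S} = insert i {j. fresh q0 + j \<in> S}"
    by auto
  then show "hadamard (fresh q0 + i) (ket (join q0 q)) S
      = ket (join q0 (q\<lparr>ket := hadamard i (ket q)\<rparr>)) S"
    by (simp add: hadamard_def join_def algebra_simps del: Int_insert_left)
qed

lemma join_tgate:
  "tgate (fresh q0 + i) (ket (join q0 q)) = ket (join q0 (q\<lparr>ket := tgate i (ket q)\<rparr>))"
  by (simp add: tgate_def join_def fun_eq_iff)

lemma join_cnot:
  "cnot (fresh q0 + i) (fresh q0 + j) (ket (join q0 q)) = ket (join q0 (q\<lparr>ket := cnot i j (ket q)\<rparr>))"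
proof
  fix S
  have "(S - {fresh q0 + j}) \<inter> {..<fresh q0} = S \<inter> {..<fresh q0}"
    "insert (fresh q0 + j) S \<inter> {..<fresh q0} = S \<inter> {..<fresh q0}"
    "{i. fresh q0 + i \<in> S - {fresh q0 + j}} = {i. fresh q0 + i \<in> S} - {j}"
    "{i. fresh q0 + i \<in> insert (fresh q0 + j) S} = insert j {i. fresh q0 + i \<in> S}"
    by auto
  then show "cnot (fresh q0 + i) (fresh q0 + j) (ket (join q0 q)) S
      = ket (join q0 (q\<lparr>ket := cnot i j (ket q)\<rparr>)) S"
    by (simp add: cnot_def join_def del: Int_insert_left)
qed

text \<open>Subsets of the joint names correspond to pairs of subsets, so the sum factors; the
  factor of \<open>q0\<close> is its squared norm, which is 1.\<close>

lemma prob_one_join: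
  assumes "valid_qmem q0"
  shows "prob_one (fresh q0 + i) (join q0 q) = prob_one i q"
proof -
  let ?f = "fresh q0"
  let ?A = "Pow {..<?f}" and ?B = "{S \<in> Pow {..<fresh q}. i \<in> S}"
  have "prob_one (?f + i) (join q0 q) =
      (\<Sum>(S, T) \<in> ?A \<times> ?B. (cmod (ket q0 S))\<^sup>2 * (cmod (ket q T))\<^sup>2)"
    unfolding prob_one_def
  proof (rule sum.reindex_bij_witness[where
        i = "\<lambda>(S, T). S \<union> (+) ?f ` T" and j = "\<lambda>S. (S \<inter> {..<?f}, {j. ?f + j \<in> S})"], goal_cases)
    case (1 S)
    have "x \<in> (+) ?f ` {j. ?f + j \<in> S}" if "x \<in> S" "\<not> x < ?f" for x
      using that by (intro image_eqI[of _ _ "x - ?f"]) auto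
    then show ?case by auto
  next
    case (5 S)
    then show ?case by (simp add: join_def norm_mult power_mult_distrib)
  qed auto
  also have "\<dots> = (\<Sum>S\<in>?A. (cmod (ket q0 S))\<^sup>2) * (\<Sum>T\<in>?B. (cmod (ket q T))\<^sup>2)"
    by (simp add: sum.cartesian_product[symmetric] sum_product)
  finally show ?thesis
    using assms by (simp add: valid_qmem_def prob_one_def)
qed

lemma join_collapse:
  assumes "valid_qmem q0"
  shows "collapse (fresh q0 + i) b (join q0 q) = join q0 (collapse i b q)"
  using prob_one_join[OF assms, of i q]
  by (auto simp: collapse_def join_def fun_eq_iff)

lemma measure_join:
  assumes "valid_qmem q0"
  shows "measure_qubit (fresh q0 + i) (join q0 q)
    = map_spmf (\<lambda>(b, q). (b, join q0 q)) (measure_qubit i q)"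
  by (simp add: measure_qubit_def prob_one_join join_collapse assms spmf.map_comp o_def split_def
      flip: map_spmf_of_pmf)

context
  fixes f g :: "reg \<Rightarrow> reg" and q0 :: qmem and s0 :: config
  assumes inj: "inj f" "inj g" and q0: "valid_qmem q0"
begin

abbreviation "emb \<equiv> embed f g q0 s0"

lemma creg_embed [simp]: "creg (emb t) (f r) = creg t r"
  by (simp add: embed_def inj)

lemma qreg_embed [simp]: "qreg (emb t) (g r) = map ((+) (fresh q0)) (qreg t r)"
  by (simp add: embed_def inj)

lemma qmem_embed [simp]: "qmem_of (emb t) = join q0 (qmem_of t)"
  by (simp add: embed_def)

lemma embed_tick: "tick k (emb t) = emb (tick k t)"
  by (simp add: embed_def tick_def fun_eq_iff)

lemma embed_set_creg: "set_creg (f r) w (emb t) = emb (set_creg r w t)"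
  by (auto simp: embed_def set_creg_def inj fun_eq_iff)

lemma embed_set_qreg: "set_qreg (g r) (map ((+) (fresh q0)) w) (emb t) = emb (set_qreg r w t)"
  by (auto simp: embed_def set_qreg_def inj fun_eq_iff)

lemma embed_set_qreg_Cons:
  "set_qreg (g r) ((fresh q0 + i) # map ((+) (fresh q0)) w) (emb t) = emb (set_qreg r (i # w) t)"
  using embed_set_qreg[of r "i # w"] by simp

lemma embed_set_qmem: "(emb t)\<lparr>qmem_of := join q0 q\<rparr> = emb (t\<lparr>qmem_of := q\<rparr>)"
  by (simp add: embed_def fun_eq_iff)

lemma embed_alloc: "alloc (g r) (emb t) = emb (alloc r t)"
  by (auto simp: embed_def alloc_def inj fun_eq_iff join_def)

lemma embed_apply_ket:
  assumes "U' (ket (join q0 (qmem_of t))) = ket (join q0 ((qmem_of t)\<lparr>ket := U (ket (qmem_of t))\<rparr>))"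
  shows "apply_ket U' (emb t) = emb (apply_ket U t)"
  using assms by (simp add: embed_def apply_ket_def fun_eq_iff join_def)

lemma holds_embed [simp]: "holds (ren_test f g b) (emb t) = holds b t"
  by (cases b) simp_all

text \<open>Every instruction touches only stacks in the ranges of \<open>f\<close> and
  \<open>g\<close> and qubits lying there, hence commutes with \<open>emb\<close>; loops are covered
  by \<open>while_spmf_map\<close>. As \<open>emb\<close> also translates step counts, the equation
  serves for running times as well as for results.\<close>

lemma exec_embed: "exec (ren f g c) (emb t) = map_spmf emb (exec c t)"
proof (induction c arbitrary: t)
  case (Coin r)
  show ?case by (simp add: embed_set_creg embed_tick spmf.map_comp o_def)
next
  case (Move r r')
  show ?case
    by (cases "qreg t r") (simp_all add: Let_def embed_set_qreg embed_set_qreg_Cons embed_tick)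
next
  case (Had r)
  show ?case
    by (cases "qreg t r") (simp_all add: embed_tick embed_apply_ket join_hadamard)
next
  case (Tee r)
  show ?case
    by (cases "qreg t r") (simp_all add: embed_tick embed_apply_ket join_tgate)
next
  case (Cnot r r')
  show ?case
    by (cases "qreg t r"; cases "qreg t r'") (simp_all add: embed_tick embed_apply_ket join_cnot)
next
  case (Measure r r')
  show ?case
    by (cases "qreg t r")
      (simp_all add: embed_tick measure_join[OF q0] embed_set_qmem embed_set_qreg embed_set_creg
        spmf.map_comp o_def split_def)
next
  case (Seq c d)
  then show ?case by (simp add: bind_map_spmf map_spmf_bind_spmf o_def)
next
  case (Branch b c d)
  then show ?case by (simp add: embed_tick)
next
  case (While b c)
  have "exec (ren f g c) (tick 1 (emb s)) = map_spmf emb (exec c (tick 1 s))" for s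
    by (simp only: embed_tick While)
  then show ?case
    by (simp add: while_spmf_map[where E = emb and b = "holds b" and f = "\<lambda>s. exec c (tick 1 s)"]
        spmf.map_comp o_def embed_tick)
qed (simp_all add: embed_set_creg embed_tick embed_alloc)

end

section \<open>Invariants and running time\<close>

text \<open>Pairs each index set without \<open>i\<close> with the one obtained by inserting
  \<open>i\<close>: these are the two-dimensional blocks on which a gate on qubit \<open>i\<close>
  acts.\<close>

lemma sum_Pow_split:
  assumes "finite U" "i \<in> U"
  shows "(\<Sum>S\<in>Pow U. h S) = (\<Sum>S\<in>Pow (U - {i}). h S + h (insert i S))"
proof -
  have "Pow U = Pow (U - {i}) \<union> insert i ` Pow (U - {i})"
    using Pow_insert[of i "U - {i}"] assms by (simp add: insert_absorb)
  then have "(\<Sum>S\<in>Pow U. h S) = sum h (Pow (U - {i})) + sum h (insert i ` Pow (U - {i}))"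
    using assms by (subst sum.union_disjoint[symmetric]) auto
  also have "sum h (insert i ` Pow (U - {i})) = (\<Sum>S\<in>Pow (U - {i}). h (insert i S))"
    by (subst sum.reindex) (auto simp: inj_on_def)
  finally show ?thesis by (simp add: sum.distrib)
qed

lemma valid_qmem_hadamard:
  assumes "valid_qmem q" and i: "i < fresh q"
  shows "valid_qmem (q\<lparr>ket := hadamard i (ket q)\<rparr>)"
proof -
  let ?U = "{..<fresh q}"
  \<comment> \<open>Parallelogram identity: on each block the normalised sum and difference preserve
    the squared norm.\<close>
  have *: "(cmod ((a + b) / complex_of_real (sqrt 2)))\<^sup>2
      + (cmod ((a - b) / complex_of_real (sqrt 2)))\<^sup>2 = (cmod a)\<^sup>2 + (cmod b)\<^sup>2" for a b
  proof -
    have "(cmod (a + b))\<^sup>2 + (cmod (a - b))\<^sup>2 = 2 * ((cmod a)\<^sup>2 + (cmod b)\<^sup>2)"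
      by (simp add: cmod_power2) (simp add: power2_eq_square algebra_simps)
    then show ?thesis by (simp add: norm_divide power_divide add_divide_distrib[symmetric])
  qed
  have "(\<Sum>S\<in>Pow ?U. (cmod (hadamard i (ket q) S))\<^sup>2)
      = (\<Sum>S\<in>Pow (?U - {i}). (cmod (ket q S))\<^sup>2 + (cmod (ket q (insert i S)))\<^sup>2)"
    unfolding sum_Pow_split[OF finite_lessThan lessThan_iff[THEN iffD2, OF i]]
  proof (rule sum.cong[OF refl])
    fix S assume "S \<in> Pow (?U - {i})"
    then have "i \<notin> S" by auto
    then show "(cmod (hadamard i (ket q) S))\<^sup>2 + (cmod (hadamard i (ket q) (insert i S)))\<^sup>2
        = (cmod (ket q S))\<^sup>2 + (cmod (ket q (insert i S)))\<^sup>2"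
      using *[of "ket q S" "ket q (insert i S)"] by (simp add: hadamard_def)
  qed
  also have "\<dots> = 1"
    using assms sum_Pow_split[of ?U i "\<lambda>S. (cmod (ket q S))\<^sup>2"] by (simp add: valid_qmem_def)
  finally have "(\<Sum>S\<in>Pow ?U. (cmod (hadamard i (ket q) S))\<^sup>2) = 1" .
  moreover have "S \<subseteq> ?U" if "hadamard i (ket q) S \<noteq> 0" for S
  proof -
    from that have "ket q (S - {i}) \<noteq> 0 \<or> ket q (insert i S) \<noteq> 0"
      by (auto simp: hadamard_def)
    then have "S - {i} \<subseteq> ?U \<or> insert i S \<subseteq> ?U" using assms by (auto simp: valid_qmem_def)
    then show ?thesis using i by auto
  qed
  ultimately show ?thesis by (simp add: valid_qmem_def)
qed

lemma valid_qmem_tgate: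
  assumes "valid_qmem q"
  shows "valid_qmem (q\<lparr>ket := tgate i (ket q)\<rparr>)"
proof -
  have "cmod (tgate i \<psi> S) = cmod (\<psi> S)" for \<psi> S
    by (simp add: tgate_def norm_mult)
  moreover have "tgate i \<psi> S \<noteq> 0 \<Longrightarrow> \<psi> S \<noteq> 0" for \<psi> S
    by (auto simp: tgate_def)
  ultimately show ?thesis using assms by (auto simp: valid_qmem_def)
qed

lemma valid_qmem_cnot:
  assumes "valid_qmem q" and ij: "i < fresh q" "j < fresh q"
  shows "valid_qmem (q\<lparr>ket := cnot i j (ket q)\<rparr>)"
proof -
  let ?U = "{..<fresh q}"
  \<comment> \<open>On basis vectors the gate is this map, an involution on the subsets of
    \<open>?U\<close>, so it merely permutes the summands.\<close>
  define n where "n S = (if i \<in> S \<and> i \<noteq> j then (if j \<in> S then S - {j} else insert j S) else S)" for S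
  have inv: "n (n S) = S" for S
  proof (cases "i \<in> S \<and> i \<noteq> j")
    case True
    then have "n S = (if j \<in> S then S - {j} else insert j S)" "i \<in> n S" by (auto simp: n_def)
    moreover from this(2) True have "n (n S) = (if j \<in> n S then n S - {j} else insert j (n S))"
      by (subst n_def) simp
    ultimately show ?thesis by (simp split: if_splits) blast+
  next
    case False
    then have "n S = S" by (simp only: n_def if_False)
    then show ?thesis by simp
  qed
  have sub: "n S \<in> Pow ?U" if "S \<in> Pow ?U" for S using that ij
    by (cases "i \<in> S \<and> i \<noteq> j"; cases "j \<in> S") (simp_all add: n_def subset_iff)
  have cnot: "cnot i j (ket q) = (\<lambda>S. ket q (n S))" by (simp add: cnot_def n_def)
  have "(\<Sum>S\<in>Pow ?U. (cmod (ket q (n S)))\<^sup>2) = (\<Sum>S\<in>Pow ?U. (cmod (ket q S))\<^sup>2)"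
    by (rule sum.reindex_bij_witness[where i = n and j = n]) (rule inv sub refl, assumption?)+
  moreover have "S \<subseteq> ?U" if "ket q (n S) \<noteq> 0" for S
  proof -
    have "n S \<in> Pow ?U" using that assms(1) by (simp add: valid_qmem_def)
    from sub[OF this] show ?thesis by (simp add: inv)
  qed
  ultimately show ?thesis using assms(1) by (simp add: valid_qmem_def cnot)
qed

lemma prob_one_bounds:
  assumes "valid_qmem q"
  shows "0 \<le> prob_one i q" "prob_one i q \<le> 1"
proof -
  show "0 \<le> prob_one i q" by (simp add: prob_one_def sum_nonneg)
  have "prob_one i q \<le> (\<Sum>S \<in> Pow {..<fresh q}. (cmod (ket q S))\<^sup>2)"
    unfolding prob_one_def by (rule sum_mono2) auto
  then show "prob_one i q \<le> 1" using assms by (simp add: valid_qmem_def)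
qed

text \<open>Positivity excludes division by zero in the renormalisation; it holds for every outcome
  in the support of the measurement.\<close>

lemma valid_qmem_collapse:
  assumes q: "valid_qmem q" and pos: "(if b then prob_one i q else 1 - prob_one i q) > 0"
  shows "valid_qmem (collapse i b q)"
proof -
  let ?U = "Pow {..<fresh q}" and ?P = "if b then prob_one i q else 1 - prob_one i q"
  have one: "(\<Sum>S\<in>?U. (cmod (ket q S))\<^sup>2) = 1" using q by (simp add: valid_qmem_def)
  have "(\<Sum>S\<in>?U. (cmod (ket q S))\<^sup>2) = prob_one i q + (\<Sum>S\<in>?U - {S\<in>?U. i \<in> S}. (cmod (ket q S))\<^sup>2)"
    unfolding prob_one_def by (subst sum.subset_diff[of "{S\<in>?U. i \<in> S}" ?U]) auto
  moreover have "?U - {S\<in>?U. i \<in> S} = {S\<in>?U. i \<notin> S}" by auto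
  ultimately have P: "(\<Sum>S\<in>{S\<in>?U. (i \<in> S) = b}. (cmod (ket q S))\<^sup>2) = ?P"
    using one by (auto simp: prob_one_def)
  have "(\<Sum>S\<in>?U. (cmod (ket (collapse i b q) S))\<^sup>2)
      = (\<Sum>S\<in>?U. if (i \<in> S) = b then (cmod (ket q S))\<^sup>2 / ?P else 0)"
    using pos by (intro sum.cong refl) (auto simp: collapse_def norm_divide power_divide)
  also have "\<dots> = (\<Sum>S\<in>{S\<in>?U. (i \<in> S) = b}. (cmod (ket q S))\<^sup>2 / ?P)"
    by (rule sum.inter_filter[symmetric]) simp
  also have "\<dots> = 1" using P pos by (simp only: sum_divide_distrib[symmetric]) simp
  finally show ?thesis using q by (auto simp: valid_qmem_def collapse_def split: if_splits)
qed

lemma set_measure_qubit: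
  assumes "valid_qmem q" "(b, q') \<in> set_spmf (measure_qubit i q)"
  shows "valid_qmem q'" "fresh q' = fresh q"
proof -
  have "b \<in> set_pmf (bernoulli_pmf (prob_one i q))" and q': "q' = collapse i b q"
    using assms(2) by (auto simp: measure_qubit_def)
  then have "pmf (bernoulli_pmf (prob_one i q)) b > 0"
    by (simp add: pmf_positive)
  then show "valid_qmem q'"
    unfolding q' using prob_one_bounds[OF assms(1), of i]
    by (intro valid_qmem_collapse assms(1)) (cases b; simp)
  show "fresh q' = fresh q" by (simp add: q' collapse_def)
qed

text \<open>Allocation adds only index sets of amplitude 0.\<close>

lemma valid_qmem_fresh:
  assumes "valid_qmem q"
  shows "valid_qmem (q\<lparr>fresh := Suc (fresh q)\<rparr>)"
proof -
  have "(\<Sum>S\<in>Pow {..<Suc (fresh q)}. (cmod (ket q S))\<^sup>2) = (\<Sum>S\<in>Pow {..<fresh q}. (cmod (ket q S))\<^sup>2)"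
    by (rule sum.mono_neutral_right) (use assms in \<open>auto simp: valid_qmem_def\<close>)
  then show ?thesis using assms by (fastforce simp: valid_qmem_def)
qed

lemma valid_qmem_vacuum [simp]: "valid_qmem vacuum"
  by (simp add: valid_qmem_def vacuum_def)

text \<open>Meaningful together with \<open>finite_support\<close>, since a sum over an infinite set
  is 0 by convention.\<close>

definition total :: "(nat \<Rightarrow> 'a list) \<Rightarrow> nat" where
  "total f = (\<Sum>r | f r \<noteq> []. length (f r))"

definition finite_support :: "(nat \<Rightarrow> 'a list) \<Rightarrow> bool" where
  "finite_support f \<longleftrightarrow> finite {r. f r \<noteq> []}"

lemma total_superset:
  assumes "finite A" "{r. f r \<noteq> []} \<subseteq> A"
  shows "total f = (\<Sum>r\<in>A. length (f r))"
  unfolding total_def by (rule sum.mono_neutral_left) (use assms in auto)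

lemma finite_support_upd [simp]:
  "finite_support f \<Longrightarrow> finite_support (f(r := w))"
  unfolding finite_support_def by (rule finite_subset[of _ "insert r {r. f r \<noteq> []}"]) auto

lemma total_upd:
  assumes "finite_support f"
  shows "total (f(r := w)) + length (f r) = total f + length w"
proof -
  let ?A = "insert r {r. f r \<noteq> []}"
  have "total (f(r := w)) = (\<Sum>x\<in>?A. length ((f(r := w)) x))"
    using assms by (intro total_superset) (auto simp: finite_support_def)
  moreover have "total f = (\<Sum>x\<in>?A. length (f x))"
    using assms by (intro total_superset) (auto simp: finite_support_def)
  moreover have "(\<Sum>x\<in>?A - {r}. length ((f(r := w)) x)) = (\<Sum>x\<in>?A - {r}. length (f x))"
    by (rule sum.cong) auto
  ultimately show ?thesis
    using assms by (simp add: sum.insert_remove finite_support_def)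
qed

lemma length_le_total: "finite_support f \<Longrightarrow> length (f r) \<le> total f"
  by (cases "f r = []") (auto simp: total_def finite_support_def intro: member_le_sum[of r _ "\<lambda>r. length (f r)"])

lemma finite_support_comp_inj:
  "finite_support f \<Longrightarrow> inj g \<Longrightarrow> finite_support (\<lambda>r. f (g r))"
  using finite_vimageI[of "{r. f r \<noteq> []}" g] by (simp add: vimage_def finite_support_def)

lemma total_comp_inj_le:
  assumes "finite_support f" "inj g"
  shows "total (\<lambda>r. f (g r)) \<le> total f"
proof -
  let ?A = "{r. f (g r) \<noteq> []}"
  have "total (\<lambda>r. f (g r)) = (\<Sum>r\<in>g ` ?A. length (f r))"
    using assms(2) by (simp add: total_def sum.reindex inj_on_def)
  also have "\<dots> \<le> total f"
    unfolding total_def by (rule sum_mono2) (use assms in \<open>auto simp: finite_support_def\<close>)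
  finally show ?thesis .
qed

text \<open>Distinctness within stacks and disjointness between them say that no qubit can be
  reached in two ways. This carries \<open>valid_input\<close> over from the list of input stacks to
  all stacks at any time of a run.\<close>

definition wf_qreg :: "(reg \<Rightarrow> nat list) \<Rightarrow> qmem \<Rightarrow> bool" where
  "wf_qreg g q \<longleftrightarrow> valid_qmem q \<and> finite_support g \<and>
     (\<forall>r. distinct (g r) \<and> set (g r) \<subseteq> {..<fresh q}) \<and>
     (\<forall>r r'. r \<noteq> r' \<longrightarrow> set (g r) \<inter> set (g r') = {})"

definition wf_config :: "config \<Rightarrow> bool" where
  "wf_config s \<longleftrightarrow> finite_support (creg s) \<and> wf_qreg (qreg s) (qmem_of s)"

definition memory :: "config \<Rightarrow> nat" where
  "memory s = total (creg s) + total (qreg s)"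

lemma wf_qreg_pop:
  assumes wf: "wf_qreg g q" and r: "g r = i # is"
  shows "wf_qreg (g(r := is)) q"
proof -
  have sub: "set ((g(r := is)) x) \<subseteq> set (g x)" for x using r by auto
  have "distinct (g x)" for x using wf by (simp add: wf_qreg_def)
  from this[of r] this have "distinct ((g(r := is)) x)" for x using r by simp
  moreover have "set ((g(r := is)) x) \<subseteq> {..<fresh q}" for x
    using wf sub[of x] unfolding wf_qreg_def by blast
  moreover have "set ((g(r := is)) x) \<inter> set ((g(r := is)) y) = {}" if "x \<noteq> y" for x y
    using wf sub[of x] sub[of y] that unfolding wf_qreg_def by blast
  ultimately show ?thesis using wf by (simp add: wf_qreg_def del: fun_upd_apply)
qed

lemma wf_qreg_push:
  "wf_qreg g q \<Longrightarrow> i < fresh q \<Longrightarrow> (\<And>r. i \<notin> set (g r)) \<Longrightarrow> wf_qreg (g(r := i # g r)) q"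
  by (auto simp: wf_qreg_def)

lemma wf_qreg_move:
  assumes "wf_qreg g q" "g r = i # is"
  shows "wf_qreg (g(r := is, r' := i # (g(r := is)) r')) q"
proof (rule wf_qreg_push[OF wf_qreg_pop[OF assms]])
  show "i < fresh q" using assms unfolding wf_qreg_def
    by (metis insert_subset lessThan_iff list.simps(15))
  show "i \<notin> set ((g(r := is)) x)" for x
  proof (cases "x = r")
    case True
    have "distinct (g r)" using assms(1) by (simp add: wf_qreg_def)
    with True show ?thesis using assms(2) by simp
  next
    case False
    then have "set (g x) \<inter> set (g r) = {}" using assms(1) by (simp add: wf_qreg_def)
    with False show ?thesis using assms(2) by auto
  qed
qed

lemma wf_qreg_qmem:
  "wf_qreg g q \<Longrightarrow> valid_qmem q' \<Longrightarrow> fresh q' = fresh q \<Longrightarrow> wf_qreg g q'"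
  by (simp add: wf_qreg_def)

lemma wf_qreg_hd: "wf_qreg g q \<Longrightarrow> g r = i # is \<Longrightarrow> i < fresh q"
  unfolding wf_qreg_def by (metis insert_subset lessThan_iff list.simps(15))

lemma tick_simps [simp]:
  "creg (tick k s) = creg s" "qreg (tick k s) = qreg s" "qmem_of (tick k s) = qmem_of s"
  "steps (tick k s) = steps s + k" "memory (tick k s) = memory s"
  "wf_config (tick k s) = wf_config s"
  by (simp_all add: tick_def memory_def wf_config_def)

lemma set_reg_simps [simp]:
  "creg (set_creg r w s) = (creg s)(r := w)" "qreg (set_creg r w s) = qreg s"
  "qmem_of (set_creg r w s) = qmem_of s" "steps (set_creg r w s) = steps s"
  "creg (set_qreg r z s) = creg s" "qreg (set_qreg r z s) = (qreg s)(r := z)"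
  "qmem_of (set_qreg r z s) = qmem_of s" "steps (set_qreg r z s) = steps s"
  by (simp_all add: set_creg_def set_qreg_def)

lemma apply_ket_simps [simp]:
  "creg (apply_ket U s) = creg s" "qreg (apply_ket U s) = qreg s" "steps (apply_ket U s) = steps s"
  "qmem_of (apply_ket U s) = (qmem_of s)\<lparr>ket := U (ket (qmem_of s))\<rparr>"
  by (simp_all add: apply_ket_def)

text \<open>The inequality, written without subtraction, says that memory grows by at most the
  number of steps spent. It makes running times compose: a second program starts on data whose size
  is bounded through the time of the first.\<close>

definition tame :: "config \<Rightarrow> config \<Rightarrow> bool" where
  "tame s s' \<longleftrightarrow> wf_config s' \<and> memory s' + steps s \<le> memory s + steps s'"

lemma tame_set_creg:
  assumes "wf_config s" "length w \<le> length (creg s r) + k"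
  shows "tame s (tick k (set_creg r w s))"
  using assms total_upd[of "creg s" r w] by (auto simp: tame_def wf_config_def memory_def)

lemma tame_qreg_eq:
  assumes "wf_config s" "creg s' = creg s" "qreg s' = qreg s" "steps s' = steps s"
    "valid_qmem (qmem_of s')" "fresh (qmem_of s') = fresh (qmem_of s)"
  shows "tame s (tick k s')"
  using assms by (auto simp: tame_def wf_config_def memory_def intro: wf_qreg_qmem)

text \<open>No instruction creates more data than it costs. The critical case is
  \<open>Copy\<close>, which is charged the length of the string.\<close>

lemma exec_tame: "wf_config s \<Longrightarrow> s' \<in> set_spmf (exec c s) \<Longrightarrow> tame s s'"
proof (induction c arbitrary: s s')
  case Skip
  then show ?case by (simp add: tame_qreg_eq wf_config_def wf_qreg_def)
next
  case (Push r b)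
  then show ?case by (simp add: tame_set_creg)
next
  case (Pop r)
  then show ?case by (simp add: tame_set_creg)
next
  case (Copy r r')
  then show ?case by (simp add: tame_set_creg)
next
  case (Coin r)
  then show ?case by (auto simp: tame_set_creg)
next
  case (New r)
  have wf: "wf_qreg (qreg s) (qmem_of s)" using New by (simp add: wf_config_def)
  let ?q = "(qmem_of s)\<lparr>fresh := Suc (fresh (qmem_of s))\<rparr>"
  have "wf_qreg (qreg s) ?q"
    using wf valid_qmem_fresh by (fastforce simp: wf_qreg_def)
  moreover have "fresh (qmem_of s) \<notin> set (qreg s x)" for x
    using wf by (auto simp: wf_qreg_def)
  ultimately have "wf_qreg ((qreg s)(r := fresh (qmem_of s) # qreg s r)) ?q"
    by (intro wf_qreg_push) auto
  then show ?case
    using New total_upd[of "qreg s" r "fresh (qmem_of s) # qreg s r"] wf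
    by (auto simp: tame_def wf_config_def alloc_def memory_def wf_qreg_def)
next
  case (Move r r')
  show ?case
  proof (cases "qreg s r")
    case Nil
    with Move show ?thesis by (simp add: tame_qreg_eq wf_config_def wf_qreg_def)
  next
    case (Cons i "is")
    have wf: "wf_qreg (qreg s) (qmem_of s)" using Move by (simp add: wf_config_def)
    have fin: "finite_support (qreg s)" "finite_support ((qreg s)(r := is))"
      using wf by (auto simp: wf_qreg_def)
    have "total ((qreg s)(r := is, r' := i # ((qreg s)(r := is)) r')) = total (qreg s)"
      using total_upd[OF fin(1), of r "is"] Cons
        total_upd[OF fin(2), of r' "i # ((qreg s)(r := is)) r'"] by simp
    then show ?thesis
      using Move wf_qreg_move[OF wf Cons, of r'] Cons
      by (auto simp: tame_def wf_config_def memory_def Let_def)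
  qed
next
  case (Had r)
  then show ?case
    by (cases "qreg s r")
      (auto intro!: tame_qreg_eq valid_qmem_hadamard simp: wf_config_def wf_qreg_hd, auto simp: wf_qreg_def)
next
  case (Tee r)
  then show ?case
    by (cases "qreg s r")
      (auto intro!: tame_qreg_eq valid_qmem_tgate simp: wf_config_def, auto simp: wf_qreg_def)
next
  case (Cnot r r')
  then show ?case
    by (cases "qreg s r"; cases "qreg s r'")
      (auto intro!: tame_qreg_eq valid_qmem_cnot simp: wf_config_def wf_qreg_hd, auto simp: wf_qreg_def)
next
  case (Measure r r')
  show ?case
  proof (cases "qreg s r")
    case Nil
    with Measure show ?thesis by (simp add: tame_qreg_eq wf_config_def wf_qreg_def)
  next
    case (Cons i "is")
    have wf: "wf_qreg (qreg s) (qmem_of s)" using Measure by (simp add: wf_config_def)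
    obtain b q where q: "(b, q) \<in> set_spmf (measure_qubit i (qmem_of s))"
      and s': "s' = tick 1 (set_creg r' (b # creg s r') (set_qreg r is (s\<lparr>qmem_of := q\<rparr>)))"
      using Measure(2) Cons by auto
    have "valid_qmem q" "fresh q = fresh (qmem_of s)"
      using set_measure_qubit[OF _ q] wf by (auto simp: wf_qreg_def)
    then show ?thesis
      using wf_qreg_qmem[OF wf_qreg_pop[OF wf Cons], of q] Measure(1) Cons
        total_upd[of "creg s" r' "b # creg s r'"] total_upd[of "qreg s" r "is"] wf
      by (auto simp: tame_def wf_config_def memory_def s' wf_qreg_def)
  qed
next
  case (Seq c d)
  from Seq.prems(2) obtain t where t: "t \<in> set_spmf (exec c s)" "s' \<in> set_spmf (exec d t)"
    by (auto simp: set_bind_spmf)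
  have st: "tame s t" by (rule Seq.IH(1)[OF Seq.prems(1) t(1)])
  moreover have "tame t s'" by (rule Seq.IH(2)[OF _ t(2)]) (use st in \<open>simp add: tame_def\<close>)
  ultimately show ?case by (auto simp: tame_def)
next
  case (Branch b c d)
  show ?case
  proof (cases "holds b s")
    case True
    then have "tame (tick 1 s) s'" using Branch.IH(1)[of "tick 1 s" s'] Branch.prems by simp
    then show ?thesis by (simp add: tame_def)
  next
    case False
    then have "tame (tick 1 s) s'" using Branch.IH(2)[of "tick 1 s" s'] Branch.prems by simp
    then show ?thesis by (simp add: tame_def)
  qed
next
  case (While b c)
  from While.prems(2) obtain t where
    t: "t \<in> set_spmf (while_spmf (holds b) (\<lambda>s. exec c (tick 1 s)) s)" "s' = tick 1 t"
    by auto
  have "tame s t"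
  proof (rule while_spmf_invariant[OF _ _ t(1), of "tame s"])
    show "tame s s" using While.prems by (simp add: tame_def)
    show "tame s u'" if "tame s u" "u' \<in> set_spmf (exec c (tick 1 u))" for u u'
      using While.IH[of "tick 1 u" u'] that by (auto simp: tame_def)
  qed
  then show ?case by (simp add: t(2) tame_def)
qed

section \<open>Closure properties of polynomial time\<close>

lemma poly_nat_mono: "x \<le> y \<Longrightarrow> poly p x \<le> poly p (y :: nat)"
  by (induction p) (auto intro!: add_mono mult_le_mono)

lemma ren_id [simp]: "ren id id c = c"
proof -
  have "ren_test id id t = t" for t by (cases t) simp_all
  then show ?thesis by (induction c) simp_all
qed

lemma wf_config_view:
  assumes "wf_config s" "inj f" "inj g"
  shows "wf_config \<lparr>creg = \<lambda>r. creg s (f r), qreg = \<lambda>r. qreg s (g r), qmem_of = qmem_of s, steps = k\<rparr>"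
  using assms by (auto simp: wf_config_def wf_qreg_def finite_support_comp_inj inj_eq)

lemma memory_view:
  assumes "wf_config s" "inj f" "inj g"
  shows "memory \<lparr>creg = \<lambda>r. creg s (f r), qreg = \<lambda>r. qreg s (g r), qmem_of = qmem_of s, steps = k\<rparr>
    \<le> memory s"
  using assms total_comp_inj_le[of "creg s" f] total_comp_inj_le[of "qreg s" g]
  by (auto simp: memory_def wf_config_def wf_qreg_def)

lemma embed_view:
  assumes "inj f" "inj g"
  shows "embed f g vacuum s
    \<lparr>creg = \<lambda>r. creg s (f r), qreg = \<lambda>r. qreg s (g r), qmem_of = qmem_of s, steps = 0\<rparr> = s"
proof -
  have "map ((+) 0) w = w" for w :: "nat list" by (simp add: map_idI)
  moreover have "fresh vacuum = 0" by (simp add: vacuum_def)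
  ultimately show ?thesis
    by (intro config.equality) (auto simp: embed_def fun_eq_iff f_inv_into_f)
qed

text \<open>A configuration is the embedding of its own view through \<open>f\<close> and
  \<open>g\<close>, so \<open>exec_embed\<close> applies to any configuration; with
  \<open>vacuum\<close> as the inert state no qubit is renamed.\<close>

lemma exec_view:
  assumes "inj f" "inj g"
  shows "exec (ren f g c) s = map_spmf (embed f g vacuum s) (exec c
    \<lparr>creg = \<lambda>r. creg s (f r), qreg = \<lambda>r. qreg s (g r), qmem_of = qmem_of s, steps = 0\<rparr>)"
  by (subst exec_embed[OF assms valid_qmem_vacuum, symmetric]) (simp only: embed_view[OF assms])

lemma distinct_concat_upt:
  assumes "\<And>r. distinct (g r)" "\<And>r r'. r \<noteq> r' \<Longrightarrow> set (g r) \<inter> set (g r') = {}"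
  shows "distinct (concat (map g [0..<M]))"
  using assms by (induction M) (auto, metis disjoint_iff nat_neq_iff)

lemma finite_support_load: "finite_support (\<lambda>r. if r < length ws then ws ! r else [])"
  unfolding finite_support_def by (rule finite_subset[of _ "{..<length ws}"]) auto

lemma total_load: "total (\<lambda>r. if r < length ws then ws ! r else []) = length (concat ws)"
proof -
  have "total (\<lambda>r. if r < length ws then ws ! r else [])
      = (\<Sum>r<length ws. length (if r < length ws then ws ! r else []))"
    by (rule total_superset) auto
  also have "\<dots> = length (concat ws)"
    by (simp add: length_concat sum_list_sum_nth atLeast0LessThan)
  finally show ?thesis .
qed

lemma memory_load: "memory (load cs qs q) = length (concat cs) + length (concat qs)"
  by (simp add: memory_def load_def total_load)

lemma distinct_concat_disjoint:
  "distinct (concat ws) \<Longrightarrow> i < length ws \<Longrightarrow> j < length ws \<Longrightarrow> i \<noteq> j \<Longrightarrow> set (ws ! i) \<inter> set (ws ! j) = {}"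
proof (induction ws arbitrary: i j)
  case (Cons w ws)
  have sub: "set (ws ! k) \<subseteq> set (concat ws)" if "k < length ws" for k
    using nth_mem[OF that] by auto
  have d: "distinct (concat ws)" "set w \<inter> set (concat ws) = {}"
    using Cons.prems(1) by auto
  show ?case
  proof (cases i)
    case 0
    then obtain k where "j = Suc k" "k < length ws" using Cons.prems by (cases j) auto
    then show ?thesis using 0 d(2) sub[of k] by auto
  next
    case (Suc k)
    show ?thesis
    proof (cases j)
      case 0
      then show ?thesis using Suc Cons.prems(2) d(2) sub[of k] by auto
    next
      case (Suc l)
      then show ?thesis using \<open>i = Suc k\<close> Cons.prems Cons.IH[OF d(1), of k l] by simp
    qed
  qed
qed simp

lemma wf_config_load:
  assumes "valid_input qs q"
  shows "wf_config (load cs qs q)"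
proof -
  have d: "distinct (concat qs)" and sub: "\<And>i. i < length qs \<Longrightarrow> set (qs ! i) \<subseteq> {..<fresh q}"
    using assms by (fastforce simp: valid_input_def dest: nth_mem)+
  have "distinct (qs ! i)" if "i < length qs" for i
    using d that by (simp add: distinct_concat_iff)
  then show ?thesis
    using assms distinct_concat_disjoint[OF d] sub
    by (auto simp: wf_config_def wf_qreg_def load_def finite_support_load valid_input_def
        disjoint_iff)
qed

text \<open>
  Unlike the definition of \<open>QPT\<close>, the following formulation speaks about all well-formed
  configurations rather than initial ones, which makes it compositional.
\<close>

definition runs_within :: "prog \<Rightarrow> nat poly \<Rightarrow> bool" where
  "runs_within c p \<longleftrightarrow> (\<forall>s. wf_config s \<longrightarrow> lossless_spmf (exec c s) \<and>
     (\<forall>s' \<in> set_spmf (exec c s). steps s' \<le> steps s + poly p (memory s)))"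

text \<open>A well-formed configuration has finitely many nonempty stacks, all below some
  \<open>M\<close>. Reading off the first \<open>M\<close> stacks as inputs turns it, apart from the
  step count, into an initial configuration with the same memory, to which \<open>QPT\<close>
  applies.\<close>

lemma QPT_iff: "QPT c \<longleftrightarrow> (\<exists>p. runs_within c p)"
proof
  assume "QPT c"
  then obtain p where p: "\<And>cs qs q. valid_input qs q \<Longrightarrow>
     lossless_spmf (exec c (load cs qs q)) \<and>
     (\<forall>s \<in> set_spmf (exec c (load cs qs q)).
        steps s \<le> poly p (length (concat cs) + length (concat qs)))"
    unfolding QPT_def by blast
  have "runs_within c p"
    unfolding runs_within_def
  proof (intro allI impI)
    fix s assume wf: "wf_config s"
    then have fin: "finite ({r. creg s r \<noteq> []} \<union> {r. qreg s r \<noteq> []})"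
      by (simp add: wf_config_def wf_qreg_def finite_support_def)
    then obtain M where M: "\<And>r. creg s r \<noteq> [] \<or> qreg s r \<noteq> [] \<Longrightarrow> r < M"
      unfolding finite_nat_set_iff_bounded by blast
    let ?cs = "map (creg s) [0..<M]" and ?qs = "map (qreg s) [0..<M]"
    let ?t = "load ?cs ?qs (qmem_of s)"
    have t: "?t = \<lparr>creg = \<lambda>r. creg s (id r), qreg = \<lambda>r. qreg s (id r), qmem_of = qmem_of s, steps = 0\<rparr>"
      using M by (force simp: load_def)
    have exec: "exec c s = map_spmf (embed id id vacuum s) (exec c ?t)"
      using exec_view[of id id c s] unfolding t by simp
    have "valid_input ?qs (qmem_of s)"
      using wf unfolding valid_input_def
      by (intro conjI distinct_concat_upt) (auto simp: wf_config_def wf_qreg_def)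
    moreover have "length (concat ?cs) + length (concat ?qs) = memory s"
      unfolding memory_load[of _ _ "qmem_of s", symmetric] t by (simp add: memory_def)
    ultimately show "lossless_spmf (exec c s) \<and>
        (\<forall>s' \<in> set_spmf (exec c s). steps s' \<le> steps s + poly p (memory s))"
      using p[of ?qs "qmem_of s" ?cs] by (auto simp: exec embed_def simp del: length_concat)
  qed
  then show "\<exists>p. runs_within c p" ..
next
  assume "\<exists>p. runs_within c p"
  then obtain p where p: "runs_within c p" ..
  show "QPT c"
    unfolding QPT_def
    using p[unfolded runs_within_def, rule_format, OF wf_config_load]
    by (intro exI[of _ p]) (simp add: memory_load, simp add: load_def)
qed

lemma QPT_Seq:
  assumes "QPT c" "QPT d"
  shows "QPT (Seq c d)"
proof -
  obtain p p' where p: "runs_within c p" and p': "runs_within d p'"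
    using assms unfolding QPT_iff by blast
  \<comment> \<open>By \<open>exec_tame\<close> the second program starts with memory at most x +
    p(x), where x is the initial memory; hence the composition of \<open>p'\<close> with the
    identity plus \<open>p\<close>.\<close>
  have "runs_within (Seq c d) (p + pcompose p' ([:0, 1:] + p))"
    unfolding runs_within_def
  proof (intro allI impI)
    fix s assume wf: "wf_config s"
    have *: "lossless_spmf (exec d t) \<and> (\<forall>s' \<in> set_spmf (exec d t).
        steps s' \<le> steps s + poly p (memory s) + poly p' (memory s + poly p (memory s)))"
      if t: "t \<in> set_spmf (exec c s)" for t
    proof -
      have "tame s t" by (rule exec_tame[OF wf t])
      moreover have st: "steps t \<le> steps s + poly p (memory s)"
        using p wf t by (simp add: runs_within_def)
      ultimately have "wf_config t" "memory t \<le> memory s + poly p (memory s)"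
        by (auto simp: tame_def)
      with poly_nat_mono[OF this(2), of p'] p' st show ?thesis
        unfolding runs_within_def by fastforce
    qed
    then show "lossless_spmf (exec (Seq c d) s) \<and> (\<forall>s' \<in> set_spmf (exec (Seq c d) s).
        steps s' \<le> steps s + poly (p + pcompose p' ([:0, 1:] + p)) (memory s))"
      using p wf by (auto simp: runs_within_def set_bind_spmf poly_pcompose add.assoc)
  qed
  then show ?thesis unfolding QPT_iff ..
qed

lemma QPT_Branch:
  assumes "QPT c" "QPT d"
  shows "QPT (Branch t c d)"
proof -
  obtain p p' where p: "runs_within c p" and p': "runs_within d p'"
    using assms unfolding QPT_iff by blast
  have "runs_within (Branch t c d) ([:1:] + p + p')"
    unfolding runs_within_def
  proof (intro allI impI)
    fix s assume "wf_config s"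
    then show "lossless_spmf (exec (Branch t c d) s) \<and> (\<forall>s' \<in> set_spmf (exec (Branch t c d) s).
        steps s' \<le> steps s + poly ([:1:] + p + p') (memory s))"
      using p[unfolded runs_within_def, rule_format, of "tick 1 s"]
        p'[unfolded runs_within_def, rule_format, of "tick 1 s"]
      by (auto simp: add.assoc)
  qed
  then show ?thesis unfolding QPT_iff ..
qed

text \<open>The renamed program sees only the memory visible through the renaming, which is no
  larger than the whole, so the same polynomial works.\<close>

lemma QPT_ren:
  assumes "inj f" "inj g" "QPT c"
  shows "QPT (ren f g c)"
proof -
  obtain p where p: "runs_within c p" using assms unfolding QPT_iff by blast
  have "runs_within (ren f g c) p"
    unfolding runs_within_def
  proof (intro allI impI)
    fix s assume wf: "wf_config s"
    let ?t = "\<lparr>creg = \<lambda>r. creg s (f r), qreg = \<lambda>r. qreg s (g r), qmem_of = qmem_of s, steps = 0\<rparr>"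
    have "poly p (memory ?t) \<le> poly p (memory s)"
      by (intro poly_nat_mono memory_view wf assms)
    moreover have "lossless_spmf (exec c ?t) \<and> (\<forall>s' \<in> set_spmf (exec c ?t). steps s' \<le> poly p (memory ?t))"
      using p[unfolded runs_within_def, rule_format, OF wf_config_view[OF wf assms(1,2)], of 0] by simp
    ultimately show "lossless_spmf (exec (ren f g c) s) \<and>
        (\<forall>s' \<in> set_spmf (exec (ren f g c) s). steps s' \<le> steps s + poly p (memory s))"
      unfolding exec_view[OF assms(1,2)] by (fastforce simp: embed_def)
  qed
  then show ?thesis unfolding QPT_iff ..
qed

text \<open>A rule for loops with variant \<open>m\<close> and cost at most \<open>k\<close> per
  round, test included. Induction on \<open>m\<close> gives termination with probability 1 and at
  most \<open>m s * k\<close> steps; the last test accounts for the constant 1 in the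
  polynomial.\<close>

lemma QPT_While:
  assumes body: "\<And>s. wf_config s \<Longrightarrow> holds t s \<Longrightarrow> lossless_spmf (exec c (tick 1 s)) \<and>
      (\<forall>s' \<in> set_spmf (exec c (tick 1 s)). steps s' \<le> steps s + k \<and> m s' < m s)"
    and m: "\<And>s. wf_config s \<Longrightarrow> m s \<le> memory s"
  shows "QPT (While t c)"
proof -
  let ?w = "while_spmf (holds t) (\<lambda>s. exec c (tick 1 s))"
  have w: "lossless_spmf (?w s) \<and> (\<forall>s' \<in> set_spmf (?w s). steps s' \<le> steps s + m s * k)"
    if "wf_config s" for s
    using that
  proof (induction "m s" arbitrary: s rule: less_induct)
    case less
    show ?case
    proof (cases "holds t s")
      case True
      have *: "lossless_spmf (?w s') \<and> (\<forall>s'' \<in> set_spmf (?w s'). steps s'' \<le> steps s + m s * k)"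
        if s': "s' \<in> set_spmf (exec c (tick 1 s))" for s'
      proof -
        have st: "steps s' \<le> steps s + k" "m s' < m s" using body[OF less.prems True] s' by auto
        have "wf_config s'" using exec_tame[OF _ s'] less.prems by (simp add: tame_def)
        note IH = less.hyps[OF st(2) this]
        have "m s' * k + k \<le> m s * k" using st(2) by (metis add.commute mult_Suc mult_le_mono1 Suc_leI)
        with IH st(1) show ?thesis by fastforce
      qed
      show ?thesis
        by (subst (1 2) while_spmf.simps) (use True * body[OF less.prems True] in \<open>auto simp: set_bind_spmf\<close>)
    next
      case False
      then show ?thesis by (subst (1 2) while_spmf.simps) simp
    qed
  qed
  have "runs_within (While t c) [:1, k:]"
    unfolding runs_within_def
  proof (intro allI impI)
    fix s assume wf: "wf_config s"
    have "m s * k \<le> memory s * k" using m[OF wf] by simp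
    then show "lossless_spmf (exec (While t c) s) \<and> (\<forall>s' \<in> set_spmf (exec (While t c) s).
        steps s' \<le> steps s + poly [:1, k:] (memory s))"
      using w[OF wf] by (auto simp: mult.commute dest!: bspec intro: order_trans)
  qed
  then show ?thesis unfolding QPT_iff ..
qed

lemma QPT_basic:
  "QPT Skip" "QPT (Push r b)" "QPT (Pop r)" "QPT (Copy r r')" "QPT (Coin r)" "QPT (Move r r')"
proof -
  have "length (creg s r) \<le> memory s" if "wf_config s" for s
    using that length_le_total[of "creg s" r] by (auto simp: wf_config_def memory_def)
  then have "runs_within (Copy r r') [:1, 1:]"
    by (auto simp: runs_within_def)
  moreover have "runs_within (Move r r') [:1:]"
    by (auto simp: runs_within_def Let_def split: list.split)
  moreover have "runs_within Skip [:1:]" "runs_within (Push r b) [:1:]" "runs_within (Pop r) [:1:]"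
    "runs_within (Coin r) [:1:]"
    by (auto simp: runs_within_def)
  ultimately show "QPT Skip" "QPT (Push r b)" "QPT (Pop r)" "QPT (Copy r r')" "QPT (Coin r)" "QPT (Move r r')"
    unfolding QPT_iff by blast+
qed

section \<open>Composing algorithms\<close>

text \<open>
  \<open>Call c vs ws\<close> runs \<open>c\<close> with its bit stacks \<open>0, 1, \<dots>\<close> placed on the variables \<open>vs\<close> and its qubit
  stacks \<open>0, 1, \<dots>\<close> on the variables \<open>ws\<close>, for inputs and outputs alike.  Variables are the stacks
  below 10.  All other stacks of \<open>c\<close> go to a bank which no other call touches, so no clean-up is
  necessary and nothing but renaming is needed to pass quantum data.
\<close>

datatype instr = Cp reg reg | Call prog "reg list" "reg list"

text \<open>Injectivity of the pairing keeps the banks of different calls disjoint, and the offset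
  10 keeps them off the variables.\<close>

definition bank :: "nat \<Rightarrow> reg \<Rightarrow> reg" where
  "bank j r = 10 + prod_encode (j, r)"

definition window :: "reg list \<Rightarrow> nat \<Rightarrow> reg \<Rightarrow> reg" where
  "window vs j r = (if r < length vs then vs ! r else bank j r)"

primrec instr_ok :: "instr \<Rightarrow> bool" where
  "instr_ok (Cp r r') = (r < 10 \<and> r' < 10)"
| "instr_ok (Call c vs ws) = (distinct vs \<and> (\<forall>r\<in>set vs. r < 10) \<and> distinct ws \<and> (\<forall>r\<in>set ws. r < 10))"

primrec instr_prog :: "nat \<Rightarrow> instr \<Rightarrow> prog" where
  "instr_prog j (Cp r r') = Copy r r'"
| "instr_prog j (Call c vs ws) = ren (window vs j) (window ws j) c"

primrec compile :: "nat \<Rightarrow> instr list \<Rightarrow> prog" where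
  "compile j [] = Skip"
| "compile j (i # is) = Seq (instr_prog j i) (compile (Suc j) is)"

primrec assign :: "reg list \<Rightarrow> (nat \<Rightarrow> 'b) \<Rightarrow> (reg \<Rightarrow> 'b) \<Rightarrow> reg \<Rightarrow> 'b" where
  "assign [] f v = v"
| "assign (r # rs) f v = (assign rs (\<lambda>i. f (Suc i)) v)(r := f 0)"

type_synonym env = "(reg \<Rightarrow> bits) \<times> (reg \<Rightarrow> nat list) \<times> qmem"

text \<open>The intended meaning of scripts, in which banks do not occur: a call starts with
  everything but its arguments empty, and all that survives of its stacks is what it leaves on the
  listed variables.\<close>

primrec run1 :: "instr \<Rightarrow> env \<Rightarrow> env spmf" where
  "run1 (Cp r r') e = (case e of (v, qv, q) \<Rightarrow> return_spmf (v(r' := v r), qv, q))"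
| "run1 (Call c vs ws) e = (case e of (v, qv, q) \<Rightarrow>
     map_spmf (\<lambda>(out, qout, q). (assign vs out v, assign ws qout qv, q))
       (call c (map v vs) (map qv ws) q))"

primrec run :: "instr list \<Rightarrow> env \<Rightarrow> env spmf" where
  "run [] e = return_spmf e"
| "run (i # is) e = bind_spmf (run1 i e) (run is)"

lemma run_append: "run (is @ js) e = bind_spmf (run is e) (run js)"
proof (induction "is" arbitrary: e)
  case (Cons i "is")
  then have "run (is @ js) = (\<lambda>e. bind_spmf (run is e) (run js))" by blast
  then show ?case by (simp add: bind_spmf_assoc)
qed simp

lemma assign_notin: "r \<notin> set vs \<Longrightarrow> assign vs f v r = v r"
  by (induction vs arbitrary: f) auto

lemma assign_nth: "distinct vs \<Longrightarrow> i < length vs \<Longrightarrow> assign vs f v (vs ! i) = f i"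
  by (induction vs arbitrary: f i) (auto simp: nth_Cons split: nat.split)

lemma bank_eq [simp]: "bank j r = bank j' r' \<longleftrightarrow> j = j' \<and> r = r'"
  by (simp add: bank_def)

lemma bank_ge: "bank j r \<ge> 10"
  by (simp add: bank_def)

lemma inj_window:
  assumes "distinct vs" "\<forall>r\<in>set vs. r < 10"
  shows "inj (window vs j)"
proof (rule injI)
  fix x y assume eq: "window vs j x = window vs j y"
  have "vs ! i \<noteq> bank j r" if "i < length vs" for i r
    using assms(2) that bank_ge[of j r] by (metis nth_mem not_le)
  with eq assms(1) show "x = y"
    by (auto simp: window_def nth_eq_iff_index_eq split: if_splits) metis+
qed

lemma window_less_10:
  assumes "\<forall>r\<in>set vs. r < 10" "r < 10"
  shows "r \<in> range (window vs j) \<longleftrightarrow> r \<in> set vs"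
proof
  assume "r \<in> range (window vs j)"
  then obtain i where "r = window vs j i" ..
  then show "r \<in> set vs"
    using assms(2) bank_ge[of j i] by (simp add: window_def split: if_splits)
next
  assume "r \<in> set vs"
  then obtain i where "i < length vs" "r = window vs j i"
    by (metis in_set_conv_nth window_def)
  then show "r \<in> range (window vs j)" by blast
qed

lemma bank_notin_window:
  assumes "\<forall>r\<in>set vs. r < 10" "i \<noteq> j"
  shows "bank i r \<notin> range (window vs j)"
  using assms bank_ge[of i r] by (auto simp: window_def split: if_splits dest!: nth_mem)

definition vars :: "(reg \<Rightarrow> 'a list) \<Rightarrow> reg \<Rightarrow> 'a list" where
  "vars f r = (if r < 10 then f r else [])"

lemma vars_window:
  assumes vs: "distinct vs" "\<forall>r\<in>set vs. r < 10"
  shows "vars (\<lambda>r. if r \<in> range (window vs j) then h (inv (window vs j) r) else f r)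
    = assign vs h (vars f)"
proof
  fix r
  show "vars (\<lambda>r. if r \<in> range (window vs j) then h (inv (window vs j) r) else f r) r
    = assign vs h (vars f) r"
  proof (cases "r \<in> set vs")
    case True
    then obtain i where i: "i < length vs" "r = vs ! i" by (metis in_set_conv_nth)
    then have "window vs j i = r" by (simp add: window_def)
    then have "inv (window vs j) r = i" "r \<in> range (window vs j)"
      using inj_window[OF vs] by auto
    then show ?thesis
      using i vs True by (simp add: vars_def assign_nth)
  next
    case False
    then show ?thesis using window_less_10[OF vs(2), of r j] by (simp add: vars_def assign_notin)
  qed
qed

definition env_of :: "config \<Rightarrow> env" where
  "env_of s = (vars (creg s), vars (qreg s), qmem_of s)"

text \<open>Emptiness of the banks from \<open>j\<close> on makes the view of call number
  \<open>j\<close> an initial configuration. The second claim is the invariant for the next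
  instruction: call number \<open>j\<close> dirties no bank but its own.\<close>

lemma exec_instr_prog:
  assumes ok: "instr_ok i" and free: "\<And>j' r. j \<le> j' \<Longrightarrow> creg s (bank j' r) = [] \<and> qreg s (bank j' r) = []"
  shows "map_spmf env_of (exec (instr_prog j i) s) = run1 i (env_of s)"
    and "s' \<in> set_spmf (exec (instr_prog j i) s) \<Longrightarrow> Suc j \<le> j' \<Longrightarrow>
      creg s' (bank j' r) = [] \<and> qreg s' (bank j' r) = []"
proof -
  have "map_spmf env_of (exec (instr_prog j i) s) = run1 i (env_of s) \<and>
    (\<forall>s' \<in> set_spmf (exec (instr_prog j i) s). \<forall>j' r. Suc j \<le> j' \<longrightarrow>
      creg s' (bank j' r) = [] \<and> qreg s' (bank j' r) = [])"
  proof (cases i)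
    case (Cp x y)
    have xy: "x < 10" "y < 10" using ok Cp by auto
    then have "vars ((creg s)(y := creg s x)) = (vars (creg s))(y := vars (creg s) x)"
      by (auto simp: vars_def fun_eq_iff)
    moreover have "bank j' r \<noteq> y" for j' r using xy bank_ge[of j' r] by simp
    ultimately show ?thesis using free by (simp add: Cp env_of_def)
  next
    case (Call c vs ws)
    have vs: "distinct vs" "\<forall>r\<in>set vs. r < 10" and ws: "distinct ws" "\<forall>r\<in>set ws. r < 10"
      using ok Call by auto
    have view: "\<lparr>creg = \<lambda>r. creg s (window vs j r), qreg = \<lambda>r. qreg s (window ws j r), qmem_of = qmem_of s, steps = 0\<rparr>
      = load (map (creg s) vs) (map (qreg s) ws) (qmem_of s)"
      using free[of j] by (simp add: load_def fun_eq_iff window_def)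
    have vmap: "map (vars f) us = map f us" if "\<forall>r\<in>set us. r < 10" for f :: "nat \<Rightarrow> 'z list" and us
      using that by (simp add: vars_def)
    have map0: "map ((+) 0) w = w" for w :: "nat list" by (simp add: map_idI)
    have fr: "fresh vacuum = 0" by (simp add: vacuum_def)
    have exec: "exec (instr_prog j i) s = map_spmf (embed (window vs j) (window ws j) vacuum s)
      (exec c (load (map (creg s) vs) (map (qreg s) ws) (qmem_of s)))"
      using exec_view[OF inj_window[OF vs] inj_window[OF ws], of j j c s] Call view by simp
    have "env_of (embed (window vs j) (window ws j) vacuum s t) =
      (assign vs (creg t) (vars (creg s)), assign ws (qreg t) (vars (qreg s)), qmem_of t)" for t
      by (simp add: env_of_def embed_def vars_window[OF vs] vars_window[OF ws] fr map0 cong: if_cong)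
    then have "map_spmf env_of (exec (instr_prog j i) s) = run1 i (env_of s)"
      using vs(2) ws(2) unfolding exec
      by (simp add: Call env_of_def[of s] call_def vmap spmf.map_comp o_def)
    moreover have "creg (embed (window vs j) (window ws j) vacuum s t) (bank j' r) = []
        \<and> qreg (embed (window vs j) (window ws j) vacuum s t) (bank j' r) = []"
      if "Suc j \<le> j'" for t j' r
      using that free[of j' r] bank_notin_window[OF vs(2), of j' j r] bank_notin_window[OF ws(2), of j' j r]
      by (simp add: embed_def)
    ultimately show ?thesis unfolding exec by simp
  qed
  then show "map_spmf env_of (exec (instr_prog j i) s) = run1 i (env_of s)"
    and "s' \<in> set_spmf (exec (instr_prog j i) s) \<Longrightarrow> Suc j \<le> j' \<Longrightarrow>
      creg s' (bank j' r) = [] \<and> qreg s' (bank j' r) = []" by simp_all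
qed

lemma exec_compile:
  assumes "list_all instr_ok is" and "\<And>j' r. j \<le> j' \<Longrightarrow> creg s (bank j' r) = [] \<and> qreg s (bank j' r) = []"
  shows "map_spmf env_of (exec (compile j is) s) = run is (env_of s)"
  using assms
proof (induction "is" arbitrary: j s)
  case Nil
  then show ?case by (simp add: env_of_def)
next
  case (Cons i "is")
  have ok: "instr_ok i" using Cons.prems by simp
  have "map_spmf env_of (exec (compile j (i # is)) s)
      = bind_spmf (exec (instr_prog j i) s) (\<lambda>t. map_spmf env_of (exec (compile (Suc j) is) t))"
    by (simp add: map_spmf_bind_spmf o_def)
  also have "\<dots> = bind_spmf (exec (instr_prog j i) s) (\<lambda>t. run is (env_of t))"
    using Cons.IH Cons.prems exec_instr_prog(2)[OF ok Cons.prems(2)]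
    by (intro bind_spmf_cong refl) simp
  also have "\<dots> = bind_spmf (map_spmf env_of (exec (instr_prog j i) s)) (run is)"
    by (simp add: bind_map_spmf o_def)
  finally show ?case by (simp add: exec_instr_prog(1)[OF ok Cons.prems(2)])
qed

definition inputs_env :: "'a list list \<Rightarrow> reg \<Rightarrow> 'a list" where
  "inputs_env ws r = (if r < length ws then ws ! r else [])"

lemma call_compile:
  assumes "list_all instr_ok is" "length cs \<le> 10" "length qs \<le> 10"
  shows "map_spmf (\<lambda>(out, qout, q). (vars out, vars qout, q)) (call (compile 0 is) cs qs q)
    = run is (inputs_env cs, inputs_env qs, q)"
proof -
  have "map_spmf (\<lambda>(out, qout, q). (vars out, vars qout, q)) (call (compile 0 is) cs qs q)
    = map_spmf env_of (exec (compile 0 is) (load cs qs q))"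
    by (simp add: call_def spmf.map_comp o_def env_of_def[abs_def])
  also have "\<dots> = run is (env_of (load cs qs q))"
    using assms bank_ge by (intro exec_compile) (auto simp: load_def, (meson le_trans not_le)+)
  also have "env_of (load cs qs q) = (inputs_env cs, inputs_env qs, q)"
    using assms by (auto simp: env_of_def load_def vars_def inputs_env_def)
  finally show ?thesis .
qed

text \<open>The last assumption says that the continuation ignores the banks; compiled program and
  script are only known to agree on the variables.\<close>

lemma bind_call_compile:
  assumes "list_all instr_ok is" "length cs \<le> 10" "length qs \<le> 10"
    and "\<And>out qout q. h (vars out, vars qout, q) = h (out, qout, q)"
  shows "bind_spmf (call (compile 0 is) cs qs q) h = bind_spmf (run is (inputs_env cs, inputs_env qs, q)) h"
  using assms(4) by (simp add: call_compile[OF assms(1-3), symmetric] bind_map_spmf o_def split_def)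

lemma QPT_compile:
  assumes "list_all instr_ok is" and "\<And>c vs ws. Call c vs ws \<in> set is \<Longrightarrow> QPT c"
  shows "QPT (compile j is)"
  using assms
proof (induction "is" arbitrary: j)
  case Nil
  then show ?case by (simp add: QPT_basic)
next
  case (Cons i "is")
  have "QPT (instr_prog j i)"
    using Cons.prems by (cases i) (auto simp: QPT_basic intro!: QPT_ren inj_window)
  with Cons show ?case by (auto intro!: QPT_Seq)
qed

text \<open>A program without quantum input cannot reach qubits left over from earlier:
  \<open>q\<close> is the product of itself with the vacuum, and the run takes place on the second
  factor. Only classical outputs are compared, because the names of new qubits are shifted.\<close>

lemma call_junk:
  assumes "valid_qmem q"
  shows "map_spmf (\<lambda>(out, _). out) (call c cs [] q) = map_spmf (\<lambda>(out, _). out) (call c cs [] vacuum)"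
proof -
  let ?E = "embed id id q (load cs [] vacuum)"
  have "ket (join q vacuum) = ket q"
  proof
    fix S
    show "ket (join q vacuum) S = ket q S"
    proof (cases "S \<subseteq> {..<fresh q}")
      case True
      then have "{i. fresh q + i \<in> S} = {}" "S \<inter> {..<fresh q} = S" by auto
      then show ?thesis by (simp add: join_def vacuum_def)
    next
      case False
      then obtain x where "x \<in> S" "\<not> x < fresh q" by auto
      then have "x - fresh q \<in> {i. fresh q + i \<in> S}" by simp
      then have "{i. fresh q + i \<in> S} \<noteq> {}" by blast
      moreover have "ket q S = 0" using False assms by (auto simp: valid_qmem_def)
      ultimately show ?thesis by (auto simp: join_def vacuum_def)
    qed
  qed
  then have "join q vacuum = q" by (simp add: join_def vacuum_def)
  then have "?E (load cs [] vacuum) = load cs [] q"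
    by (simp add: embed_def load_def fun_eq_iff)
  then have "exec c (load cs [] q) = map_spmf ?E (exec c (load cs [] vacuum))"
    using exec_embed[of id id q c "load cs [] vacuum" "load cs [] vacuum"] assms by simp
  then show ?thesis
    by (simp add: call_def spmf.map_comp o_def) (simp add: embed_def)
qed

lemma call_valid_qmem:
  assumes "valid_input qs q" "(out, qout, q') \<in> set_spmf (call c cs qs q)"
  shows "valid_qmem q'"
  using assms exec_tame[OF wf_config_load]
  by (fastforce simp: call_def tame_def wf_config_def wf_qreg_def)

lemma lossless_call: "QPT c \<Longrightarrow> valid_input qs q \<Longrightarrow> lossless_spmf (call c cs qs q)"
  by (auto simp: call_def QPT_def)

lemma valid_input_Nil [simp]: "valid_qmem q \<Longrightarrow> valid_input [] q"
  by (simp add: valid_input_def)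

lemma lossless_outcome: "QPT c \<Longrightarrow> lossless_spmf (outcome c cs)"
  by (simp add: outcome_def lossless_call)

section \<open>Semantics without step counts\<close>

text \<open>As no instruction reads the step counter, dropping it yields a compositional meaning,
  and programs can be evaluated by rewriting environments.\<close>

definition sem :: "prog \<Rightarrow> env \<Rightarrow> env spmf" where
  "sem c e = (case e of (v, qv, q) \<Rightarrow> map_spmf (\<lambda>s. (creg s, qreg s, qmem_of s))
     (exec c \<lparr>creg = v, qreg = qv, qmem_of = q, steps = 0\<rparr>))"

lemma exec_sem:
  "map_spmf (\<lambda>s. (creg s, qreg s, qmem_of s)) (exec c s) = sem c (creg s, qreg s, qmem_of s)"
proof -
  have "map ((+) 0) w = w" for w :: "nat list" by (simp add: map_idI)
  moreover have "fresh vacuum = 0" by (simp add: vacuum_def)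
  ultimately show ?thesis
    using exec_view[of id id c s] by (simp add: sem_def spmf.map_comp o_def embed_def)
qed

lemma call_sem: "call c cs qs q = sem c (inputs_env cs, inputs_env qs, q)"
  unfolding call_def exec_sem by (simp add: load_def inputs_env_def[abs_def])

lemma sem_simps:
  "sem Skip e = return_spmf e"
  "sem (Push r b) (v, qv, q) = return_spmf (v(r := b # v r), qv, q)"
  "sem (Pop r) (v, qv, q) = return_spmf (v(r := tl (v r)), qv, q)"
  "sem (Copy r r') (v, qv, q) = return_spmf (v(r' := v r), qv, q)"
  "sem (Coin r) (v, qv, q) = map_spmf (\<lambda>b. (v(r := b # v r), qv, q)) coin_spmf"
  by (simp_all add: sem_def spmf.map_comp o_def split: prod.split)

lemma sem_Move:
  "sem (Move r r') (v, qv, q) = return_spmf (v, (case qv r of [] \<Rightarrow> qv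
     | i # is \<Rightarrow> (qv(r := is))(r' := i # (qv(r := is)) r')), q)"
  by (simp add: sem_def Let_def split: list.split)

lemma sem_Seq: "sem (Seq c d) e = bind_spmf (sem c e) (sem d)"
proof -
  obtain v qv q where e: "e = (v, qv, q)" by (cases e)
  let ?s = "\<lparr>creg = v, qreg = qv, qmem_of = q, steps = 0\<rparr>"
  have "sem (Seq c d) e = bind_spmf (exec c ?s) (\<lambda>s. sem d (creg s, qreg s, qmem_of s))"
    unfolding e by (simp add: sem_def[of "Seq c d"] map_spmf_bind_spmf o_def exec_sem)
  also have "\<dots> = bind_spmf (sem c e) (sem d)"
    unfolding e by (simp add: sem_def[of c] bind_map_spmf o_def)
  finally show ?thesis .
qed

definition holds_in :: "test \<Rightarrow> env \<Rightarrow> bool" where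
  "holds_in t e = (case e of (v, qv, q) \<Rightarrow> holds t \<lparr>creg = v, qreg = qv, qmem_of = q, steps = 0\<rparr>)"

lemma holds_in_simps [simp]:
  "holds_in (Top r) (v, qv, q) = (v r \<noteq> [] \<and> hd (v r))"
  "holds_in (NonEmpty r) (v, qv, q) = (v r \<noteq> [])"
  "holds_in (QNonEmpty r) (v, qv, q) = (qv r \<noteq> [])"
  by (simp_all add: holds_in_def)

lemma holds_tick [simp]: "holds t (tick k s) = holds t s"
  by (cases t) simp_all

lemma sem_Branch: "sem (Branch t c d) e = (if holds_in t e then sem c e else sem d e)"
proof -
  obtain v qv q where e: "e = (v, qv, q)" by (cases e)
  show ?thesis
    unfolding e sem_def[of "Branch t c d"]
    by (simp add: holds_in_def exec_sem)
qed

lemma exec_While_unroll: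
  "exec (While t c) s =
    (if holds t s then bind_spmf (exec c (tick 1 s)) (exec (While t c)) else return_spmf (tick 1 s))"
proof -
  have W: "exec (While t c) = (\<lambda>s. map_spmf (tick 1) (while_spmf (holds t) (\<lambda>s'. exec c (tick 1 s')) s))"
    by (rule ext) simp
  show ?thesis
    unfolding W by (subst while_spmf.simps) (simp add: map_spmf_bind_spmf o_def)
qed

lemma sem_While:
  "sem (While t c) e = (if holds_in t e then bind_spmf (sem c e) (sem (While t c)) else return_spmf e)"
proof -
  obtain v qv q where e: "e = (v, qv, q)" by (cases e)
  let ?s = "\<lparr>creg = v, qreg = qv, qmem_of = q, steps = 0\<rparr>"
  have "sem c e = map_spmf (\<lambda>s. (creg s, qreg s, qmem_of s)) (exec c (tick 1 ?s))"
    unfolding exec_sem e by simp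
  then have "bind_spmf (sem c e) (sem (While t c)) =
      bind_spmf (exec c (tick 1 ?s)) (\<lambda>s. sem (While t c) (creg s, qreg s, qmem_of s))"
    by (simp only: bind_map_spmf o_def)
  moreover have "sem (While t c) e = map_spmf (\<lambda>s. (creg s, qreg s, qmem_of s)) (exec (While t c) ?s)"
    by (simp add: sem_def e)
  ultimately show ?thesis
    unfolding e exec_While_unroll[of t c ?s]
    by (cases "holds t ?s") (simp_all del: exec.simps add: map_spmf_bind_spmf o_def exec_sem holds_in_def)
qed

lemma inputs_env_simps [simp]:
  "inputs_env [] = (\<lambda>_. [])"
  "inputs_env [a] = (\<lambda>_. [])(0 := a)"
  "inputs_env [a, b] = (\<lambda>_. [])(0 := a, 1 := b)"
  "inputs_env [a, b, c] = (\<lambda>_. [])(0 := a, 1 := b, 2 := c)"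
  "inputs_env [a, b, c, d] = (\<lambda>_. [])(0 := a, 1 := b, 2 := c, 3 := d)"
  by (auto simp: inputs_env_def fun_eq_iff nth_Cons numeral_eq_Suc less_Suc_eq split: nat.split)

section \<open>Uniform bit strings\<close>

lemma finite_cube [simp]: "finite (cube n)"
  using finite_lists_length_eq[of "UNIV :: bool set" n] by (simp add: cube_def)

lemma cube_not_empty [simp]: "cube n \<noteq> {}"
  using length_replicate[of n True] unfolding cube_def by blast

lemma card_cube: "card (cube n) = 2 ^ n"
  using card_lists_length_eq[of "UNIV :: bool set" n] by (simp add: cube_def)

text \<open>The extra bit is appended at the end because stacks grow at the front: in a loop that
  pushes coins, the first coin ends up last.\<close>

lemma spmf_of_set_cube_Suc:
  "spmf_of_set (cube (Suc n)) =
     bind_spmf coin_spmf (\<lambda>b. map_spmf (\<lambda>x. x @ [b]) (spmf_of_set (cube n)))"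
proof (rule spmf_eqI)
  fix y :: bits
  have inj: "inj_on (\<lambda>x. x @ [b]) A" for b :: bool and A by (simp add: inj_on_def)
  have img: "y \<in> (\<lambda>x. x @ [b]) ` cube n \<longleftrightarrow> y \<in> cube (Suc n) \<and> last y = b" for b
    by (cases y rule: rev_cases) (auto simp: cube_def image_iff)
  have "spmf (map_spmf (\<lambda>x. x @ [b]) (spmf_of_set (cube n))) y
      = (if y \<in> cube (Suc n) \<and> last y = b then 1 / 2 ^ n else 0)" for b
    by (simp add: map_spmf_of_set_inj_on inj spmf_of_set card_image img card_cube indicator_def)
  then show "spmf (spmf_of_set (cube (Suc n))) y =
      spmf (bind_spmf coin_spmf (\<lambda>b. map_spmf (\<lambda>x. x @ [b]) (spmf_of_set (cube n)))) y"
    by (simp add: spmf_bind integral_spmf_of_set spmf_of_set card_cube UNIV_bool indicator_def)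
qed

lemma cube_0: "cube 0 = {[]}"
  by (auto simp: cube_def)

section \<open>Elementary programs\<close>

definition move_prog :: "reg \<Rightarrow> reg \<Rightarrow> prog" where
  "move_prog r r' = While (QNonEmpty r) (Move r r')"

lemma sem_move_prog:
  assumes "r \<noteq> r'"
  shows "sem (move_prog r r') (v, qv, q) = return_spmf (v, qv(r := [], r' := rev (qv r) @ qv r'), q)"
proof (induction "qv r" arbitrary: qv)
  case Nil
  then have "qv(r := [], r' := qv r') = qv" by auto
  with Nil show ?case unfolding move_prog_def by (subst sem_While) simp
next
  case (Cons i "is")
  then have "sem (move_prog r r') (v, qv, q)
      = sem (move_prog r r') (v, qv(r := is, r' := i # qv r'), q)"
    unfolding move_prog_def using assms by (subst sem_While) (simp add: sem_Move flip: Cons(2))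
  also have "\<dots> = return_spmf (v, qv(r := [], r' := rev is @ i # qv r'), q)"
    using Cons(1)[of "qv(r := is, r' := i # qv r')"] assms
    by (simp add: fun_upd_twist[of r r'])
  finally show ?case using Cons(2)[symmetric] by simp
qed

text \<open>Two moves, since one move reverses the order of the qubits.\<close>

definition shift_prog :: prog where
  "shift_prog = Seq (move_prog 1 2) (move_prog 2 0)"

text \<open>The empty stack 0 stands for the internal quantum state of the opening stage, which
  passes on classical data only; the pirate expects the obfuscated program in that place.\<close>

lemma call_shift_prog: "call shift_prog [] [[], w] q = return_spmf (\<lambda>_. [], (\<lambda>_. [])(0 := w), q)"
  by (auto simp: call_sem shift_prog_def sem_Seq sem_move_prog fun_eq_iff)

text \<open>Decides whether stack \<open>r\<close> is exactly \<open>[b]\<close>, with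
  \<open>c\<close> as the branch for success. There is no equality test, so the top bit is compared
  and popped and the rest is tested for emptiness.\<close>

definition test_single :: "reg \<Rightarrow> bool \<Rightarrow> prog \<Rightarrow> prog \<Rightarrow> prog" where
  "test_single r b c d = (let p = Seq (Pop r) (Branch (NonEmpty r) d c) in
     Branch (NonEmpty r) (Branch (Top r) (if b then p else d) (if b then d else p)) d)"

text \<open>Within \<open>check_prog\<close> stack 2 is empty, so the two copies clear stacks 0 and
  1.\<close>

definition answer_prog :: "bool \<Rightarrow> prog" where
  "answer_prog b = Seq (Copy 2 0) (Seq (Copy 2 1) (Push 0 b))"

definition check_prog :: "bool \<Rightarrow> prog" where
  "check_prog b = test_single 0 b (test_single 1 b (answer_prog True) (answer_prog False)) (answer_prog False)"

lemma call_check_prog: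
  "call (check_prog b) [u, w] [] q
    = return_spmf ((\<lambda>_. [])(0 := [u = [b] \<and> w = [b]]), \<lambda>_. [], q)"
proof -
  have answer: "sem (answer_prog a) ((\<lambda>_. [])(0 := u', 1 := w'), qv, q)
      = return_spmf ((\<lambda>_. [])(0 := [a]), qv, q)" for a u' w' qv
    by (auto simp: answer_prog_def sem_Seq sem_simps fun_eq_iff)
  have answer': "sem (answer_prog a) ((\<lambda>_. [])(0 := u', Suc 0 := w'), qv, q)
      = return_spmf ((\<lambda>_. [])(0 := [a]), qv, q)" for a u' w' qv
    using answer by simp
  have t: "sem (test_single r b c d) (v, qv, q) = (if v r = [b] then sem c (v(r := []), qv, q)
      else sem d (v(r := (if v r = [] \<or> hd (v r) \<noteq> b then v r else tl (v r))), qv, q))" for r c d v qv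
    by (cases "v r"; cases "tl (v r)") (auto simp: test_single_def sem_Branch sem_Seq sem_simps Let_def fun_upd_idem)
  have swap: "(\<lambda>_ :: nat. [])(0 := u, 1 := w, 0 := z) = (\<lambda>_. [])(0 := z, 1 := w)" for z :: bits
    by (auto simp: fun_eq_iff)
  show ?thesis
    unfolding call_sem check_prog_def inputs_env_simps t swap
    by (simp add: answer answer' t fun_upd_twist)
qed

text \<open>Stack 0 acts as a unary counter: any string of the desired length will do as
  input.\<close>

definition sample_prog :: prog where
  "sample_prog = While (NonEmpty 0) (Seq (Pop 0) (Coin 1))"

lemma call_sample_prog:
  "call sample_prog [w, []] [] q
    = map_spmf (\<lambda>x. ((\<lambda>_. [])(1 := x), \<lambda>_. [], q)) (spmf_of_set (cube (length w)))"
proof -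
  have "sem sample_prog ((\<lambda>_. [])(0 := w, 1 := z), qv, q)
      = map_spmf (\<lambda>x. ((\<lambda>_. [])(1 := x @ z), qv, q)) (spmf_of_set (cube (length w)))" for z qv
  proof (induction w arbitrary: z)
    case Nil
    have "(\<lambda>_. [])(0 := [], 1 := z) = (\<lambda>_. [])(1 := z)" by auto
    then show ?case
      unfolding sample_prog_def
      by (subst sem_While) (simp add: cube_0 spmf_of_set_singleton del: One_nat_def)
  next
    case (Cons b w)
    have *: "(\<lambda>_. [])(0 := w, 1 := a # z) = (\<lambda>_. [])(0 := b # w, 1 := z, 0 := w, 1 := a # z)" for a
      by auto
    have "sem sample_prog ((\<lambda>_. [])(0 := b # w, 1 := z), qv, q)
        = bind_spmf coin_spmf (\<lambda>a. sem sample_prog ((\<lambda>_. [])(0 := w, 1 := a # z), qv, q))"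
      unfolding * unfolding sample_prog_def
      by (subst sem_While) (simp add: sem_Seq sem_simps bind_map_spmf o_def)
    then show ?case
      unfolding Cons list.size add_Suc_right add_0_right spmf_of_set_cube_Suc map_spmf_bind_spmf
        spmf.map_comp o_def append_assoc append_Cons append_Nil .
  qed
  from this[of "[]"] show ?thesis by (simp add: call_sem)
qed

text \<open>
  The reduction has to produce a description of the constant-1 circuit, but no algorithm for \<open>n\<close>
  is given.  The program below reads \<open>n\<close> off the description of an arbitrary circuit with \<open>n\<close>
  inputs, and draws a uniform string of that length on the way.
\<close>

definition const_suffix :: bits where
  "const_suffix = [False, True, False, False, True, True, False, False, False]"

text \<open>The suffix reads: \<open>False\<close> ends the unary \<open>n\<close>;
  \<open>True, False\<close> announces one gate, \<open>False, True\<close> is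
  \<open>Const True\<close>; \<open>True, False\<close> announces one output,
  \<open>False, False\<close> is \<open>Gate 0\<close>.\<close>

lemma encode_const_one: "encode (const_one n) = replicate n True @ const_suffix"
  by (simp add: const_one_def unary_def const_suffix_def numeral_eq_Suc)

definition const_loop :: prog where
  "const_loop = While (Top 0) (Seq (Pop 0) (Seq (Push 1 True) (Coin 3)))"

text \<open>The \<open>foldr\<close> pushes the suffix from its last bit to its first, so that it
  lies on the stack in reading order when the loop puts the unary part in front.
  \<open>Copy 1 2\<close> supplies the second of the two identical circuits for puncturing.\<close>

definition const_prog :: prog where
  "const_prog = Seq (foldr (\<lambda>b c. Seq c (Push 1 b)) const_suffix Skip) (Seq const_loop (Copy 1 2))"

lemma sem_const_loop:
  "sem const_loop ((\<lambda>_. [])(0 := replicate n True @ False # w, 1 := u, 3 := z), qv, q)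
    = map_spmf (\<lambda>x. ((\<lambda>_. [])(0 := False # w, 1 := replicate n True @ u, 3 := x @ z), qv, q))
        (spmf_of_set (cube n))"
proof (induction n arbitrary: u z)
  case 0
  show ?case
    unfolding const_loop_def by (subst sem_While) (simp add: cube_0 spmf_of_set_singleton)
next
  case (Suc n)
  let ?e = "\<lambda>a. ((\<lambda>_. [])(0 := replicate n True @ False # w, 1 := True # u, 3 := a # z), qv, q)"
  have *: "?e a = ((\<lambda>_. [])(0 := replicate (Suc n) True @ False # w, 1 := u, 3 := z,
      0 := replicate n True @ False # w, 1 := True # u, 3 := a # z), qv, q)" for a
    by auto
  have "sem const_loop ((\<lambda>_. [])(0 := replicate (Suc n) True @ False # w, 1 := u, 3 := z), qv, q)
      = bind_spmf coin_spmf (\<lambda>a. sem const_loop (?e a))"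
    unfolding * unfolding const_loop_def
    by (subst sem_While) (simp add: sem_Seq sem_simps bind_map_spmf o_def)
  also have "\<dots> = bind_spmf coin_spmf (\<lambda>a. map_spmf (\<lambda>x. ((\<lambda>_. [])(0 := False # w,
      1 := replicate n True @ True # u, 3 := x @ a # z), qv, q)) (spmf_of_set (cube n)))"
    by (simp only: Suc)
  also have "replicate n True @ True # u = replicate (Suc n) True @ u"
    by (simp add: replicate_app_Cons_same)
  finally show ?case
    unfolding spmf_of_set_cube_Suc map_spmf_bind_spmf spmf.map_comp o_def append_assoc append_Cons
      append_Nil .
qed

lemma encode_inputs: "\<exists>w. encode C = replicate (inputs C) True @ False # w"
  by (cases C) (simp add: unary_def)

lemma call_const_prog:
  "\<exists>w. call const_prog [encode C, [], [], []] [] q = map_spmf (\<lambda>x. ((\<lambda>_. [])(0 := w,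
      1 := encode (const_one (inputs C)), 2 := encode (const_one (inputs C)), 3 := x), \<lambda>_. [], q))
    (spmf_of_set (cube (inputs C)))"
proof -
  obtain w where w: "encode C = replicate (inputs C) True @ False # w"
    using encode_inputs by blast
  have pre: "sem (foldr (\<lambda>b c. Seq c (Push 1 b)) u Skip) (v, qv, q) = return_spmf (v(1 := u @ v 1), qv, q)"
    for u v qv
  proof (induction u)
    case (Cons b u)
    show ?case
      by (simp only: foldr.simps o_apply sem_Seq Cons return_bind_spmf sem_simps) (simp add: fun_eq_iff)
  qed (simp add: sem_simps)
  have env: "(inputs_env [encode C, [], [], []])(1 := const_suffix @ inputs_env [encode C, [], [], []] 1)
      = (\<lambda>_. [])(0 := replicate (inputs C) True @ False # w, 1 := const_suffix, 3 := [])"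
    by (auto simp: w)
  show ?thesis
    unfolding call_sem const_prog_def sem_Seq pre return_bind_spmf env sem_const_loop
    by (intro exI[of _ "False # w"]) (auto simp: map_spmf_conv_bind_spmf sem_simps encode_const_one fun_eq_iff intro!: bind_spmf_cong)
qed

section \<open>Running time of the elementary programs\<close>

lemma wf_config_finite: "wf_config s \<Longrightarrow> finite_support (creg s) \<and> finite_support (qreg s)"
  by (simp add: wf_config_def wf_qreg_def)

lemma QPT_shift_prog: "QPT shift_prog"
proof -
  have "QPT (move_prog r r')" if "r \<noteq> r'" for r r'
    unfolding move_prog_def
  proof (rule QPT_While[where k = 2 and m = "\<lambda>s. length (qreg s r)"])
    fix s assume "wf_config s"
    then show "length (qreg s r) \<le> memory s"
      using length_le_total[of "qreg s" r] wf_config_finite[of s] by (simp add: memory_def)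
  qed (use that in \<open>auto simp: Let_def split: list.split\<close>)
  then show ?thesis by (simp add: shift_prog_def QPT_Seq)
qed

lemma QPT_check_prog: "QPT (check_prog b)"
  by (auto simp: check_prog_def test_single_def answer_prog_def Let_def intro!: QPT_Branch QPT_Seq QPT_basic)

lemma length_creg_le_memory: "wf_config s \<Longrightarrow> length (creg s r) \<le> memory s"
  using length_le_total[of "creg s" r] wf_config_finite[of s] by (simp add: memory_def)

lemma QPT_sample_prog: "QPT sample_prog"
  unfolding sample_prog_def
  by (rule QPT_While[where k = 3 and m = "\<lambda>s. length (creg s 0)"])
    (auto simp: length_creg_le_memory)

lemma QPT_const_prog: "QPT const_prog"
proof -
  have "QPT const_loop"
    unfolding const_loop_def
    by (rule QPT_While[where k = 4 and m = "\<lambda>s. length (creg s 0)"])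
      (auto simp: length_creg_le_memory)
  moreover have "QPT (foldr (\<lambda>b c. Seq c (Push 1 b)) u Skip)" for u
    by (induction u) (auto intro: QPT_basic QPT_Seq)
  ultimately show ?thesis by (auto simp: const_prog_def intro!: QPT_Seq QPT_basic)
qed

section \<open>The adversaries of the reduction\<close>

lemma call_pad [simp]: "call c cs [w, []] q = call c cs [w] q"
proof -
  have "load cs [w, []] q = load cs [w] q"
    by (auto simp: load_def fun_eq_iff nth_Cons split: nat.split)
  then show ?thesis by (simp add: call_def)
qed

lemma call_pad_Nil [simp]: "call c cs [[]] q = call c cs [] q"
proof -
  have "load cs [[]] q = load cs [] q"
    by (auto simp: load_def fun_eq_iff)
  then show ?thesis by (simp add: call_def)
qed

context
  fixes Obf A AB AC :: prog
begin

text \<open>The game from the moment the program is available, which is where the inner pirate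
  enters, having received the program from the challenger. The answers are returned uncompared,
  since the two halves of the piracy game ask for different values.\<close>

definition play :: "nat \<Rightarrow> bits \<Rightarrow> bits \<Rightarrow> nat list \<Rightarrow> qmem \<Rightarrow> (bits \<times> bits) spmf" where
  "play \<eta> x \<rho> q\<rho> q = do {
     (\<sigma>, q\<sigma>, q) \<leftarrow> call A [secpar \<eta>, \<rho>] [q\<rho>] q;
     (yB, _, q) \<leftarrow> call AB [secpar \<eta>, x, \<sigma> 0] [q\<sigma> 0] q;
     (yC, _, q) \<leftarrow> call AC [secpar \<eta>, x, \<sigma> 1] [q\<sigma> 1] q;
     return_spmf (yB 0, yC 0) }"

definition game :: "nat \<Rightarrow> bits \<Rightarrow> bits \<Rightarrow> qmem \<Rightarrow> (bits \<times> bits) spmf" where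
  "game \<eta> w x q = do {
     (\<rho>, q\<rho>, q) \<leftarrow> call Obf [secpar \<eta>, w] [] q;
     play \<eta> x (\<rho> 0) (q\<rho> 0) q }"

text \<open>Expects the security parameter, the challenge and the program in variables 0, 1, 2.
  Calls overwrite their arguments, hence the copies. \<open>A\<close> leaves the two halves of its
  state in variables 3 and 2 and on qubit variables 0 and 1; the answers end up in 4 and 0.\<close>

definition play_script :: "instr list" where
  "play_script = [Cp 0 3, Call A [3, 2] [0, 1], Cp 0 4, Cp 1 5, Call AB [4, 5, 3] [0], Call AC [0, 1, 2] [1]]"

text \<open>Starts with the circuit in variable 1 and the challenge in 2, and ends its preamble in
  the layout that \<open>play_script\<close> expects.\<close>

definition game_script :: "instr list" where
  "game_script = [Cp 0 3, Call Obf [3, 1] [0], Cp 2 1, Cp 3 2] @ play_script"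

abbreviation answers :: "env \<Rightarrow> bits \<times> bits" where
  "answers e \<equiv> (case e of (v, _, _) \<Rightarrow> (v 4, v 0))"

lemma run_play_script:
  assumes "v 0 = secpar \<eta>" "qv 1 = []"
  shows "map_spmf answers (run play_script (v, qv, q)) = play \<eta> (v 1) (v 2) (qv 0) q"
  using assms
  by (simp add: play_script_def play_def map_spmf_conv_bind_spmf split_def)

lemma run_game_script:
  assumes "v 0 = secpar \<eta>" "qv 0 = []" "qv 1 = []"
  shows "map_spmf answers (run game_script (v, qv, q)) = game \<eta> (v 1) (v 2) q"
  using assms unfolding game_script_def run_append map_spmf_bind_spmf o_def
  by (simp add: game_def bind_map_spmf o_def split_def run_play_script[unfolded split_def])

definition check_script :: "bool \<Rightarrow> instr list" where
  "check_script b = [Call (check_prog b) [4, 0] [], Cp 4 0, Cp 4 1]"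

definition verdict :: "bool \<Rightarrow> bits \<times> bits \<Rightarrow> bits" where
  "verdict b y = [y = ([b], [b])]"

lemma run_check_script:
  "map_spmf (\<lambda>(v, _, _). (v 0, v 1)) (run (check_script b) (v, qv, q))
    = return_spmf (verdict b (v 4, v 0), verdict b (v 4, v 0))"
  by (simp add: check_script_def call_check_prog verdict_def)

lemma run_checked:
  "map_spmf (\<lambda>(v, _, _). (v 0, v 1)) (run (is @ check_script b) e)
    = map_spmf (\<lambda>y. (verdict b y, verdict b y)) (map_spmf answers (run is e))"
proof -
  have "map_spmf (\<lambda>(v, _, _). (v 0, v 1)) (run (is @ check_script b) e)
    = bind_spmf (run is e) (\<lambda>(v, qv, q). return_spmf (verdict b (v 4, v 0), verdict b (v 4, v 0)))"
    unfolding run_append map_spmf_bind_spmf o_def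
    by (rule bind_spmf_cong[OF refl], clarify) (simp only: run_check_script prod.case)
  then show ?thesis
    by (simp add: map_spmf_conv_bind_spmf split_def)
qed

lemma map_call_compile:
  assumes "list_all instr_ok is" "length cs \<le> 10" "length qs \<le> 10"
    and "\<And>out qout q. h (vars out, vars qout, q) = h (out, qout, q)"
  shows "map_spmf h (call (compile 0 is) cs qs q) = map_spmf h (run is (inputs_env cs, inputs_env qs, q))"
  unfolding map_spmf_conv_bind_spmf by (rule bind_call_compile) (use assms in simp_all)

text \<open>The game has classical inputs only and is a single compiled call, so
  \<open>call_junk\<close> applies. In the experiment for the obfuscation it is started after the
  opening stage may have left qubits behind.\<close>

lemma game_junk:
  assumes "valid_qmem q"
  shows "game \<eta> w x q = game \<eta> w x vacuum"
proof -
  have "game \<eta> w x q = map_spmf answers (call (compile 0 game_script) [secpar \<eta>, w, x] [] q)" for q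
  proof -
    have "map_spmf answers (run game_script (inputs_env [secpar \<eta>, w, x], inputs_env [], q)) = game \<eta> w x q"
      by (subst run_game_script) simp_all
    moreover have "map_spmf answers (call (compile 0 game_script) [secpar \<eta>, w, x] [] q)
      = map_spmf answers (run game_script (inputs_env [secpar \<eta>, w, x], inputs_env [], q))"
      by (rule map_call_compile) (simp_all add: game_script_def play_script_def vars_def)
    ultimately show ?thesis by simp
  qed
  moreover have "map_spmf answers (call c cs [] q) = map_spmf (\<lambda>v. (v 4, v 0)) (map_spmf (\<lambda>(out, _). out) (call c cs [] q))"
    for c cs q by (simp add: spmf.map_comp o_def split_def)
  ultimately show ?thesis by (simp add: call_junk[OF assms])
qed

definition distinguisher :: "bool \<Rightarrow> prog" where
  "distinguisher b = compile 0 (game_script @ check_script b)"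

text \<open>The point that comes with the circuit serves as a length; the game is played at a fresh
  uniform point of that length, independent of where the circuit was punctured.\<close>

definition sampling_distinguisher :: "bool \<Rightarrow> prog" where
  "sampling_distinguisher b = compile 0 ([Call sample_prog [2, 4] [], Cp 4 2] @ game_script @ check_script b)"

lemma outcome_conv: "outcome c cs = map_spmf fst (map_spmf (\<lambda>(v, _, _). (v 0, v 1)) (call c cs [] vacuum))"
  by (simp add: outcome_def spmf.map_comp o_def split_def)

lemma script_ok: "list_all instr_ok game_script" "list_all instr_ok play_script" "list_all instr_ok (check_script b)"
  by (simp_all add: game_script_def play_script_def check_script_def)

lemma outcome_distinguisher:
  "outcome (distinguisher b) [secpar \<eta>, w, x] = map_spmf (verdict b) (game \<eta> w x vacuum)"
proof -
  have "map_spmf (\<lambda>(v, _, _). (v 0, v 1)) (call (distinguisher b) [secpar \<eta>, w, x] [] vacuum)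
    = map_spmf (\<lambda>(v, _, _). (v 0, v 1)) (run (game_script @ check_script b) (inputs_env [secpar \<eta>, w, x], inputs_env [], vacuum))"
    unfolding distinguisher_def by (rule map_call_compile) (simp_all add: vars_def script_ok)
  also have "\<dots> = map_spmf (\<lambda>y. (verdict b y, verdict b y)) (game \<eta> w x vacuum)"
    unfolding run_checked by (subst run_game_script) simp_all
  finally show ?thesis by (simp add: outcome_conv spmf.map_comp o_def)
qed

lemma outcome_sampling_distinguisher:
  "outcome (sampling_distinguisher b) [secpar \<eta>, w, z] =
    bind_spmf (spmf_of_set (cube (length z))) (\<lambda>x. map_spmf (verdict b) (game \<eta> w x vacuum))"
proof -
  let ?is = "[Call sample_prog [2, 4] [], Cp 4 2]"
  let ?e = "(inputs_env [secpar \<eta>, w, z], inputs_env [], vacuum)"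
  have "map_spmf (\<lambda>(v, _, _). (v 0, v 1)) (call (sampling_distinguisher b) [secpar \<eta>, w, z] [] vacuum)
    = map_spmf (\<lambda>(v, _, _). (v 0, v 1)) (run ((?is @ game_script) @ check_script b) ?e)"
    unfolding sampling_distinguisher_def append_assoc
    by (rule map_call_compile) (simp_all add: vars_def script_ok)
  also have "\<dots> = map_spmf (\<lambda>y. (verdict b y, verdict b y))
      (bind_spmf (run ?is ?e) (\<lambda>e. map_spmf answers (run game_script e)))"
    unfolding run_checked unfolding run_append map_spmf_bind_spmf o_def ..
  also have "bind_spmf (run ?is ?e) (\<lambda>e. map_spmf answers (run game_script e))
    = bind_spmf (spmf_of_set (cube (length z))) (\<lambda>x. game \<eta> w x vacuum)"
    by (simp add: call_sample_prog bind_map_spmf o_def split_def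
        run_game_script[where \<eta> = \<eta>, unfolded split_def])
  finally show ?thesis
    by (simp only: outcome_conv) (simp add: spmf.map_comp o_def map_spmf_bind_spmf)
qed

text \<open>
  The two stages of the adversaries against the obfuscation scheme that follow the challenge.
  \<open>inner_pirate\<close> plays the whole piracy game by itself, on an input of its own choice, and hands the
  verdict to both parties; \<open>pirate\<close> only passes its input to \<open>A\<close>.  Both have the obfuscated program
  on qubit stack 1.
\<close>

definition inner_pirate :: "bool \<Rightarrow> prog" where
  "inner_pirate b = compile 0 ([Call shift_prog [] [0, 1]] @ play_script @ check_script b)"

definition pirate :: prog where
  "pirate = compile 0 [Call shift_prog [] [0, 1], Call A [0, 2] [0, 1], Cp 2 1]"

definition forward_prog :: prog where
  "forward_prog = Copy 2 0"

lemma call_inner_pirate: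
  "map_spmf (\<lambda>(v, _, _). (v 0, v 1)) (call (inner_pirate b) [secpar \<eta>, x, \<rho>] [[], w] q)
    = map_spmf (\<lambda>y. (verdict b y, verdict b y)) (play \<eta> x \<rho> w q)"
proof -
  let ?is = "[Call shift_prog [] [0, 1]]"
  let ?e = "(inputs_env [secpar \<eta>, x, \<rho>], inputs_env [[], w], q)"
  have "map_spmf (\<lambda>(v, _, _). (v 0, v 1)) (call (inner_pirate b) [secpar \<eta>, x, \<rho>] [[], w] q)
    = map_spmf (\<lambda>(v, _, _). (v 0, v 1)) (run ((?is @ play_script) @ check_script b) ?e)"
    unfolding inner_pirate_def append_assoc
    by (rule map_call_compile) (simp_all add: vars_def script_ok)
  also have "\<dots> = map_spmf (\<lambda>y. (verdict b y, verdict b y))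
      (bind_spmf (run ?is ?e) (\<lambda>e. map_spmf answers (run play_script e)))"
    unfolding run_checked unfolding run_append map_spmf_bind_spmf o_def ..
  also have "bind_spmf (run ?is ?e) (\<lambda>e. map_spmf answers (run play_script e)) = play \<eta> x \<rho> w q"
    by (simp add: call_shift_prog split_def run_play_script[where \<eta> = \<eta>, unfolded split_def])
  finally show ?thesis .
qed

lemma call_pirate:
  assumes "\<And>out qout q. h (vars out, vars qout, q) = h (out, qout, q)"
    and "\<And>f g f' g' q. f 0 = f' 0 \<Longrightarrow> f 1 = f' 1 \<Longrightarrow> g 0 = g' 0 \<Longrightarrow> g 1 = g' 1 \<Longrightarrow> h (f, g, q) = h (f', g', q)"
  shows "bind_spmf (call pirate [secpar \<eta>, x, \<rho>] [[], w] q) h = bind_spmf (call A [secpar \<eta>, \<rho>] [w] q) h"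
proof -
  have "bind_spmf (call pirate [secpar \<eta>, x, \<rho>] [[], w] q) h
    = bind_spmf (run [Call shift_prog [] [0, 1], Call A [0, 2] [0, 1], Cp 2 1]
       (inputs_env [secpar \<eta>, x, \<rho>], inputs_env [[], w], q)) h"
    unfolding pirate_def by (rule bind_call_compile) (simp_all add: assms(1))
  also have "\<dots> = bind_spmf (call A [secpar \<eta>, \<rho>] [w] q) h"
    by (simp add: call_shift_prog bind_map_spmf o_def split_def)
      (auto intro!: bind_spmf_cong assms(2))
  finally show ?thesis .
qed

lemma call_forward_prog: "map_spmf (\<lambda>(v, _, q). (v 0, q)) (call forward_prog [a, b, c] qs q) = return_spmf (c, q)"
  by (simp add: call_sem forward_prog_def sem_simps)

lemma QPT_programs:
  assumes "QPT Obf" "QPT A" "QPT AB" "QPT AC"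
  shows "QPT (distinguisher b)" "QPT (sampling_distinguisher b)" "QPT (inner_pirate b)" "QPT pirate"
    "QPT forward_prog"
proof -
  show "QPT (distinguisher b)"
    unfolding distinguisher_def
    by (rule QPT_compile) (use assms in \<open>auto simp: script_ok, auto simp: game_script_def play_script_def check_script_def QPT_check_prog\<close>)
  show "QPT (sampling_distinguisher b)"
    unfolding sampling_distinguisher_def
    by (rule QPT_compile) (use assms in \<open>auto simp: script_ok, auto simp: game_script_def play_script_def check_script_def QPT_check_prog QPT_sample_prog\<close>)
  show "QPT (inner_pirate b)"
    unfolding inner_pirate_def
    by (rule QPT_compile) (use assms in \<open>auto simp: script_ok, auto simp: play_script_def check_script_def QPT_check_prog QPT_shift_prog\<close>)
  show "QPT pirate"
    unfolding pirate_def by (rule QPT_compile) (use assms in \<open>auto simp: QPT_shift_prog\<close>)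
  show "QPT forward_prog" by (simp add: forward_prog_def QPT_basic)
qed

end

text \<open>
  The first stage of both adversaries: \<open>sd\<close> samples a key, \<open>sf\<close> some circuit on \<open>n\<close> bits.
\<close>

definition opening_prog :: "prog \<Rightarrow> prog \<Rightarrow> prog" where
  "opening_prog sd sf = compile 0 [Cp 0 4, Call sd [0] [], Call sf [4] [], Call const_prog [4, 1, 2, 3] []]"

lemma QPT_opening_prog: "QPT sd \<Longrightarrow> QPT sf \<Longrightarrow> QPT (opening_prog sd sf)"
  unfolding opening_prog_def by (rule QPT_compile) (auto simp: QPT_const_prog)

text \<open>The circuit drawn by \<open>sf\<close> matters only through its number of inputs, which
  is \<open>n\<close> for every possible outcome; as \<open>sf\<close> terminates with probability
  1, its run can then be dropped. It starts on memory left by \<open>sd\<close>, which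
  \<open>call_junk\<close> shows to be harmless. The assumptions on \<open>h\<close> say that what
  follows depends on the classical outputs alone.\<close>

lemma bind_opening_prog:
  assumes sd: "outcome sd [secpar \<eta>] = D" and sf: "QPT sf" "QPT sd"
    "set_spmf (outcome sf [secpar \<eta>]) \<subseteq> encode ` circuits n m"
    and h: "\<And>v qv q. valid_qmem q \<Longrightarrow> qv 0 = [] \<Longrightarrow> h (v, qv, q) = h' (v 0) (v 1) (v 2) (v 3)"
    and hvars: "\<And>out qout q. h (vars out, vars qout, q) = h (out, qout, q)"
  shows "bind_spmf (call (opening_prog sd sf) [secpar \<eta>] [] vacuum) h = do {
     k \<leftarrow> D; x \<leftarrow> spmf_of_set (cube n);
     h' k (encode (const_one n)) (encode (const_one n)) x }"
proof -
  let ?\<mu> = "encode (const_one n)"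
  let ?is = "[Cp 0 4, Call sd [0] [], Call sf [4] [], Call const_prog [4, 1, 2, 3] []]"
  have inner: "bind_spmf (call const_prog [o2 0, [], [], []] [] q2)
      (\<lambda>(o3, _, q). h (assign [4, 1, 2, 3] o3 v, \<lambda>_. [], q))
      = bind_spmf (spmf_of_set (cube n)) (h' (v 0) ?\<mu> ?\<mu>)"
    if q1: "valid_qmem q1" and o2: "(o2, qo2, q2) \<in> set_spmf (call sf [secpar \<eta>] [] q1)" for q1 o2 qo2 q2 v
  proof -
    have "valid_qmem q2" using call_valid_qmem[OF _ o2] q1 by simp
    have "o2 \<in> set_spmf (map_spmf (\<lambda>(out, _). out) (call sf [secpar \<eta>] [] q1))"
      using o2 by force
    then have "o2 \<in> set_spmf (map_spmf (\<lambda>(out, _). out) (call sf [secpar \<eta>] [] vacuum))"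
      unfolding call_junk[OF q1] .
    then have "o2 0 \<in> set_spmf (outcome sf [secpar \<eta>])"
      by (force simp: outcome_def)
    with sf obtain C where C: "o2 0 = encode C" "inputs C = n" by (auto simp: circuits_def)
    obtain w where "call const_prog [encode C, [], [], []] [] q2 = map_spmf (\<lambda>x. ((\<lambda>_. [])(0 := w,
        1 := encode (const_one (inputs C)), 2 := encode (const_one (inputs C)), 3 := x), \<lambda>_. [], q2))
        (spmf_of_set (cube (inputs C)))"
      using call_const_prog by blast
    then show ?thesis
      by (simp add: C bind_map_spmf o_def h[OF \<open>valid_qmem q2\<close>])
  qed
  have "bind_spmf (call (opening_prog sd sf) [secpar \<eta>] [] vacuum) h
    = bind_spmf (run ?is (inputs_env [secpar \<eta>], inputs_env [], vacuum)) h"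
    unfolding opening_prog_def by (rule bind_call_compile) (simp_all add: hvars)
  also have "\<dots> = bind_spmf (call sd [secpar \<eta>] [] vacuum) (\<lambda>(o1, _, q1).
      bind_spmf (call sf [secpar \<eta>] [] q1) (\<lambda>(o2, _, q2).
      bind_spmf (call const_prog [o2 0, [], [], []] [] q2) (\<lambda>(o3, _, q).
      h (assign [4, 1, 2, 3] o3 ((\<lambda>_. [])(0 := o1 0, 4 := o2 0)), \<lambda>_. [], q))))"
    by (simp add: bind_map_spmf o_def split_def fun_upd_twist)
  also have "\<dots> = bind_spmf (call sd [secpar \<eta>] [] vacuum) (\<lambda>(o1, _, q1).
      bind_spmf (call sf [secpar \<eta>] [] q1) (\<lambda>_. bind_spmf (spmf_of_set (cube n)) (h' (o1 0) ?\<mu> ?\<mu>)))"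
    by (rule bind_spmf_cong[OF refl], clarify, rule bind_spmf_cong[OF refl], clarify, subst inner)
      (auto intro: call_valid_qmem[OF valid_input_Nil[OF valid_qmem_vacuum]])
  also have "\<dots> = bind_spmf (call sd [secpar \<eta>] [] vacuum) (\<lambda>(o1, _, q1).
      bind_spmf (spmf_of_set (cube n)) (h' (o1 0) ?\<mu> ?\<mu>))"
  proof (rule bind_spmf_cong[OF refl], clarify)
    fix o1 qo1 q1 assume "(o1, qo1, q1) \<in> set_spmf (call sd [secpar \<eta>] [] vacuum)"
    then have "lossless_spmf (call sf [secpar \<eta>] [] q1)"
      by (intro lossless_call sf(1) valid_input_Nil) (rule call_valid_qmem[OF valid_input_Nil[OF valid_qmem_vacuum]])
    then show "bind_spmf (call sf [secpar \<eta>] [] q1) (\<lambda>_. bind_spmf (spmf_of_set (cube n)) (h' (o1 0) ?\<mu> ?\<mu>))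
        = bind_spmf (spmf_of_set (cube n)) (h' (o1 0) ?\<mu> ?\<mu>)"
      by (simp add: bind_spmf_const lossless_weight_spmfD)
  qed
  also have "\<dots> = bind_spmf D (\<lambda>k. bind_spmf (spmf_of_set (cube n)) (h' k ?\<mu> ?\<mu>))"
    by (simp add: sd[symmetric] outcome_def bind_map_spmf o_def split_def)
  finally show ?thesis .
qed

section \<open>Security\<close>

lemma negligible_add: "negligible f \<Longrightarrow> negligible g \<Longrightarrow> negligible (\<lambda>\<eta>. f \<eta> + g \<eta>)"
  unfolding negligible_def by (auto intro: sum_in_smallo)

lemma negligible_cmult: "negligible f \<Longrightarrow> negligible (\<lambda>\<eta>. c * f \<eta>)"
  unfolding negligible_def by (cases "c = 0") auto

lemma negligible_mono:
  assumes "negligible g" "\<And>\<eta>. \<bar>f \<eta>\<bar> \<le> g \<eta>"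
  shows "negligible f"
proof -
  have "f \<in> O(g)"
    by (rule landau_o.big_mono, rule always_eventually) (use assms(2) in \<open>auto intro: order_trans abs_ge_self\<close>)
  with assms(1) show ?thesis
    unfolding negligible_def by (blast intro: landau_o.big_small_trans)
qed

lemma integrable_spmf_bind: "integrable (measure_spmf p) (\<lambda>y. spmf (f y) x)"
  by (rule measure_spmf.integrable_const_bound[where B = 1]) (simp_all add: pmf_le_1)

lemma spmf_bind_le_add:
  assumes "\<And>y. y \<in> set_spmf p \<Longrightarrow> spmf (f y) True \<le> spmf (g y) True + spmf (h y) True"
  shows "spmf (bind_spmf p f) True \<le> spmf (bind_spmf p g) True + spmf (bind_spmf p h) True"
proof -
  have "(LINT y|measure_spmf p. spmf (f y) True) \<le> (LINT y|measure_spmf p. spmf (g y) True + spmf (h y) True)"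
    by (intro integral_mono_AE) (use assms in \<open>auto simp: integrable_spmf_bind\<close>)
  then show ?thesis by (simp add: spmf_bind integrable_spmf_bind)
qed

lemma spmf_bind_le:
  assumes "\<And>y. y \<in> set_spmf p \<Longrightarrow> spmf (f y) x \<le> c" "0 \<le> c"
  shows "spmf (bind_spmf p f) x \<le> c"
proof -
  have "(LINT y|measure_spmf p. spmf (f y) x) \<le> (LINT y|measure_spmf p. c)"
    by (intro integral_mono_AE) (use assms in \<open>auto simp: integrable_spmf_bind\<close>)
  also have "\<dots> \<le> c"
    using assms(2) measure_spmf.subprob_measure_le_1[of p "space (measure_spmf p)"]
    by (simp add: mult_left_le_one_le)
  finally show ?thesis by (simp add: spmf_bind)
qed

lemma spmf_bind_ge:
  assumes "\<And>y. y \<in> set_spmf p \<Longrightarrow> c \<le> spmf (f y) x" "lossless_spmf p"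
  shows "c \<le> spmf (bind_spmf p f) x"
proof -
  have "c = (LINT y|measure_spmf p. c)"
    using assms(2) by (simp add: lossless_spmf_def weight_spmf_def)
  also have "\<dots> \<le> (LINT y|measure_spmf p. spmf (f y) x)"
    by (intro integral_mono_AE) (use assms in \<open>auto simp: integrable_spmf_bind\<close>)
  finally show ?thesis by (simp add: spmf_bind)
qed

lemma spmf_coin: "spmf (bind_spmf coin_spmf g) x = (spmf (g True) x + spmf (g False) x) / 2"
  by (simp add: spmf_bind integral_spmf_of_set UNIV_bool)

lemma spmf_coin_bind:
  "spmf (bind_spmf p (\<lambda>k. bind_spmf coin_spmf (f k))) x
    = (spmf (bind_spmf p (\<lambda>k. f k True)) x + spmf (bind_spmf p (\<lambda>k. f k False)) x) / 2"
  by (subst bind_commute_spmf) (rule spmf_coin)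

lemma spmf_bind_pmf_prob:
  "spmf (bind_spmf (spmf_of_pmf p) (\<lambda>k. return_spmf (c k))) True = measure_pmf.prob p {k. c k}"
proof -
  have "spmf (bind_spmf (spmf_of_pmf p) (\<lambda>k. return_spmf (c k))) True = pmf (map_pmf c p) True"
    by (simp flip: map_spmf_conv_bind_spmf)
  also have "\<dots> = measure_pmf.prob p {k. c k}"
    by (simp add: pmf_map vimage_def)
  finally show ?thesis .
qed

lemma spmf_map_singleton: "spmf (map_spmf (\<lambda>y. [c y]) p) [True] = spmf (map_spmf c p) True"
  using spmf_map_inj'[of "\<lambda>b. [b]" "map_spmf c p" True] by (simp add: inj_def spmf.map_comp o_def)

lemma spmf_verdict: "spmf (map_spmf (verdict b) p) [True] = spmf (map_spmf (\<lambda>y. y = ([b], [b])) p) True"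
  unfolding verdict_def by (rule spmf_map_singleton)

section \<open>The experiments expressed through the game\<close>

lemma bind_D_identical:
  assumes "preimage_one C \<noteq> {}"
  shows "bind_spmf (spmf_of_pmf (D_identical \<eta> C)) f = bind_spmf coin_spmf (\<lambda>b.
    bind_spmf (spmf_of_set (if b then cube (inputs C) else preimage_one C)) (\<lambda>x. f (x, x)))"
proof -
  have "finite (preimage_one C)" by (simp add: preimage_one_def)
  with assms have "spmf_of_pmf (D_identical \<eta> C) = bind_spmf coin_spmf (\<lambda>b.
    bind_spmf (spmf_of_set (if b then cube (inputs C) else preimage_one C)) (\<lambda>x. return_spmf (x, x)))"
    unfolding D_identical_def spmf_of_pmf_bind bernoulli_pmf_half_conv_pmf_of_set
    by (auto simp: bind_spmf_of_pmf[symmetric] intro!: bind_spmf_cong)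
  then show ?thesis by simp
qed

lemma game_bind:
  "bind_spmf (game Obf A AB AC \<eta> w x q) h = do {
     (\<rho>, q\<rho>, q) \<leftarrow> call Obf [secpar \<eta>, w] [] q;
     (\<sigma>, q\<sigma>, q) \<leftarrow> call A [secpar \<eta>, \<rho> 0] [q\<rho> 0] q;
     (yB, _, q) \<leftarrow> call AB [secpar \<eta>, x, \<sigma> 0] [q\<sigma> 0] q;
     (yC, _, q) \<leftarrow> call AC [secpar \<eta>, x, \<sigma> 1] [q\<sigma> 1] q;
     h (yB 0, yC 0) }"
  by (simp add: game_def play_def split_def)

text \<open>The challenge depends on the key only, so drawing it commutes with obfuscating and with
  running \<open>A\<close>; the rest is one game.\<close>

lemma piracy_experiment_game:
  assumes pre: "\<And>k. k \<in> set_pmf (D \<eta>) \<Longrightarrow> preimage_one (C \<eta> k) \<noteq> {}"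
  shows "piracy_experiment Obf D_identical C D A AB AC \<eta> = do {
     k \<leftarrow> spmf_of_pmf (D \<eta>); b \<leftarrow> coin_spmf;
     x \<leftarrow> spmf_of_set (if b then cube (inputs (C \<eta> k)) else preimage_one (C \<eta> k));
     y \<leftarrow> game Obf A AB AC \<eta> (encode (C \<eta> k)) x vacuum;
     return_spmf (y = (ceval (C \<eta> k) x, ceval (C \<eta> k) x)) }"
  unfolding piracy_experiment_def
proof (rule bind_spmf_cong[OF refl])
  fix k assume "k \<in> set_spmf (spmf_of_pmf (D \<eta>))"
  then have ne: "preimage_one (C \<eta> k) \<noteq> {}" using pre by simp
  let ?D = "spmf_of_pmf (D_identical \<eta> (C \<eta> k))"
  have "(do {
     (\<rho>, q\<rho>, q) \<leftarrow> call Obf [secpar \<eta>, encode (C \<eta> k)] [] vacuum;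
     (\<sigma>, q\<sigma>, q) \<leftarrow> call A [secpar \<eta>, \<rho> 0] [q\<rho> 0] q;
     (xB, xC) \<leftarrow> ?D;
     (yB, _, q) \<leftarrow> call AB [secpar \<eta>, xB, \<sigma> 0] [q\<sigma> 0] q;
     (yC, _, q) \<leftarrow> call AC [secpar \<eta>, xC, \<sigma> 1] [q\<sigma> 1] q;
     return_spmf (yB 0 = ceval (C \<eta> k) xB \<and> yC 0 = ceval (C \<eta> k) xC) })
   = (do {
     (xB, xC) \<leftarrow> ?D;
     (\<rho>, q\<rho>, q) \<leftarrow> call Obf [secpar \<eta>, encode (C \<eta> k)] [] vacuum;
     (\<sigma>, q\<sigma>, q) \<leftarrow> call A [secpar \<eta>, \<rho> 0] [q\<rho> 0] q;
     (yB, _, q) \<leftarrow> call AB [secpar \<eta>, xB, \<sigma> 0] [q\<sigma> 0] q;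
     (yC, _, q) \<leftarrow> call AC [secpar \<eta>, xC, \<sigma> 1] [q\<sigma> 1] q;
     return_spmf (yB 0 = ceval (C \<eta> k) xB \<and> yC 0 = ceval (C \<eta> k) xC) })"
    unfolding split_def
    by (subst bind_commute_spmf[of ?D]) (subst bind_commute_spmf[of ?D], rule refl)
  also have "\<dots> = do { b \<leftarrow> coin_spmf;
     x \<leftarrow> spmf_of_set (if b then cube (inputs (C \<eta> k)) else preimage_one (C \<eta> k));
     y \<leftarrow> game Obf A AB AC \<eta> (encode (C \<eta> k)) x vacuum;
     return_spmf (y = (ceval (C \<eta> k) x, ceval (C \<eta> k) x)) }"
    unfolding bind_D_identical[OF ne] game_bind by simp
  finally show "(do {
     (\<rho>, q\<rho>, q) \<leftarrow> call Obf [secpar \<eta>, encode (C \<eta> k)] [] vacuum;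
     (\<sigma>, q\<sigma>, q) \<leftarrow> call A [secpar \<eta>, \<rho> 0] [q\<rho> 0] q;
     (xB, xC) \<leftarrow> ?D;
     (yB, _, q) \<leftarrow> call AB [secpar \<eta>, xB, \<sigma> 0] [q\<sigma> 0] q;
     (yC, _, q) \<leftarrow> call AC [secpar \<eta>, xC, \<sigma> 1] [q\<sigma> 1] q;
     return_spmf (yB 0 = ceval (C \<eta> k) xB \<and> yC 0 = ceval (C \<eta> k) xC) })
   = do { b \<leftarrow> coin_spmf;
     x \<leftarrow> spmf_of_set (if b then cube (inputs (C \<eta> k)) else preimage_one (C \<eta> k));
     y \<leftarrow> game Obf A AB AC \<eta> (encode (C \<eta> k)) x vacuum;
     return_spmf (y = (ceval (C \<eta> k) x, ceval (C \<eta> k) x)) }" .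
qed

lemma const_one_circuit: "const_one n \<in> circuits n 1"
  by (simp add: const_one_def circuits_def csize_def)

text \<open>Both reductions share this form: \<open>x\<close> is the uniform string kept by the
  opening stage as internal state, \<open>y\<close> the punctured point and challenge. By
  \<open>R\<close>, everything after the choice of the circuit depends on classical data alone,
  whatever qubits the opening stage left. The two summands are the two values of the challenge
  bit.\<close>

lemma upo_experiment_opening:
  assumes gp: "generalized_puncturable n (\<lambda>_. 1) K' C' P"
    and D': "set_pmf (D' \<eta>) \<subseteq> K' \<eta>"
    and sd: "QPT sd" "outcome sd [secpar \<eta>] = spmf_of_pmf (D' \<eta>)"
    and sf: "QPT sf" "set_spmf (outcome sf [secpar \<eta>]) \<subseteq> encode ` circuits (n \<eta>) 1"
    and R: "\<And>b w x y q. valid_qmem q \<Longrightarrow> (do {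
       (\<rho>, q\<rho>, q) \<leftarrow> call Obf [secpar \<eta>, w] [] q;
       (\<sigma>, q\<sigma>, q) \<leftarrow> call A2 [secpar \<eta>, x, \<rho> 0] [[], q\<rho> 0] q;
       (bB, _, q) \<leftarrow> call AB [secpar \<eta>, y, \<sigma> 0] [q\<sigma> 0] q;
       (bC, _, q) \<leftarrow> call AC [secpar \<eta>, y, \<sigma> 1] [q\<sigma> 1] q;
       return_spmf (bB 0 = [b] \<and> bC 0 = [b]) }) = R b w x y"
  shows "spmf (upo_experiment Obf Id_U n (\<lambda>_. 1) K' C' P (opening_prog sd sf) A2 AB AC \<eta>) True
    = (spmf (do { k \<leftarrow> spmf_of_pmf (D' \<eta>); x \<leftarrow> spmf_of_set (cube (n \<eta>)); y \<leftarrow> spmf_of_set (cube (n \<eta>));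
          G \<leftarrow> outcome P [secpar \<eta>, k, y, y, encode (const_one (n \<eta>)), encode (const_one (n \<eta>))];
          R True G x y }) True
      + spmf (do { k \<leftarrow> spmf_of_pmf (D' \<eta>); x \<leftarrow> spmf_of_set (cube (n \<eta>)); y \<leftarrow> spmf_of_set (cube (n \<eta>));
          R False (encode (C' \<eta> k)) x y }) True) / 2"
proof -
  let ?\<mu> = "encode (const_one (n \<eta>))"
  let ?U = "spmf_of_set (cube (n \<eta>))"
  let ?ok = "\<lambda>k \<mu>B \<mu>C. k \<in> K' \<eta> \<and> \<mu>B \<in> encode ` circuits (n \<eta>) 1 \<and> \<mu>C \<in> encode ` circuits (n \<eta>) 1"
  define h :: "bool \<Rightarrow> env \<Rightarrow> bool spmf" where "h b = (\<lambda>(a1, qa1, q). if ?ok (a1 0) (a1 1) (a1 2)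
     then do {
       (xB, xC) \<leftarrow> spmf_of_pmf (Id_U (n \<eta>));
       G \<leftarrow> outcome P [secpar \<eta>, a1 0, xB, xC, a1 1, a1 2];
       (\<rho>, q\<rho>, q) \<leftarrow> call Obf [secpar \<eta>, if b then G else encode (C' \<eta> (a1 0))] [] q;
       (\<sigma>, q\<sigma>, q) \<leftarrow> call A2 [secpar \<eta>, a1 3, \<rho> 0] [qa1 0, q\<rho> 0] q;
       (bB, _, q) \<leftarrow> call AB [secpar \<eta>, xB, \<sigma> 0] [q\<sigma> 0] q;
       (bC, _, q) \<leftarrow> call AC [secpar \<eta>, xC, \<sigma> 1] [q\<sigma> 1] q;
       return_spmf (bB 0 = [b] \<and> bC 0 = [b]) }
     else return_spmf False)" for b
  define h' where "h' b k \<mu>B \<mu>C x = (if ?ok k \<mu>B \<mu>C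
     then do { y \<leftarrow> ?U; G \<leftarrow> outcome P [secpar \<eta>, k, y, y, \<mu>B, \<mu>C];
       R b (if b then G else encode (C' \<eta> k)) x y }
     else return_spmf False)" for b k \<mu>B \<mu>C x
  have Id: "spmf_of_pmf (Id_U (n \<eta>)) = map_spmf (\<lambda>x. (x, x)) ?U"
    unfolding Id_U_def by (simp flip: map_spmf_of_pmf)
  have h: "h b (v, qv, q) = h' b (v 0) (v 1) (v 2) (v 3)" if "valid_qmem q" "qv 0 = []" for b v qv q
    unfolding h_def h'_def Id prod.case that(2)
    by (simp only: bind_map_spmf o_def prod.case R[OF that(1)])
  have hvars: "h b (vars out, vars qout, q) = h b (out, qout, q)" for b out qout q
    by (simp add: h_def vars_def cong: if_cong)
  have start: "bind_spmf (call (opening_prog sd sf) [secpar \<eta>] [] vacuum) (h b)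
     = do { k \<leftarrow> spmf_of_pmf (D' \<eta>); x \<leftarrow> ?U; h' b k ?\<mu> ?\<mu> x }" for b
    by (rule bind_opening_prog[OF sd(2) sf(1) sd(1) sf(2)]) (use h hvars in auto)
  moreover have "(do { k \<leftarrow> spmf_of_pmf (D' \<eta>); x \<leftarrow> ?U; h' b k ?\<mu> ?\<mu> x }) = do { k \<leftarrow> spmf_of_pmf (D' \<eta>); x \<leftarrow> ?U; y \<leftarrow> ?U;
      G \<leftarrow> outcome P [secpar \<eta>, k, y, y, ?\<mu>, ?\<mu>]; R b (if b then G else encode (C' \<eta> k)) x y }" for b
    by (rule bind_spmf_cong[OF refl]) (use D' const_one_circuit in \<open>auto simp: h'_def\<close>)
  ultimately have run: "bind_spmf (call (opening_prog sd sf) [secpar \<eta>] [] vacuum) (h b) =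
    do { k \<leftarrow> spmf_of_pmf (D' \<eta>); x \<leftarrow> ?U; y \<leftarrow> ?U;
      G \<leftarrow> outcome P [secpar \<eta>, k, y, y, ?\<mu>, ?\<mu>]; R b (if b then G else encode (C' \<eta> k)) x y }" for b by simp
  have "QPT P" using gp by (simp add: generalized_puncturable_def)
  \<comment> \<open>For challenge bit 0 the punctured circuit is sampled and then discarded, which
    loses no probability mass because \<open>P\<close> always terminates.\<close>
  then have drop: "bind_spmf (outcome P cs) (\<lambda>_. p) = p" for cs and p :: "bool spmf"
    by (simp add: bind_spmf_const lossless_weight_spmfD lossless_outcome)
  have exp: "upo_experiment Obf Id_U n (\<lambda>_. 1) K' C' P (opening_prog sd sf) A2 AB AC \<eta> =
    bind_spmf coin_spmf (\<lambda>b. bind_spmf (call (opening_prog sd sf) [secpar \<eta>] [] vacuum) (h b))"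
    unfolding upo_experiment_def h_def Let_def ..
  show ?thesis
    unfolding exp spmf_coin run by (simp add: drop)
qed

section \<open>The trivial attack and the consequences of evasiveness\<close>

lemma ceval_bit: "C \<in> circuits n 1 \<Longrightarrow> ceval C x = [True] \<or> ceval C x = [False]"
  by (cases "outputs C") (auto simp: circuits_def ceval_def)

text \<open>Evasiveness is a bound for each fixed input, so the input is drawn before the
  key.\<close>

lemma uniform_input_evasive:
  assumes "\<And>x. x \<in> cube n \<Longrightarrow> measure_pmf.prob D {k. ceval (C k) x = [True]} \<le> \<delta>" and "0 \<le> \<delta>"
  shows "spmf (do { k \<leftarrow> spmf_of_pmf D; x \<leftarrow> spmf_of_set (cube n); return_spmf (ceval (C k) x = [True]) }) True
    \<le> \<delta>"
  by (subst bind_commute_spmf, rule spmf_bind_le) (use assms in \<open>simp_all only: spmf_bind_pmf_prob set_spmf_of_set finite_cube if_True\<close>)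

text \<open>The witness is the honest attack: one party runs \<open>Eval\<close>, the other answers
  \<open>[False]\<close>. On a uniform challenge it fails only through incorrectness of
  \<open>Eval\<close> or because the circuit accepts the challenge.\<close>

lemma p_triv_ge:
  assumes pre: "\<And>k. k \<in> set_pmf (D \<eta>) \<Longrightarrow> preimage_one (C \<eta> k) \<noteq> {}"
    and circ: "\<And>k. k \<in> set_pmf (D \<eta>) \<Longrightarrow> C \<eta> k \<in> circuits n 1"
    and corr: "\<And>k x. k \<in> set_pmf (D \<eta>) \<Longrightarrow> x \<in> cube n \<Longrightarrow> 1 - \<epsilon> \<le>
        spmf (do { (out, qout, q) \<leftarrow> call Obf [secpar \<eta>, encode (C \<eta> k)] [] vacuum;
                   (y, _) \<leftarrow> call Eval [secpar \<eta>, x, out 0] [qout 0] q;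
                   return_spmf (y 0 = ceval (C \<eta> k) x) }) True"
    and evas: "\<And>x. x \<in> cube n \<Longrightarrow> measure_pmf.prob (D \<eta>) {k. ceval (C \<eta> k) x = [True]} \<le> \<delta>"
    and "0 \<le> \<delta>"
  shows "1 / 2 - (\<epsilon> + \<delta>) / 2 \<le> p_triv Obf D_identical C D \<eta>"
proof -
  let ?D = "spmf_of_pmf (D \<eta>)" and ?U = "spmf_of_set (cube n)"
  define both where "both k x = do { (\<rho>, q\<rho>, q) \<leftarrow> call Obf [secpar \<eta>, encode (C \<eta> k)] [] vacuum;
      (y, _) \<leftarrow> call Eval [secpar \<eta>, x, \<rho> 0] [q\<rho> 0] q;
      return_spmf (y 0 = ceval (C \<eta> k) x \<and> [False] = ceval (C \<eta> k) x) }" for k x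
  define eval where "eval k x = do { (out, qout, q) \<leftarrow> call Obf [secpar \<eta>, encode (C \<eta> k)] [] vacuum;
      (y, _) \<leftarrow> call Eval [secpar \<eta>, x, out 0] [qout 0] q;
      return_spmf (y 0 = ceval (C \<eta> k) x) }" for k x
  have inp: "inputs (C \<eta> k) = n" if "k \<in> set_pmf (D \<eta>)" for k
    using circ[OF that] by (simp add: circuits_def)
  have exp: "trivial_experiment True Obf D_identical C D Eval (\<lambda>_. return_pmf [False]) \<eta> =
     bind_spmf ?D (\<lambda>k. bind_spmf coin_spmf (\<lambda>b.
       bind_spmf (spmf_of_set (if b then cube (inputs (C \<eta> k)) else preimage_one (C \<eta> k))) (both k)))"
    unfolding trivial_experiment_def
  proof (rule bind_spmf_cong[OF refl])
    fix k assume "k \<in> set_spmf ?D"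
    then have ne: "preimage_one (C \<eta> k) \<noteq> {}" using pre by simp
    let ?I = "spmf_of_pmf (D_identical \<eta> (C \<eta> k))"
    have "(do {
       (\<rho>, q\<rho>, q) \<leftarrow> call Obf [secpar \<eta>, encode (C \<eta> k)] [] vacuum;
       (xB, xC) \<leftarrow> ?I;
       let (x, x') = (if True then (xB, xC) else (xC, xB));
       (y, _) \<leftarrow> call Eval [secpar \<eta>, x, \<rho> 0] [q\<rho> 0] q;
       y' \<leftarrow> spmf_of_pmf (return_pmf [False]);
       return_spmf (y 0 = ceval (C \<eta> k) x \<and> y' = ceval (C \<eta> k) x') }) = (do {
       (xB, xC) \<leftarrow> ?I;
       (\<rho>, q\<rho>, q) \<leftarrow> call Obf [secpar \<eta>, encode (C \<eta> k)] [] vacuum;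
       (y, _) \<leftarrow> call Eval [secpar \<eta>, xB, \<rho> 0] [q\<rho> 0] q;
       return_spmf (y 0 = ceval (C \<eta> k) xB \<and> [False] = ceval (C \<eta> k) xC) })"
      unfolding split_def Let_def
      by (subst bind_commute_spmf[of ?I]) (simp only: if_True fst_conv snd_conv spmf_of_pmf_return_pmf return_bind_spmf)
    also have "\<dots> = bind_spmf coin_spmf (\<lambda>b.
       bind_spmf (spmf_of_set (if b then cube (inputs (C \<eta> k)) else preimage_one (C \<eta> k))) (both k))"
      unfolding bind_D_identical[OF ne] both_def by simp
    finally show "(do {
       (\<rho>, q\<rho>, q) \<leftarrow> call Obf [secpar \<eta>, encode (C \<eta> k)] [] vacuum;
       (xB, xC) \<leftarrow> ?I;
       let (x, x') = (if True then (xB, xC) else (xC, xB));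
       (y, _) \<leftarrow> call Eval [secpar \<eta>, x, \<rho> 0] [q\<rho> 0] q;
       y' \<leftarrow> spmf_of_pmf (return_pmf [False]);
       return_spmf (y 0 = ceval (C \<eta> k) x \<and> y' = ceval (C \<eta> k) x') }) = bind_spmf coin_spmf (\<lambda>b.
       bind_spmf (spmf_of_set (if b then cube (inputs (C \<eta> k)) else preimage_one (C \<eta> k))) (both k))" .
  qed
  have "1 - \<epsilon> \<le> spmf (bind_spmf ?D (\<lambda>k. bind_spmf ?U (eval k))) True"
  proof (intro spmf_bind_ge[where p = ?D] spmf_bind_ge[where p = ?U])
    fix k x assume "k \<in> set_spmf ?D" "x \<in> set_spmf ?U"
    then show "1 - \<epsilon> \<le> spmf (eval k x) True"
      unfolding eval_def by (intro corr) simp_all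
  qed simp_all
  \<comment> \<open>If the circuit rejects \<open>x\<close>, the constant guess is right and both
    parties win as soon as the evaluation is correct.\<close>
  also have "\<dots> \<le> spmf (bind_spmf ?D (\<lambda>k. bind_spmf ?U (both k))) True +
      spmf (bind_spmf ?D (\<lambda>k. bind_spmf ?U (\<lambda>x. return_spmf (ceval (C \<eta> k) x = [True])))) True"
  proof (intro spmf_bind_le_add)
    fix k x assume "k \<in> set_spmf ?D"
    then consider "ceval (C \<eta> k) x = [True]" | "ceval (C \<eta> k) x = [False]"
      using ceval_bit[OF circ[of k], of x] by auto
    then show "spmf (eval k x) True \<le> spmf (both k x) True + spmf (return_spmf (ceval (C \<eta> k) x = [True])) True"
    proof cases
      case 1
      then show ?thesis using pmf_le_1[of "eval k x" "Some True"] by (simp add: add_increasing)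
    next
      case 2
      then have "both k x = eval k x" by (simp add: both_def eval_def)
      then show ?thesis by simp
    qed
  qed
  also have "spmf (bind_spmf ?D (\<lambda>k. bind_spmf ?U (\<lambda>x. return_spmf (ceval (C \<eta> k) x = [True])))) True \<le> \<delta>"
    by (rule uniform_input_evasive) (use evas assms(5) in auto)
  finally have "1 - \<epsilon> - \<delta> \<le> spmf (bind_spmf ?D (\<lambda>k. bind_spmf ?U (both k))) True" by simp
  also have "bind_spmf ?D (\<lambda>k. bind_spmf ?U (both k)) = bind_spmf ?D (\<lambda>k. bind_spmf (spmf_of_set (cube (inputs (C \<eta> k)))) (both k))"
    by (rule bind_spmf_cong[OF refl]) (simp add: inp)
  \<comment> \<open>The half of the challenges drawn from the preimage is estimated by 0, whence the
    factor 2.\<close>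
  also have "spmf \<dots> True \<le> 2 * spmf (trivial_experiment True Obf D_identical C D Eval (\<lambda>_. return_pmf [False]) \<eta>) True"
    unfolding exp spmf_coin_bind by simp
  also have "spmf (trivial_experiment True Obf D_identical C D Eval (\<lambda>_. return_pmf [False]) \<eta>) True
      \<le> p_trivial_to True Obf D_identical C D \<eta>"
    unfolding p_trivial_to_def
    by (rule cSUP_upper2[where x = "(Eval, \<lambda>_. return_pmf [False])"])
      (auto intro!: bdd_aboveI[of _ 1] simp: pmf_le_1)
  also have "\<dots> \<le> p_triv Obf D_identical C D \<eta>" by (simp add: p_triv_def)
  finally show ?thesis by (simp add: field_simps)
qed

text \<open>Evasiveness speaks of \<open>DF\<close>; statistical closeness transfers it to keys at
  the price of \<open>\<epsilon>'\<close>. The last bound holds because a circuit with a preimage of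
  1 accepts one of only \<open>2 ^ n \<eta>\<close> inputs: if that number were small, some fixed
  input would be accepted too often.\<close>

lemma preimage_samplable_evasive_bounds:
  assumes pse: "preimage_samplable_evasive n F DF K CF D"
  obtains \<delta> where "negligible \<delta>" "\<And>\<eta>. 0 \<le> \<delta> \<eta>"
    "\<And>\<eta> x. x \<in> cube (n \<eta>) \<Longrightarrow> measure_pmf.prob (D \<eta>) {k. ceval (CF \<eta> k) x = [True]} \<le> \<delta> \<eta>"
    "negligible (\<lambda>\<eta>. 1 / 2 ^ n \<eta>)"
proof -
  obtain \<epsilon> where \<epsilon>: "negligible \<epsilon>"
    "\<And>\<eta> x. x \<in> cube (n \<eta>) \<Longrightarrow> measure_pmf.prob (DF \<eta>) {f. f x = [True]} \<le> \<epsilon> \<eta>"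
    using pse by (auto simp: preimage_samplable_evasive_def evasive_def)
  obtain \<epsilon>' where \<epsilon>': "negligible \<epsilon>'" "\<And>\<eta> A. \<bar>measure_pmf.prob (map_pmf (\<lambda>k. functionality (CF \<eta> k)) (D \<eta>)) A
      - measure_pmf.prob (DF \<eta>) A\<bar> \<le> \<epsilon>' \<eta>"
    using pse by (auto simp: preimage_samplable_evasive_def implements_dist_def stat_indist_def)
  have pos: "0 \<le> \<epsilon> \<eta>" "0 \<le> \<epsilon>' \<eta>" for \<eta>
  proof -
    show "0 \<le> \<epsilon> \<eta>"
      by (rule order_trans[OF measure_nonneg \<epsilon>(2)[of "replicate (n \<eta>) True" \<eta>]]) (simp add: cube_def)
    show "0 \<le> \<epsilon>' \<eta>" using \<epsilon>'(2)[of \<eta> "{}"] by simp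
  qed
  have circ: "inputs (CF \<eta> k) = n \<eta>" if "k \<in> set_pmf (D \<eta>)" for \<eta> k
    using pse that unfolding preimage_samplable_evasive_def implements_dist_def implements_def
      keyed_circuit_class_def circuits_def by blast
  have pre: "preimage_one (CF \<eta> k) \<noteq> {}" if "k \<in> set_pmf (D \<eta>)" for \<eta> k
    using pse that unfolding preimage_samplable_evasive_def by blast
  have prob: "measure_pmf.prob (map_pmf (\<lambda>k. functionality (CF \<eta> k)) (D \<eta>)) {f. f x = [True]}
      = measure_pmf.prob (D \<eta>) {k. ceval (CF \<eta> k) x = [True]}" if "x \<in> cube (n \<eta>)" for \<eta> x
    unfolding measure_map_pmf
    by (rule measure_pmf.finite_measure_eq_AE) (use that circ in \<open>auto simp: AE_measure_pmf_iff functionality_def\<close>)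
  have bound: "1 / 2 ^ n \<eta> \<le> \<epsilon> \<eta> + \<epsilon>' \<eta>" for \<eta>
  proof -
    \<comment> \<open>The event that the function takes the value 1 somewhere. It is certain for
      sampled keys, is compared with \<open>DF\<close> as a single event so that
      \<open>\<epsilon>'\<close> is paid once, and only then split by a union bound.\<close>
    let ?A = "\<Union>x\<in>cube (n \<eta>). {f. f x = [True]}"
    have "1 = measure_pmf.prob (map_pmf (\<lambda>k. functionality (CF \<eta> k)) (D \<eta>)) ?A"
    proof -
      have "\<exists>x\<in>cube (n \<eta>). functionality (CF \<eta> k) x = [True]" if k: "k \<in> set_pmf (D \<eta>)" for k
      proof -
        obtain x where "x \<in> preimage_one (CF \<eta> k)" using pre[OF k] by blast
        then show ?thesis
          using circ[OF k] by (intro bexI[of _ x]) (simp_all add: preimage_one_def functionality_def)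
      qed
      then show ?thesis
        by (subst eq_commute, subst measure_pmf.prob_eq_1) (simp_all add: AE_measure_pmf_iff)
    qed
    also have "\<dots> \<le> measure_pmf.prob (DF \<eta>) ?A + \<epsilon>' \<eta>"
      using \<epsilon>'(2)[of \<eta> ?A] by linarith
    also have "measure_pmf.prob (DF \<eta>) ?A \<le> (\<Sum>x\<in>cube (n \<eta>). measure_pmf.prob (DF \<eta>) {f. f x = [True]})"
      by (rule measure_pmf.finite_measure_subadditive_finite) auto
    also have "\<dots> \<le> (\<Sum>x\<in>cube (n \<eta>). \<epsilon> \<eta>)" by (rule sum_mono) (rule \<epsilon>(2))
    finally have "1 \<le> 2 ^ n \<eta> * \<epsilon> \<eta> + \<epsilon>' \<eta>" by (simp add: card_cube)
    also have "\<dots> \<le> 2 ^ n \<eta> * (\<epsilon> \<eta> + \<epsilon>' \<eta>)"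
      using pos[of \<eta>] mult_right_mono[of 1 "2 ^ n \<eta>" "\<epsilon>' \<eta>"] by (simp add: distrib_left)
    finally show ?thesis by (simp add: divide_le_eq mult.commute)
  qed
  show ?thesis
  proof (rule that)
    show "negligible (\<lambda>\<eta>. \<epsilon> \<eta> + \<epsilon>' \<eta>)" by (intro negligible_add \<epsilon> \<epsilon>')
    show "0 \<le> \<epsilon> \<eta> + \<epsilon>' \<eta>" for \<eta> using pos[of \<eta>] by simp
    show "measure_pmf.prob (D \<eta>) {k. ceval (CF \<eta> k) x = [True]} \<le> \<epsilon> \<eta> + \<epsilon>' \<eta>" if "x \<in> cube (n \<eta>)" for \<eta> x
      using \<epsilon>(2)[OF that] \<epsilon>'(2)[of \<eta> "{f. f x = [True]}"] unfolding prob[OF that] by linarith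
    show "negligible (\<lambda>\<eta>. 1 / 2 ^ n \<eta>)"
      by (rule negligible_mono[where g = "\<lambda>\<eta>. \<epsilon> \<eta> + \<epsilon>' \<eta>"])
        (intro negligible_add \<epsilon> \<epsilon>', use bound in simp)
  qed
qed

section \<open>The reduction\<close>

lemma comp_indist_gap:
  assumes "comp_indist X Y" "QPT c"
  obtains \<epsilon> where "negligible \<epsilon>"
    "\<And>\<eta>. \<bar>spmf (bind_spmf (X \<eta>) (\<lambda>z. outcome c (secpar \<eta> # z))) [True]
      - spmf (bind_spmf (Y \<eta>) (\<lambda>z. outcome c (secpar \<eta> # z))) [True]\<bar> \<le> \<epsilon> \<eta>"
  using assms that unfolding comp_indist_def by blast

lemma UPO_anti_piracy:
  assumes pse: "preimage_samplable_evasive n F DF K CF D"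
    and upo: "generalized_UPO Id_U Obf Eval"
    and A: "QPT A" and AB: "QPT AB" and AC: "QPT AC"
  shows "\<exists>\<epsilon>. negligible \<epsilon> \<and> (\<forall>\<eta>.
    spmf (piracy_experiment Obf D_identical CF D A AB AC \<eta>) True \<le> p_triv Obf D_identical CF D \<eta> + \<epsilon> \<eta>)"
proof -
  let ?g = "\<lambda>\<eta> w x. game Obf A AB AC \<eta> w x vacuum"
  let ?U = "\<lambda>\<eta>. spmf_of_set (cube (n \<eta>))"
  let ?D = "\<lambda>\<eta>. spmf_of_pmf (D \<eta>)"
  let ?pre = "\<lambda>\<eta> k. spmf_of_set (preimage_one (CF \<eta> k))"
  let ?\<mu> = "\<lambda>\<eta>. encode (const_one (n \<eta>))"
  let ?is = "\<lambda>b u. u = ([b], [b])"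
  have Obf: "QPT Obf" and corr: "\<And>n m K C. keyed_circuit_class n m K C \<Longrightarrow> correct Obf Eval n K C"
    and sec: "\<And>n m K C P. generalized_puncturable n m K C P \<Longrightarrow> negligible (\<lambda>\<eta>. 1 / 2 ^ n \<eta>) \<Longrightarrow>
      upo_secure Obf Id_U n m K C P"
    using upo unfolding generalized_UPO_def by blast+
  have kcc: "keyed_circuit_class n (\<lambda>_. 1) K CF" and DK: "\<And>\<eta>. set_pmf (D \<eta>) \<subseteq> K \<eta>"
    and pre: "\<And>\<eta> k. k \<in> set_pmf (D \<eta>) \<Longrightarrow> preimage_one (CF \<eta> k) \<noteq> {}"
    and DF: "efficiently_samplable_fun n (\<lambda>_. 1) DF"
    using pse unfolding preimage_samplable_evasive_def implements_dist_def implements_def evasive_def by blast+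
  obtain K' C' P D' where gp: "generalized_puncturable n (\<lambda>_. 1) K' C' P"
    and D'K: "\<And>\<eta>. set_pmf (D' \<eta>) \<subseteq> K' \<eta>" and D': "efficiently_samplable D'"
    and ind: "comp_indist
          (\<lambda>\<eta>. do { k \<leftarrow> ?D \<eta>; x \<leftarrow> ?pre \<eta> k; return_spmf [encode (CF \<eta> k), x] })
          (\<lambda>\<eta>. do { k' \<leftarrow> spmf_of_pmf (D' \<eta>); y \<leftarrow> ?U \<eta>;
                    w \<leftarrow> outcome P [secpar \<eta>, k', y, y, ?\<mu> \<eta>, ?\<mu> \<eta>]; return_spmf [w, y] })"
    using pse unfolding preimage_samplable_evasive_def by blast
  let ?D' = "\<lambda>\<eta>. spmf_of_pmf (D' \<eta>)"
  let ?P = "\<lambda>\<eta> k y. outcome P [secpar \<eta>, k, y, y, ?\<mu> \<eta>, ?\<mu> \<eta>]"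
  obtain sd where sd: "QPT sd" "\<And>\<eta>. outcome sd [secpar \<eta>] = ?D' \<eta>"
    using D' unfolding efficiently_samplable_def by blast
  obtain sf where sf: "QPT sf" "\<And>\<eta>. set_spmf (outcome sf [secpar \<eta>]) \<subseteq> encode ` circuits (n \<eta>) 1"
    using DF unfolding efficiently_samplable_fun_def by blast
  obtain \<delta> where \<delta>: "negligible \<delta>" "\<And>\<eta>. 0 \<le> \<delta> \<eta>"
    "\<And>\<eta> x. x \<in> cube (n \<eta>) \<Longrightarrow> measure_pmf.prob (D \<eta>) {k. ceval (CF \<eta> k) x = [True]} \<le> \<delta> \<eta>"
    and n: "negligible (\<lambda>\<eta>. 1 / 2 ^ n \<eta>)"
    using preimage_samplable_evasive_bounds[OF pse] by blast
  have circ: "CF \<eta> k \<in> circuits (n \<eta>) 1" if "k \<in> set_pmf (D \<eta>)" for \<eta> k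
    using kcc DK that unfolding keyed_circuit_class_def by blast
  have inp: "inputs (CF \<eta> k) = n \<eta>" if "k \<in> set_pmf (D \<eta>)" for \<eta> k
    using circ[OF that] by (simp add: circuits_def)
  note progs = QPT_programs[OF Obf A AB AC]

  obtain \<epsilon>0 where \<epsilon>0: "negligible \<epsilon>0" "\<And>\<eta> k x. k \<in> K \<eta> \<Longrightarrow> x \<in> cube (n \<eta>) \<Longrightarrow> 1 - \<epsilon>0 \<eta> \<le>
      spmf (do { (out, qout, q) \<leftarrow> call Obf [secpar \<eta>, encode (CF \<eta> k)] [] vacuum;
                 (y, _) \<leftarrow> call Eval [secpar \<eta>, x, out 0] [qout 0] q;
                 return_spmf (y 0 = ceval (CF \<eta> k) x) }) True"
    using corr[OF kcc] unfolding correct_def by blast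
  have triv: "1 / 2 - (\<epsilon>0 \<eta> + \<delta> \<eta>) / 2 \<le> p_triv Obf D_identical CF D \<eta>" for \<eta>
    by (rule p_triv_ge[OF pre circ \<epsilon>0(2) \<delta>(3) \<delta>(2)]) (use DK in auto)

  \<comment> \<open>
    \<open>P1\<close>, \<open>P2\<close> are the two halves of the piracy game; \<open>P1 - Q1\<close> and \<open>P2 - Q2\<close> are negligible by preimage
    samplability, \<open>Q1 - Q1'\<close> and \<open>Q2 + Q1' - 1\<close> are at most negligible by security of the obfuscation.
  \<close>
  define P1 where "P1 \<eta> = spmf (do { k \<leftarrow> ?D \<eta>; x \<leftarrow> ?U \<eta>; map_spmf (?is False) (?g \<eta> (encode (CF \<eta> k)) x) }) True" for \<eta>
  define P2 where "P2 \<eta> = spmf (do { k \<leftarrow> ?D \<eta>; x \<leftarrow> ?pre \<eta> k; map_spmf (?is True) (?g \<eta> (encode (CF \<eta> k)) x) }) True" for \<eta>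
  define Q1 where "Q1 \<eta> = spmf (do { k \<leftarrow> ?D' \<eta>; y \<leftarrow> ?U \<eta>; G \<leftarrow> ?P \<eta> k y; x \<leftarrow> ?U \<eta>; map_spmf (?is False) (?g \<eta> G x) }) True" for \<eta>
  define Q1' where "Q1' \<eta> = spmf (do { k \<leftarrow> ?D' \<eta>; x \<leftarrow> ?U \<eta>; map_spmf (?is False) (?g \<eta> (encode (C' \<eta> k)) x) }) True" for \<eta>
  define Q2 where "Q2 \<eta> = spmf (do { k \<leftarrow> ?D' \<eta>; y \<leftarrow> ?U \<eta>; G \<leftarrow> ?P \<eta> k y; map_spmf (?is True) (?g \<eta> G y) }) True" for \<eta>

  \<comment> \<open>The correct answer on a uniform challenge is replaced by 0. Where the circuit
    accepts, the pirate is counted as winning, which costs \<open>\<delta> \<eta>\<close>.\<close>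
  have piracy: "spmf (piracy_experiment Obf D_identical CF D A AB AC \<eta>) True \<le> (P1 \<eta> + \<delta> \<eta> + P2 \<eta>) / 2" for \<eta>
  proof -
    let ?w = "\<lambda>k x. map_spmf (\<lambda>u. u = (ceval (CF \<eta> k) x, ceval (CF \<eta> k) x)) (?g \<eta> (encode (CF \<eta> k)) x)"
    have "spmf (bind_spmf (?D \<eta>) (\<lambda>k. bind_spmf (spmf_of_set (cube (inputs (CF \<eta> k)))) (?w k))) True
      = spmf (bind_spmf (?D \<eta>) (\<lambda>k. bind_spmf (?U \<eta>) (?w k))) True"
      by (rule arg_cong[where f = "\<lambda>p. spmf p True"], rule bind_spmf_cong[OF refl]) (simp add: inp)
    also have "\<dots> \<le> P1 \<eta> + spmf (bind_spmf (?D \<eta>) (\<lambda>k. bind_spmf (?U \<eta>) (\<lambda>x. return_spmf (ceval (CF \<eta> k) x = [True])))) True"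
      unfolding P1_def
    proof (intro spmf_bind_le_add)
      fix k x assume "k \<in> set_spmf (?D \<eta>)"
      then consider "ceval (CF \<eta> k) x = [True]" | "ceval (CF \<eta> k) x = [False]"
        using ceval_bit[OF circ[of k \<eta>], of x] by auto
      then show "spmf (?w k x) True \<le> spmf (map_spmf (?is False) (?g \<eta> (encode (CF \<eta> k)) x)) True
          + spmf (return_spmf (ceval (CF \<eta> k) x = [True])) True"
      proof cases
        case 1
        then show ?thesis using pmf_le_1[of "?w k x" "Some True"] by (simp add: add_increasing)
      next
        case 2
        then show ?thesis by simp
      qed
    qed
    also have "spmf (bind_spmf (?D \<eta>) (\<lambda>k. bind_spmf (?U \<eta>) (\<lambda>x. return_spmf (ceval (CF \<eta> k) x = [True])))) True \<le> \<delta> \<eta>"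
      by (rule uniform_input_evasive[OF \<delta>(3) \<delta>(2)])
    finally have 1: "spmf (bind_spmf (?D \<eta>) (\<lambda>k. bind_spmf (spmf_of_set (cube (inputs (CF \<eta> k)))) (?w k))) True
      \<le> P1 \<eta> + \<delta> \<eta>" by simp
    have 2: "bind_spmf (?D \<eta>) (\<lambda>k. bind_spmf (?pre \<eta> k) (?w k))
        = (do { k \<leftarrow> ?D \<eta>; x \<leftarrow> ?pre \<eta> k; map_spmf (?is True) (?g \<eta> (encode (CF \<eta> k)) x) })"
    proof (intro bind_spmf_cong refl)
      fix k x assume "x \<in> set_spmf (?pre \<eta> k)"
      then have "ceval (CF \<eta> k) x = [True]" by (auto simp: set_spmf_of_set preimage_one_def split: if_splits)
      then show "?w k x = map_spmf (?is True) (?g \<eta> (encode (CF \<eta> k)) x)" by simp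
    qed
    have "piracy_experiment Obf D_identical CF D A AB AC \<eta> = bind_spmf (?D \<eta>) (\<lambda>k. bind_spmf coin_spmf (\<lambda>b.
        bind_spmf (spmf_of_set (if b then cube (inputs (CF \<eta> k)) else preimage_one (CF \<eta> k))) (?w k)))"
      by (subst piracy_experiment_game[where D = D and \<eta> = \<eta> and C = CF, OF pre])
        (simp_all only: map_spmf_conv_bind_spmf)
    then have "spmf (piracy_experiment Obf D_identical CF D A AB AC \<eta>) True
      = (spmf (bind_spmf (?D \<eta>) (\<lambda>k. bind_spmf (spmf_of_set (cube (inputs (CF \<eta> k)))) (?w k))) True + P2 \<eta>) / 2"
      unfolding P2_def 2[symmetric] by (simp only: spmf_coin_bind if_True if_False)
    with 1 show ?thesis by simp
  qed

  \<comment> \<open>The distinguisher plays at the very point it is given: a preimage of 1 on one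
    side, the punctured point on the other.\<close>
  obtain \<epsilon>2 where \<epsilon>2: "negligible \<epsilon>2" "\<And>\<eta>. \<bar>P2 \<eta> - Q2 \<eta>\<bar> \<le> \<epsilon>2 \<eta>"
  proof (rule comp_indist_gap[OF ind progs(1)[of True]])
    fix \<epsilon>
    assume "negligible \<epsilon>" and gap: "\<And>\<eta>. \<bar>spmf (bind_spmf (do { k \<leftarrow> ?D \<eta>; x \<leftarrow> ?pre \<eta> k; return_spmf [encode (CF \<eta> k), x] })
          (\<lambda>z. outcome (distinguisher Obf A AB AC True) (secpar \<eta> # z))) [True]
        - spmf (bind_spmf (do { k' \<leftarrow> ?D' \<eta>; y \<leftarrow> ?U \<eta>; w \<leftarrow> ?P \<eta> k' y; return_spmf [w, y] })
          (\<lambda>z. outcome (distinguisher Obf A AB AC True) (secpar \<eta> # z))) [True]\<bar> \<le> \<epsilon> \<eta>"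
    have "\<bar>P2 \<eta> - Q2 \<eta>\<bar> \<le> \<epsilon> \<eta>" for \<eta>
      using gap[of \<eta>] unfolding P2_def Q2_def bind_spmf_assoc return_bind_spmf outcome_distinguisher
      unfolding spmf_bind spmf_verdict .
    with \<open>negligible \<epsilon>\<close> show thesis by (rule that)
  qed

  \<comment> \<open>Here the challenge must be independent of the given point, so the distinguisher
    draws its own.\<close>
  obtain \<epsilon>1 where \<epsilon>1: "negligible \<epsilon>1" "\<And>\<eta>. \<bar>P1 \<eta> - Q1 \<eta>\<bar> \<le> \<epsilon>1 \<eta>"
  proof (rule comp_indist_gap[OF ind progs(2)[of False]])
    fix \<epsilon>
    assume "negligible \<epsilon>" and gap: "\<And>\<eta>. \<bar>spmf (bind_spmf (do { k \<leftarrow> ?D \<eta>; x \<leftarrow> ?pre \<eta> k; return_spmf [encode (CF \<eta> k), x] })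
          (\<lambda>z. outcome (sampling_distinguisher Obf A AB AC False) (secpar \<eta> # z))) [True]
        - spmf (bind_spmf (do { k' \<leftarrow> ?D' \<eta>; y \<leftarrow> ?U \<eta>; w \<leftarrow> ?P \<eta> k' y; return_spmf [w, y] })
          (\<lambda>z. outcome (sampling_distinguisher Obf A AB AC False) (secpar \<eta> # z))) [True]\<bar> \<le> \<epsilon> \<eta>"
    have P1: "(do { k \<leftarrow> ?D \<eta>; z \<leftarrow> ?pre \<eta> k; x \<leftarrow> spmf_of_set (cube (length z));
          map_spmf (?is False) (?g \<eta> (encode (CF \<eta> k)) x) })
        = (do { k \<leftarrow> ?D \<eta>; x \<leftarrow> ?U \<eta>; map_spmf (?is False) (?g \<eta> (encode (CF \<eta> k)) x) })" for \<eta>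
    proof (rule bind_spmf_cong[OF refl])
      fix k assume "k \<in> set_spmf (?D \<eta>)"
      then have k: "k \<in> set_pmf (D \<eta>)" by simp
      have fin: "finite (preimage_one (CF \<eta> k))" by (simp add: preimage_one_def)
      let ?h = "\<lambda>x. map_spmf (?is False) (?g \<eta> (encode (CF \<eta> k)) x)"
      have "bind_spmf (?pre \<eta> k) (\<lambda>z. bind_spmf (spmf_of_set (cube (length z))) ?h)
          = bind_spmf (?pre \<eta> k) (\<lambda>_. bind_spmf (?U \<eta>) ?h)"
      proof (rule bind_spmf_cong[OF refl])
        fix z assume "z \<in> set_spmf (?pre \<eta> k)"
        then have "length z = n \<eta>"
          using fin inp[OF k] by (simp add: set_spmf_of_set preimage_one_def cube_def)
        then show "bind_spmf (spmf_of_set (cube (length z))) ?h = bind_spmf (?U \<eta>) ?h" by simp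
      qed
      \<comment> \<open>Discarding the preimage loses no mass because the preimage is
        nonempty.\<close>
      also have "\<dots> = bind_spmf (?U \<eta>) ?h"
        using fin pre[OF k] by (simp add: bind_spmf_const lossless_weight_spmfD)
      finally show "bind_spmf (?pre \<eta> k) (\<lambda>z. bind_spmf (spmf_of_set (cube (length z))) ?h) = bind_spmf (?U \<eta>) ?h" .
    qed
    have Q1: "(do { k \<leftarrow> ?D' \<eta>; y \<leftarrow> ?U \<eta>; G \<leftarrow> ?P \<eta> k y; x \<leftarrow> spmf_of_set (cube (length y)); map_spmf (?is False) (?g \<eta> G x) })
        = (do { k \<leftarrow> ?D' \<eta>; y \<leftarrow> ?U \<eta>; G \<leftarrow> ?P \<eta> k y; x \<leftarrow> ?U \<eta>; map_spmf (?is False) (?g \<eta> G x) })" for \<eta>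
    proof (rule bind_spmf_cong[OF refl], rule bind_spmf_cong[OF refl])
      fix k y assume "y \<in> set_spmf (?U \<eta>)"
      then have "length y = n \<eta>" by (simp add: cube_def set_spmf_of_set split: if_splits)
      then show "(do { G \<leftarrow> ?P \<eta> k y; x \<leftarrow> spmf_of_set (cube (length y)); map_spmf (?is False) (?g \<eta> G x) })
        = (do { G \<leftarrow> ?P \<eta> k y; x \<leftarrow> ?U \<eta>; map_spmf (?is False) (?g \<eta> G x) })" by simp
    qed
    have "\<bar>P1 \<eta> - Q1 \<eta>\<bar> \<le> \<epsilon> \<eta>" for \<eta>
      using gap[of \<eta>]
      unfolding P1_def Q1_def P1[symmetric] Q1[symmetric] bind_spmf_assoc return_bind_spmf
        outcome_sampling_distinguisher
      unfolding spmf_bind spmf_verdict .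
    with \<open>negligible \<epsilon>\<close> show thesis by (rule that)
  qed

  have secure: "upo_secure Obf Id_U n (\<lambda>_. 1) K' C' P" by (rule sec[OF gp n])
  have drop: "bind_spmf (?U \<eta>) (\<lambda>_. p) = p" for \<eta> and p :: "bool spmf"
    by (simp add: bind_spmf_const lossless_weight_spmfD)
  note QS = QPT_opening_prog[OF sd(1) sf(1)]

  \<comment> \<open>The pirate's answers are the guesses. With challenge bit 1 both must answer 1 at
    the punctured point, which is \<open>Q2\<close>; with bit 0 both must answer 0 about the
    unpunctured circuit, which is \<open>Q1'\<close>.\<close>
  obtain \<epsilon>4 where \<epsilon>4: "negligible \<epsilon>4" "\<And>\<eta>. (Q2 \<eta> + Q1' \<eta>) / 2 \<le> 1 / 2 + \<epsilon>4 \<eta>"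
  proof -
    obtain \<epsilon> where \<epsilon>: "negligible \<epsilon>" "\<And>\<eta>. spmf (upo_experiment Obf Id_U n (\<lambda>_. 1) K' C' P
        (opening_prog sd sf) (pirate A) AB AC \<eta>) True \<le> 1 / 2 + \<epsilon> \<eta>"
      using secure QS progs(4) AB AC unfolding upo_secure_def by blast
    have R: "(do {
       (\<rho>, q\<rho>, q) \<leftarrow> call Obf [secpar \<eta>, w] [] q;
       (\<sigma>, q\<sigma>, q) \<leftarrow> call (pirate A) [secpar \<eta>, x, \<rho> 0] [[], q\<rho> 0] q;
       (bB, _, q) \<leftarrow> call AB [secpar \<eta>, y, \<sigma> 0] [q\<sigma> 0] q;
       (bC, _, q) \<leftarrow> call AC [secpar \<eta>, y, \<sigma> 1] [q\<sigma> 1] q;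
       return_spmf (bB 0 = [b] \<and> bC 0 = [b]) }) = map_spmf (?is b) (?g \<eta> w y)"
      if "valid_qmem q" for \<eta> b w x y q
    proof -
      have "(do {
       (\<rho>, q\<rho>, q) \<leftarrow> call Obf [secpar \<eta>, w] [] q;
       (\<sigma>, q\<sigma>, q) \<leftarrow> call (pirate A) [secpar \<eta>, x, \<rho> 0] [[], q\<rho> 0] q;
       (bB, _, q) \<leftarrow> call AB [secpar \<eta>, y, \<sigma> 0] [q\<sigma> 0] q;
       (bC, _, q) \<leftarrow> call AC [secpar \<eta>, y, \<sigma> 1] [q\<sigma> 1] q;
       return_spmf (bB 0 = [b] \<and> bC 0 = [b]) }) = (do {
       (\<rho>, q\<rho>, q) \<leftarrow> call Obf [secpar \<eta>, w] [] q;
       (\<sigma>, q\<sigma>, q) \<leftarrow> call A [secpar \<eta>, \<rho> 0] [q\<rho> 0] q;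
       (bB, _, q) \<leftarrow> call AB [secpar \<eta>, y, \<sigma> 0] [q\<sigma> 0] q;
       (bC, _, q) \<leftarrow> call AC [secpar \<eta>, y, \<sigma> 1] [q\<sigma> 1] q;
       return_spmf (bB 0 = [b] \<and> bC 0 = [b]) })"
        by (subst call_pirate) (simp_all add: vars_def)
      also have "\<dots> = map_spmf (?is b) (game Obf A AB AC \<eta> w y q)"
        unfolding map_spmf_conv_bind_spmf o_def game_bind by simp
      finally show ?thesis unfolding game_junk[OF that] .
    qed
    have "spmf (upo_experiment Obf Id_U n (\<lambda>_. 1) K' C' P (opening_prog sd sf) (pirate A) AB AC \<eta>) True
      = (Q2 \<eta> + Q1' \<eta>) / 2" for \<eta>
      by (subst upo_experiment_opening[where D' = D' and
            R = "\<lambda>b w x y. map_spmf (?is b) (?g \<eta> w y)", OF gp D'K sd sf])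
        (erule R, simp only: Q2_def Q1'_def drop)
    with \<epsilon> that show thesis by metis
  qed

  \<comment> \<open>The inner pirate plays at the string \<open>x\<close> from the opening stage and
    guesses 1 exactly if both answers are 0. It wins with probability \<open>Q1\<close> for bit 1
    and \<open>1 - Q1'\<close> for bit 0. The verdict is classical, so both parties can hold
    it.\<close>
  obtain \<epsilon>3 where \<epsilon>3: "negligible \<epsilon>3" "\<And>\<eta>. (Q1 \<eta> + (1 - Q1' \<eta>)) / 2 \<le> 1 / 2 + \<epsilon>3 \<eta>"
  proof -
    let ?A2 = "inner_pirate A AB AC False"
    obtain \<epsilon> where \<epsilon>: "negligible \<epsilon>" "\<And>\<eta>. spmf (upo_experiment Obf Id_U n (\<lambda>_. 1) K' C' P
        (opening_prog sd sf) ?A2 forward_prog forward_prog \<eta>) True \<le> 1 / 2 + \<epsilon> \<eta>"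
      using secure QS progs(3)[of False] progs(5) unfolding upo_secure_def by blast
    have R: "(do {
       (\<rho>, q\<rho>, q) \<leftarrow> call Obf [secpar \<eta>, w] [] q;
       (\<sigma>, q\<sigma>, q) \<leftarrow> call ?A2 [secpar \<eta>, x, \<rho> 0] [[], q\<rho> 0] q;
       (bB, _, q) \<leftarrow> call forward_prog [secpar \<eta>, y, \<sigma> 0] [q\<sigma> 0] q;
       (bC, _, q) \<leftarrow> call forward_prog [secpar \<eta>, y, \<sigma> 1] [q\<sigma> 1] q;
       return_spmf (bB 0 = [b] \<and> bC 0 = [b]) }) = map_spmf (\<lambda>u. ?is False u = b) (?g \<eta> w x)"
      if "valid_qmem q" for \<eta> b w x y q
    proof -
      have fwd: "bind_spmf (call forward_prog [a, a', c] qs q) (\<lambda>(v, _, q). h (v 0) q) = h c q"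
        for a a' c qs q and h :: "bits \<Rightarrow> qmem \<Rightarrow> bool spmf"
      proof -
        have "bind_spmf (call forward_prog [a, a', c] qs q) (\<lambda>(v, _, q). h (v 0) q)
          = bind_spmf (map_spmf (\<lambda>(v, _, q). (v 0, q)) (call forward_prog [a, a', c] qs q)) (\<lambda>(x, q). h x q)"
          by (simp add: bind_map_spmf o_def split_def)
        then show ?thesis by (simp add: call_forward_prog)
      qed
      have A2: "bind_spmf (call ?A2 [secpar \<eta>, x, \<rho>] [[], w] q) (\<lambda>(\<sigma>, _, _). return_spmf (\<sigma> 0 = [b] \<and> \<sigma> 1 = [b]))
        = map_spmf (\<lambda>u. ?is False u = b) (play A AB AC \<eta> x \<rho> w q)" for \<rho> w q
      proof -
        have "bind_spmf (call ?A2 [secpar \<eta>, x, \<rho>] [[], w] q) (\<lambda>(\<sigma>, _, _). return_spmf (\<sigma> 0 = [b] \<and> \<sigma> 1 = [b]))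
          = map_spmf (\<lambda>(s, t). s = [b] \<and> t = [b]) (map_spmf (\<lambda>(v, _, _). (v 0, v 1)) (call ?A2 [secpar \<eta>, x, \<rho>] [[], w] q))"
          by (simp add: map_spmf_conv_bind_spmf split_def)
        also have "\<dots> = map_spmf (\<lambda>u. ?is False u = b) (play A AB AC \<eta> x \<rho> w q)"
          unfolding call_inner_pirate by (simp add: spmf.map_comp o_def verdict_def)
        finally show ?thesis .
      qed
      have "(do {
       (\<rho>, q\<rho>, q) \<leftarrow> call Obf [secpar \<eta>, w] [] q;
       (\<sigma>, q\<sigma>, q) \<leftarrow> call ?A2 [secpar \<eta>, x, \<rho> 0] [[], q\<rho> 0] q;
       (bB, _, q) \<leftarrow> call forward_prog [secpar \<eta>, y, \<sigma> 0] [q\<sigma> 0] q;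
       (bC, _, q) \<leftarrow> call forward_prog [secpar \<eta>, y, \<sigma> 1] [q\<sigma> 1] q;
       return_spmf (bB 0 = [b] \<and> bC 0 = [b]) })
       = map_spmf (\<lambda>u. ?is False u = b) (game Obf A AB AC \<eta> w x q)"
        unfolding fwd[of _ _ _ _ _ "\<lambda>v q. return_spmf (u = [b] \<and> v = [b])" for u]
          fwd[of _ _ _ _ _ "\<lambda>u q. return_spmf (u = [b] \<and> v = [b])" for v] A2 game_def
        unfolding map_spmf_bind_spmf o_def by (simp add: split_def)
      then show ?thesis unfolding game_junk[OF that] .
    qed
    have Q1: "(do { k \<leftarrow> ?D' \<eta>; x \<leftarrow> ?U \<eta>; y \<leftarrow> ?U \<eta>; G \<leftarrow> ?P \<eta> k y; map_spmf (\<lambda>u. ?is False u = True) (?g \<eta> G x) })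
      = (do { k \<leftarrow> ?D' \<eta>; y \<leftarrow> ?U \<eta>; G \<leftarrow> ?P \<eta> k y; x \<leftarrow> ?U \<eta>; map_spmf (?is False) (?g \<eta> G x) })" for \<eta>
      by (rule bind_spmf_cong[OF refl], subst bind_commute_spmf, rule bind_spmf_cong[OF refl],
          subst bind_commute_spmf) simp
    \<comment> \<open>The complement \<open>1 - Q1'\<close> is the probability of the opposite
      verdict only if the whole game terminates with probability 1.\<close>
    have lossless: "lossless_spmf (do { k \<leftarrow> ?D' \<eta>; x \<leftarrow> ?U \<eta>; map_spmf (?is False) (?g \<eta> (encode (C' \<eta> k)) x) })" for \<eta>
    proof -
      have "lossless_spmf (?g \<eta> w x)" for w x
        using lossless_outcome[OF progs(1), of False "[secpar \<eta>, w, x]"] by (simp add: outcome_distinguisher)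
      then show ?thesis by simp
    qed
    have "spmf (do { k \<leftarrow> ?D' \<eta>; x \<leftarrow> ?U \<eta>; map_spmf (\<lambda>u. ?is False u = False) (?g \<eta> (encode (C' \<eta> k)) x) }) True
      = 1 - Q1' \<eta>" for \<eta>
    proof -
      let ?p = "do { k \<leftarrow> ?D' \<eta>; x \<leftarrow> ?U \<eta>; map_spmf (?is False) (?g \<eta> (encode (C' \<eta> k)) x) }"
      have "(do { k \<leftarrow> ?D' \<eta>; x \<leftarrow> ?U \<eta>; map_spmf (\<lambda>u. ?is False u = False) (?g \<eta> (encode (C' \<eta> k)) x) }) = map_spmf Not ?p"
        by (simp only: map_spmf_bind_spmf o_def spmf.map_comp eq_False)
      moreover have "spmf (map_spmf Not ?p) True = spmf ?p False"
        using spmf_map_inj'[of Not ?p False] by (simp add: inj_def)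
      ultimately show ?thesis using spmf_False_conv_True[OF lossless[of \<eta>]] unfolding Q1'_def by simp
    qed
    then have "spmf (upo_experiment Obf Id_U n (\<lambda>_. 1) K' C' P (opening_prog sd sf) ?A2 forward_prog forward_prog \<eta>) True
      = (Q1 \<eta> + (1 - Q1' \<eta>)) / 2" for \<eta>
      by (subst upo_experiment_opening[where D' = D' and
            R = "\<lambda>b w x y. map_spmf (\<lambda>u. ?is False u = b) (?g \<eta> w x)", OF gp D'K sd sf])
        (erule R, simp only: Q1_def drop Q1)
    with \<epsilon> that show thesis by metis
  qed

  \<comment> \<open>Each of the two piracy halves has weight 1/2, hence the factors of
    \<open>\<epsilon>1\<close> and \<open>\<epsilon>2\<close>; \<open>\<epsilon>3\<close> and
    \<open>\<epsilon>4\<close> bound experiments that already average over a bit. The term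
    \<open>\<delta>\<close> enters with 1/2 twice, through the pirate's uniform half and through the
    trivial attack, which also contributes half of \<open>\<epsilon>0\<close>.\<close>
  define \<epsilon> where "\<epsilon> \<eta> = 1 / 2 * \<epsilon>0 \<eta> + (\<delta> \<eta> + (1 / 2 * \<epsilon>1 \<eta> + (1 / 2 * \<epsilon>2 \<eta> + (\<epsilon>3 \<eta> + \<epsilon>4 \<eta>))))" for \<eta>
  have "negligible \<epsilon>"
    unfolding \<epsilon>_def by (intro negligible_add negligible_cmult \<epsilon>0 \<delta> \<epsilon>1 \<epsilon>2 \<epsilon>3 \<epsilon>4)
  moreover have "spmf (piracy_experiment Obf D_identical CF D A AB AC \<eta>) True \<le> p_triv Obf D_identical CF D \<eta> + \<epsilon> \<eta>" for \<eta>
    using triv[of \<eta>] piracy[of \<eta>] \<epsilon>1(2)[of \<eta>] \<epsilon>2(2)[of \<eta>] \<epsilon>3(2)[of \<eta>] \<epsilon>4(2)[of \<eta>]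
    unfolding \<epsilon>_def by (simp add: field_simps abs_le_iff)
  ultimately show ?thesis by blast
qed

theorem theorem2:
  fixes n :: "nat \<Rightarrow> nat"
    and F :: "nat \<Rightarrow> (bits \<Rightarrow> bits) set"
    and DF :: "nat \<Rightarrow> (bits \<Rightarrow> bits) pmf"
    and K :: "nat \<Rightarrow> bits set"
    and CF :: "nat \<Rightarrow> bits \<Rightarrow> circuit"
    and D :: "nat \<Rightarrow> bits pmf"
    and Obf Eval :: prog
  assumes "preimage_samplable_evasive n F DF K CF D"
    and "generalized_UPO Id_U Obf Eval"
  shows "\<exists>CopyProtect CPEval. CopyProtect = Obf \<and>
           copy_protection n (\<lambda>_. 1) F K CF CopyProtect CPEval \<and>
           anti_piracy n (\<lambda>_. 1) F DF D_identical K CF D CopyProtect"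
proof -
  have impl: "implements_dist n (\<lambda>_. 1) F DF K CF D"
    using assms(1) by (simp add: preimage_samplable_evasive_def)
  then have "copy_protection n (\<lambda>_. 1) F K CF Obf Eval"
    using assms(2) by (auto simp: copy_protection_def generalized_UPO_def implements_dist_def implements_def)
  moreover have "anti_piracy n (\<lambda>_. 1) F DF D_identical K CF D Obf"
    unfolding anti_piracy_def using impl UPO_anti_piracy[OF assms] by blast
  ultimately show ?thesis by blast
qed

end
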